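(* Suppose there exists an integer $d\ge 3$ such that for every integer $p\ge1$ there exists $k_0(d,p)$ such that for every $k\ge k_0(d,p)$ there exists a $p$-shuffle chain on $\mathcal{C}_k^{(d)}$ whose stationary distribution is the uniform distribution on $\mathcal{C}_k^{(d)}$. Then the Jacobian conjecture holds: for every $n\ge1$, every Keller map $F:\mathbb{C}^n\to\mathbb{C}^n$ is a polynomial automorphism.
   Context: For $d\ge2$, a $d$-Catalan tree is a rooted planar tree in which every vertex has $0$ or $d$ children (internal vertices have $d$); $\mathcal{C}_k^{(d)}$ is the set of such trees with $k$ internal vertices. The height of a vertex is its graph distance to the root. A path of length $p$ is $(v_0,\dots,v_p)$ with $v_i$ a child of $v_{i-1}$; every vertex $v$ of height $\ge p$ is the endpoint $v_p$ of a unique such path. For $1\le i\le p$ the $d-1$ siblings of $v_i$ subtend subtrees (sibling plus descendants); the shuffle class $\mathrm{Sh}_{T,p}(v)\subseteq\mathcal{C}_k^{(d)}$ is the set of trees obtained from $T$ by rearranging these $(d-1)p$ subtrees among the $(d-1)p$ sibling positions, all else fixed. A $p$-shuffle chain on $\mathcal{C}_k^{(d)}$ is specified by a family $\{P_T: T\in\mathcal{C}_k^{(d)}\}$ where $P_T$ is a probability measure on the vertex set $V(T)$ with $P_T(v)>0$ iff $v$ has height at least $p$; it is the Markov chain on $\mathcal{C}_k^{(d)}$ with transition probabilities $\mathbb{P}(T_{j+1}=T'\mid T_j=T)=\sum_{v\in V(T)}P_T(v)\,\mathbf{1}\{T'\in\mathrm{Sh}_{T,p}(v)\}/\#\mathrm{Sh}_{T,p}(v)$.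 A polynomial mapping $F:\mathbb{C}^n\to\mathbb{C}^n$ is a Keller map if $\det JF$ is a nonzero constant, and a polynomial automorphism if it has a polynomial two-sided compositional inverse. *)

theory Defs
  imports "HOL-Analysis.Analysis"
begin

datatype ptree = Node "ptree list"

fun children :: "ptree \<Rightarrow> ptree list" where
  "children (Node ts) = ts"

text \<open>Vertices are addressed by positions: the list of child indices from the root.
  The height of a vertex is the length of its position.\<close>

fun is_pos :: "ptree \<Rightarrow> nat list \<Rightarrow> bool" where
  "is_pos t [] = True"
| "is_pos t (i # is) = (i < length (children t) \<and> is_pos (children t ! i) is)"

definition vertices :: "ptree \<Rightarrow> nat list set" where
  "vertices t = {q. is_pos t q}"

fun subt :: "ptree \<Rightarrow> nat list \<Rightarrow> ptree" where
  "subt t [] = t"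
| "subt t (i # is) = subt (children t ! i) is"

fun replace :: "ptree \<Rightarrow> nat list \<Rightarrow> ptree \<Rightarrow> ptree" where
  "replace t [] u = u"
| "replace t (i # is) u = Node ((children t)[i := replace (children t ! i) is u])"

definition is_catalan :: "nat \<Rightarrow> ptree \<Rightarrow> bool" where
  "is_catalan d t \<longleftrightarrow>
     (\<forall>q \<in> vertices t. length (children (subt t q)) = 0 \<or> length (children (subt t q)) = d)"

definition internal_vertices :: "ptree \<Rightarrow> nat list set" where
  "internal_vertices t = {q \<in> vertices t. children (subt t q) \<noteq> []}"

definition catalan_trees :: "nat \<Rightarrow> nat \<Rightarrow> ptree set" where
  "catalan_trees d k = {t. is_catalan d t \<and> card (internal_vertices t) = k}"

text \<open>For a vertex \<open>v\<close> of height \<open>\<ge> p\<close>, the path of length \<open>p\<close> ending at \<open>v\<close> is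
  \<open>v_i = take (length v - p + i) v\<close>, \<open>0 \<le> i \<le> p\<close>.  The siblings of \<open>v_i\<close> (\<open>1 \<le> i \<le> p\<close>)
  are the positions \<open>take j v @ [c]\<close> with \<open>j = length v - p + i - 1\<close>, \<open>c < d\<close>, \<open>c \<noteq> v ! j\<close>.\<close>
definition sibling_positions :: "nat \<Rightarrow> nat \<Rightarrow> nat list \<Rightarrow> nat list set" where
  "sibling_positions d p v =
     {take j v @ [c] | j c. length v - p \<le> j \<and> j < length v \<and> c < d \<and> c \<noteq> v ! j}"

text \<open>Rearranging the subtrees subtended by the sibling positions \<open>S\<close> according to a
  permutation \<open>\<sigma>\<close> of \<open>S\<close>: the subtree of \<open>T\<close> at \<open>\<sigma> s\<close> is moved to position \<open>s\<close>.
  Since the positions in \<open>S\<close> are pairwise incomparable (no one is a prefix of another),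
  the order in which the replacements are carried out is irrelevant.\<close>
definition rearrange :: "ptree \<Rightarrow> nat list list \<Rightarrow> (nat list \<Rightarrow> nat list) \<Rightarrow> ptree" where
  "rearrange T xs \<sigma> = foldr (\<lambda>s t. replace t s (subt T (\<sigma> s))) xs T"

definition shuffle_class :: "nat \<Rightarrow> ptree \<Rightarrow> nat \<Rightarrow> nat list \<Rightarrow> ptree set" where
  "shuffle_class d T p v =
     {T'. \<exists>xs \<sigma>. distinct xs \<and> set xs = sibling_positions d p v \<and>
                 \<sigma> permutes sibling_positions d p v \<and> T' = rearrange T xs \<sigma>}"

definition is_shuffle_family :: "nat \<Rightarrow> nat \<Rightarrow> nat \<Rightarrow> (ptree \<Rightarrow> nat list \<Rightarrow> real) \<Rightarrow> bool" where
  "is_shuffle_family d p k P \<longleftrightarrow>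
     (\<forall>T \<in> catalan_trees d k.
        (\<forall>v \<in> vertices T. 0 \<le> P T v) \<and>
        (\<Sum>v \<in> vertices T. P T v) = 1 \<and>
        (\<forall>v \<in> vertices T. 0 < P T v \<longleftrightarrow> p \<le> length v))"

definition shuffle_trans :: "nat \<Rightarrow> nat \<Rightarrow> (ptree \<Rightarrow> nat list \<Rightarrow> real) \<Rightarrow> ptree \<Rightarrow> ptree \<Rightarrow> real" where
  "shuffle_trans d p P T T' =
     (\<Sum>v \<in> vertices T. P T v *
        (if T' \<in> shuffle_class d T p v then 1 / real (card (shuffle_class d T p v)) else 0))"

definition uniform_stationary :: "nat \<Rightarrow> nat \<Rightarrow> nat \<Rightarrow> (ptree \<Rightarrow> nat list \<Rightarrow> real) \<Rightarrow> bool" where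
  "uniform_stationary d p k P \<longleftrightarrow>
     (\<forall>T' \<in> catalan_trees d k.
        (\<Sum>T \<in> catalan_trees d k. (1 / real (card (catalan_trees d k))) * shuffle_trans d p P T T')
          = 1 / real (card (catalan_trees d k)))"

definition poly_fun :: "(complex ^ 'n \<Rightarrow> complex) \<Rightarrow> bool" where
  "poly_fun f \<longleftrightarrow>
     (\<exists>(S :: ('n \<Rightarrow> nat) set) (c :: ('n \<Rightarrow> nat) \<Rightarrow> complex). finite S \<and>
        (\<forall>x. f x = (\<Sum>m \<in> S. c m * (\<Prod>i \<in> UNIV. (x $ i) ^ m i))))"

definition poly_map :: "(complex ^ 'n \<Rightarrow> complex ^ 'n) \<Rightarrow> bool" where
  "poly_map F \<longleftrightarrow> (\<forall>i. poly_fun (\<lambda>x. F x $ i))"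

definition jacobian_matrix :: "(complex ^ 'n \<Rightarrow> complex ^ 'n) \<Rightarrow> complex ^ 'n \<Rightarrow> complex ^ 'n ^ 'n" where
  "jacobian_matrix F x =
     (\<chi> i j. deriv (\<lambda>t. F (\<chi> k. if k = j then t else x $ k) $ i) (x $ j))"

definition keller_map :: "(complex ^ 'n \<Rightarrow> complex ^ 'n) \<Rightarrow> bool" where
  "keller_map F \<longleftrightarrow> poly_map F \<and> (\<exists>c. c \<noteq> 0 \<and> (\<forall>x. det (jacobian_matrix F x) = c))"

definition poly_automorphism :: "(complex ^ 'n \<Rightarrow> complex ^ 'n) \<Rightarrow> bool" where
  "poly_automorphism F \<longleftrightarrow> poly_map F \<and> (\<exists>G. poly_map G \<and> G \<circ> F = id \<and> F \<circ> G = id)"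

end

theory Submission
  imports Defs "HOL-Library.Sublist" "HOL-Library.Function_Algebras"
    "HOL-Computational_Algebra.Fundamental_Theorem_Algebra"
begin

text \<open>
  By stable equivalence (Bass, Connell and Wright) it suffices to invert maps \<open>F = id - K\<close> whose
  perturbation \<open>K\<close> is homogeneous of degree \<open>d\<close>. Invertibility of the derivative everywhere then
  makes every \<open>JK(x)\<close> nilpotent, with a uniform exponent \<open>p\<close>. Let \<open>\<mu>\<close> be the symmetric multilinear
  form with diagonal \<open>K\<close>, and evaluate a \<open>d\<close>-Catalan tree at \<open>y\<close> by putting \<open>y\<close> at the leaves and
  \<open>\<mu>\<close> at the internal vertices; the formal inverse of \<open>F\<close> is the sum of the values of all trees.
  Polarising \<open>JK(x)^p = 0\<close> shows that the values of the trees of a \<open>p\<close>-shuffle class add up to zero.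
  If a \<open>p\<close>-shuffle chain on the trees with \<open>k\<close> internal vertices preserves the uniform
  distribution, then the constant function is a combination of indicators of shuffle classes, so the
  degree-\<open>k\<close> part of the inverse vanishes; as this holds for all large \<open>k\<close>, the inverse is polynomial.
\<close>

section \<open>Polarisation\<close>

text \<open>The reductions change the number of variables, so the dimension cannot be a type: once
  \<open>F\<close> is put in coordinates, all maps act on sequences of complex numbers and are the
  identity beyond some \<open>N\<close>. The Jacobian condition becomes injectivity of h +
  \<open>dpert L x h\<close> in h, which passes to more variables without determinants. Degrees are
  first brought down to 2 and 3 and then raised to exactly \<open>d\<close>; the cubic part receives
  the factor t^(d-3), whence \<open>3 \<le> d\<close>. Nilpotence comes from homogeneity: a scalar s
  in 1 - s A(x) is absorbed into the base point by a (d-1)-th root, so A(x) has no nonzero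
  eigenvalue; its image lies in the first N coordinates, so A(x)^(N+1) = 0. The exponent depends on
  the N reached after stabilisation, which is why chains are assumed for every p, whereas one d
  suffices. No power series occurs: once tree sums vanish for large k, their finite sum
  \<open>G\<close> solves the fixed point equation exactly and is a right inverse. That it is also a
  left inverse is a separate argument, resting on injectivity near 0.\<close>

definition multi_additive :: "'a set \<Rightarrow> (('a \<Rightarrow> 'v::ab_group_add) \<Rightarrow> 'w::ab_group_add) \<Rightarrow> bool" where
  "multi_additive S Q \<longleftrightarrow>
     (\<forall>z s a b. s \<in> S \<longrightarrow> Q (z(s := a + b)) = Q (z(s := a)) + Q (z(s := b)))"

lemma multi_additive_zero:
  assumes "multi_additive S Q" "s \<in> S"
  shows "Q (z(s := 0)) = 0"
  using assms unfolding multi_additive_def by (metis add_0 add_cancel_right_left)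

lemma multi_additive_sum:
  assumes "multi_additive S Q" "s \<in> S" "finite B"
  shows "Q (z(s := \<Sum>j\<in>B. w j)) = (\<Sum>j\<in>B. Q (z(s := w j)))"
  using assms(3)
proof (induction B rule: finite_induct)
  case empty
  show ?case unfolding sum.empty by (rule multi_additive_zero[OF assms(1,2)])
next
  case (insert j B)
  have "Q (z(s := w j + sum w B)) = Q (z(s := w j)) + Q (z(s := sum w B))"
    using assms(1,2) unfolding multi_additive_def by blast
  then show ?case unfolding sum.insert[OF insert.hyps] insert.IH .
qed

lemma multi_additive_expand:
  assumes Q: "multi_additive S Q" and "finite A" "A \<subseteq> S" "finite B"
  shows "Q (\<lambda>k. if k \<in> A then \<Sum>j\<in>B. w j else z k)
       = (\<Sum>\<phi>\<in>A \<rightarrow>\<^sub>E B. Q (\<lambda>k. if k \<in> A then w (\<phi> k) else z k))"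
  using assms(2,3)
proof (induction A arbitrary: z rule: finite_induct)
  case empty
  then show ?case by simp
next
  case (insert s A)
  let ?z = "\<lambda>k. if k \<in> A then \<Sum>j\<in>B. w j else z k"
  have "(\<lambda>k. if k \<in> insert s A then \<Sum>j\<in>B. w j else z k) = ?z(s := \<Sum>j\<in>B. w j)"
    by auto
  then have "Q (\<lambda>k. if k \<in> insert s A then \<Sum>j\<in>B. w j else z k) = (\<Sum>j\<in>B. Q (?z(s := w j)))"
    using multi_additive_sum[OF Q _ \<open>finite B\<close>, of s] insert.prems by simp
  also have "\<dots> = (\<Sum>j\<in>B. \<Sum>\<phi>\<in>A \<rightarrow>\<^sub>E B. Q (\<lambda>k. if k \<in> A then w (\<phi> k) else (z(s := w j)) k))"
  proof (rule sum.cong[OF refl])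
    fix j
    have "?z(s := w j) = (\<lambda>k. if k \<in> A then \<Sum>j\<in>B. w j else (z(s := w j)) k)"
      using insert.hyps by auto
    then show "Q (?z(s := w j)) = (\<Sum>\<phi>\<in>A \<rightarrow>\<^sub>E B. Q (\<lambda>k. if k \<in> A then w (\<phi> k) else (z(s := w j)) k))"
      using insert.IH[of "z(s := w j)"] insert.prems by simp
  qed
  also have "\<dots> = (\<Sum>(j, \<phi>)\<in>B \<times> (A \<rightarrow>\<^sub>E B). Q (\<lambda>k. if k \<in> insert s A then w ((\<phi>(s := j)) k) else z k))"
    unfolding sum.cartesian_product using insert.hyps
    by (intro sum.cong refl) (auto intro!: arg_cong[where f = Q])
  also have "\<dots> = (\<Sum>\<phi>\<in>insert s A \<rightarrow>\<^sub>E B. Q (\<lambda>k. if k \<in> insert s A then w (\<phi> k) else z k))"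
    unfolding PiE_insert_eq
    by (subst sum.reindex[OF inj_combinator[OF insert.hyps(2)]]) (simp add: case_prod_unfold o_def)
  finally show ?case .
qed

lemma sum_alternating_supersets:
  assumes "finite S" "A \<subset> S"
  shows "(\<Sum>U | U \<subseteq> S \<and> A \<subseteq> U. (-1) ^ card U) = (0::complex)"
proof (rule sum_alternating_cancels)
  show "finite {U. U \<subseteq> S \<and> A \<subseteq> U}" using assms by simp
  show "card {x \<in> {U. U \<subseteq> S \<and> A \<subseteq> U}. even (card x)} = card {x \<in> {U. U \<subseteq> S \<and> A \<subseteq> U}. odd (card x)}"
    using card_subsupersets_even_odd[OF assms] by (simp add: conj_assoc)
qed

text \<open>Inclusion-exclusion over \<open>U \<subseteq> S\<close>: the diagonal values at the sums
  of \<open>z j\<close> over j in \<open>U\<close> vanish. Expanding their alternating sum gives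
  each map \<phi> from \<open>S\<close> to \<open>S\<close> the alternating count of the
  \<open>U\<close> containing its image, which is 0 unless \<phi> is onto. \<open>S\<close> indexes
  both the slots and the arguments; \<open>z0\<close> fills the places outside
  \<open>S\<close>.\<close>

lemma polarisation:
  fixes Q :: "('a \<Rightarrow> 'v::ab_group_add) \<Rightarrow> complex"
  assumes Q: "multi_additive S Q" and S: "finite S"
    and diag: "\<And>x. Q (\<lambda>k. if k \<in> S then x else z0 k) = 0"
  shows "(\<Sum>\<sigma> | \<sigma> permutes S. Q (\<lambda>k. if k \<in> S then z (\<sigma> k) else z0 k)) = 0"
proof -
  let ?q = "\<lambda>\<phi>. Q (\<lambda>k. if k \<in> S then z (\<phi> k) else z0 k)"
  have fin: "finite (S \<rightarrow>\<^sub>E S)" using S by (simp add: finite_PiE)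
  have "0 = (\<Sum>U\<in>Pow S. (-1) ^ card U * Q (\<lambda>k. if k \<in> S then \<Sum>j\<in>U. z j else z0 k))"
    by (simp add: diag)
  also have "\<dots> = (\<Sum>U\<in>Pow S. (-1) ^ card U * (\<Sum>\<phi>\<in>S \<rightarrow>\<^sub>E U. ?q \<phi>))"
    using S by (intro sum.cong refl) (simp add: multi_additive_expand[OF Q S subset_refl] finite_subset)
  also have "\<dots> = (\<Sum>U\<in>Pow S. \<Sum>\<phi>\<in>S \<rightarrow>\<^sub>E S. if \<phi> ` S \<subseteq> U then (-1) ^ card U * ?q \<phi> else 0)"
  proof (rule sum.cong[OF refl])
    fix U assume "U \<in> Pow S"
    then have "(S \<rightarrow>\<^sub>E U) = {\<phi> \<in> S \<rightarrow>\<^sub>E S. \<phi> ` S \<subseteq> U}"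
      by (auto simp: PiE_def Pi_def)
    then show "(-1) ^ card U * (\<Sum>\<phi>\<in>S \<rightarrow>\<^sub>E U. ?q \<phi>)
        = (\<Sum>\<phi>\<in>S \<rightarrow>\<^sub>E S. if \<phi> ` S \<subseteq> U then (-1) ^ card U * ?q \<phi> else 0)"
      using sum.inter_filter[OF fin, of "\<lambda>\<phi>. (-1) ^ card U * ?q \<phi>" "\<lambda>\<phi>. \<phi> ` S \<subseteq> U"]
      by (simp add: sum_distrib_left)
  qed
  also have "\<dots> = (\<Sum>\<phi>\<in>S \<rightarrow>\<^sub>E S. ?q \<phi> * (\<Sum>U | U \<subseteq> S \<and> \<phi> ` S \<subseteq> U. (-1) ^ card U))"
  proof (subst sum.swap, rule sum.cong[OF refl])
    fix \<phi>
    have "(\<Sum>U\<in>Pow S. if \<phi> ` S \<subseteq> U then (-1) ^ card U * ?q \<phi> else 0)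
        = (\<Sum>U\<in>{U \<in> Pow S. \<phi> ` S \<subseteq> U}. (-1) ^ card U * ?q \<phi>)"
      using S by (subst sum.inter_filter) auto
    then show "(\<Sum>U\<in>Pow S. if \<phi> ` S \<subseteq> U then (-1) ^ card U * ?q \<phi> else 0)
        = ?q \<phi> * (\<Sum>U | U \<subseteq> S \<and> \<phi> ` S \<subseteq> U. (-1) ^ card U)"
      by (simp add: sum_distrib_left mult.commute)
  qed
  also have "\<dots> = (\<Sum>\<phi>\<in>S \<rightarrow>\<^sub>E S. if \<phi> ` S = S then ?q \<phi> * (-1) ^ card S else 0)"
  proof (rule sum.cong[OF refl])
    fix \<phi> assume \<phi>: "\<phi> \<in> S \<rightarrow>\<^sub>E S"
    show "?q \<phi> * (\<Sum>U | U \<subseteq> S \<and> \<phi> ` S \<subseteq> U. (-1) ^ card U)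
        = (if \<phi> ` S = S then ?q \<phi> * (-1) ^ card S else 0)"
    proof (cases "\<phi> ` S = S")
      case True
      then have "{U. U \<subseteq> S \<and> \<phi> ` S \<subseteq> U} = {S}" by auto
      then show ?thesis using True by simp
    next
      case False
      then have "\<phi> ` S \<subset> S" using \<phi> by auto
      then show ?thesis using sum_alternating_supersets[OF S] False by simp
    qed
  qed
  also have "\<dots> = (-1) ^ card S * (\<Sum>\<phi> | \<phi> \<in> S \<rightarrow>\<^sub>E S \<and> \<phi> ` S = S. ?q \<phi>)"
    using sum.inter_filter[OF fin, of "\<lambda>\<phi>. ?q \<phi> * (-1) ^ card S" "\<lambda>\<phi>. \<phi> ` S = S"]
    by (simp add: sum_distrib_left mult.commute)
  also have "(\<Sum>\<phi> | \<phi> \<in> S \<rightarrow>\<^sub>E S \<and> \<phi> ` S = S. ?q \<phi>) = (\<Sum>\<sigma> | \<sigma> permutes S. ?q \<sigma>)"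
  \<comment> \<open>Maps of \<open>S\<close> onto itself are permutations because \<open>S\<close>
    is finite. Outside \<open>S\<close> one encoding demands \<open>undefined\<close> and the other
    the identity; the two witnesses translate.\<close>
  proof (rule sum.reindex_bij_witness[where i = "\<lambda>\<sigma>. restrict \<sigma> S" and j = "\<lambda>\<phi> k. if k \<in> S then \<phi> k else k"])
    fix \<phi> assume \<phi>: "\<phi> \<in> {\<phi>. \<phi> \<in> S \<rightarrow>\<^sub>E S \<and> \<phi> ` S = S}"
    show "restrict (\<lambda>k. if k \<in> S then \<phi> k else k) S = \<phi>" using \<phi> by (auto simp: fun_eq_iff PiE_def extensional_def)
    have "bij_betw \<phi> S S" using \<phi> S by (auto simp: bij_betw_def intro: eq_card_imp_inj_on)
    then have "bij_betw (\<lambda>k. if k \<in> S then \<phi> k else k) S S"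
      by (rule bij_betw_cong[THEN iffD1, rotated]) simp
    then show "(\<lambda>k. if k \<in> S then \<phi> k else k) \<in> {\<sigma>. \<sigma> permutes S}"
      by (auto intro: bij_imp_permutes)
    show "?q (\<lambda>k. if k \<in> S then \<phi> k else k) = ?q \<phi>"
      by (rule arg_cong[where f = Q]) auto
  next
    fix \<sigma> assume \<sigma>: "\<sigma> \<in> {\<sigma>. \<sigma> permutes S}"
    then show "(\<lambda>k. if k \<in> S then restrict \<sigma> S k else k) = \<sigma>"
      by (auto simp: fun_eq_iff permutes_def)
    show "restrict \<sigma> S \<in> {\<phi>. \<phi> \<in> S \<rightarrow>\<^sub>E S \<and> \<phi> ` S = S}"
      using \<sigma> permutes_image[of \<sigma> S] by (auto simp: permutes_in_image)
  qed
  finally show ?thesis by simp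
qed

section \<open>Substitution into trees\<close>

lemma size_nth_less: "i < length ts \<Longrightarrow> size (ts ! i) < Suc (size_list size ts)"
  by (metis less_Suc_eq_le nth_mem size_list_estimation' order_refl)

text \<open>The value of a tree in the algebra with operation \<open>\<mu>\<close>, where \<open>g\<close> prescribes the values of
  the subtrees at certain positions and \<open>\<mu> []\<close> is the value of a leaf.\<close>
function tree_eval :: "('v list \<Rightarrow> 'v) \<Rightarrow> (nat list \<Rightarrow> 'v option) \<Rightarrow> ptree \<Rightarrow> 'v" where
  "tree_eval \<mu> g (Node ts) = (case g [] of Some u \<Rightarrow> u
     | None \<Rightarrow> \<mu> (map (\<lambda>i. tree_eval \<mu> (\<lambda>q. g (i # q)) (ts ! i)) [0..<length ts]))"
  by pat_completeness auto
termination
  by (relation "Wellfounded.measure (\<lambda>(\<mu>, g, t). size t)") (auto simp: size_nth_less)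

declare tree_eval.simps[simp del]

abbreviation tree_value :: "('v list \<Rightarrow> 'v) \<Rightarrow> ptree \<Rightarrow> 'v" where
  "tree_value \<mu> \<equiv> tree_eval \<mu> (\<lambda>_. None)"

lemma tree_value_Node: "tree_value \<mu> (Node ts) = \<mu> (map (tree_value \<mu>) ts)"
  by (auto simp: tree_eval.simps intro!: arg_cong[where f = \<mu>] nth_equalityI)

lemma tree_eval_Some: "g [] = Some u \<Longrightarrow> tree_eval \<mu> g t = u"
  by (cases t) (simp add: tree_eval.simps)

lemma tree_eval_None:
  "g [] = None \<Longrightarrow> tree_eval \<mu> g (Node ts)
     = \<mu> (map (\<lambda>i. tree_eval \<mu> (\<lambda>q. g (i # q)) (ts ! i)) [0..<length ts])"
  by (simp add: tree_eval.simps)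

lemma Cons_parallel_Cons: "i # p \<parallel> j # q \<longleftrightarrow> i \<noteq> j \<or> p \<parallel> q"
  by (auto simp: parallel_def)

lemma replace_Node: "replace (Node ts) (i # s) u = Node (ts[i := replace (ts ! i) s u])"
  by simp

lemma parallel_replace:
  assumes "q \<parallel> s"
  shows "is_pos (replace t s u) q = is_pos t q" and "is_pos t q \<Longrightarrow> subt (replace t s u) q = subt t q"
  using assms
proof (induction s arbitrary: q t)
  case Nil
  { case 1 then show ?case by simp next case 2 then show ?case by simp }
next
  case (Cons i s)
  { case 1
    obtain ts where t: "t = Node ts" by (cases t)
    from 1 obtain j q' where "q = j # q'" by (cases q) auto
    with 1 Cons.IH(1)[of q' "ts ! i"] show ?case
      by (cases "i = j") (auto simp: t Cons_parallel_Cons)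
  next
    case 2
    obtain ts where t: "t = Node ts" by (cases t)
    from 2 obtain j q' where "q = j # q'" by (cases q) auto
    with 2 Cons.IH(2)[of "ts ! i" q'] show ?case
      by (cases "i = j") (auto simp: t Cons_parallel_Cons)
  }
qed

text \<open>Grafting \<open>u\<close> at \<open>s\<close> has the effect of prescribing its value
  there. A prescribed position above \<open>s\<close> would hide the graft, and one below
  \<open>s\<close> would act inside \<open>u\<close> on the left only;
  \<open>q \<parallel> s\<close> rules out both.\<close>

lemma tree_eval_replace:
  assumes "is_pos t s" "\<forall>q\<in>dom g. q \<parallel> s"
  shows "tree_eval \<mu> g (replace t s u) = tree_eval \<mu> (g(s \<mapsto> tree_value \<mu> u)) t"
  using assms
proof (induction s arbitrary: t g)
  case Nil
  then have "g = (\<lambda>_. None)" by (auto simp: dom_def fun_eq_iff)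
  then show ?case by (simp add: tree_eval_Some)
next
  case (Cons i s)
  obtain ts where t: "t = Node ts" by (cases t)
  have g: "g [] = None" using Cons.prems(2) by (auto simp: dom_def)
  have i: "i < length ts" "is_pos (ts ! i) s" using Cons.prems by (auto simp: t)
  have eq: "tree_eval \<mu> (\<lambda>q. g (j # q)) (ts[i := replace (ts ! i) s u] ! j)
      = tree_eval \<mu> (\<lambda>q. (g(i # s \<mapsto> tree_value \<mu> u)) (j # q)) (ts ! j)" if "j < length ts" for j
  proof (cases "i = j")
    case True
    have "\<forall>q\<in>dom (\<lambda>q. g (i # q)). q \<parallel> s"
      using Cons.prems(2) by (auto simp: dom_def Cons_parallel_Cons)
    moreover have "(\<lambda>q. (g(i # s \<mapsto> tree_value \<mu> u)) (i # q)) = (\<lambda>q. g (i # q))(s \<mapsto> tree_value \<mu> u)"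
      by auto
    ultimately show ?thesis using Cons.IH[OF i(2)] i(1) True by simp
  next
    case False
    then show ?thesis by simp
  qed
  have "(g(i # s \<mapsto> tree_value \<mu> u)) [] = None" using g by simp
  note tree_eval_None[where g = "g(i # s \<mapsto> tree_value \<mu> u)", OF this]
  then show ?case unfolding t replace_Node tree_eval_None[where g = g, OF g]
    by (auto simp del: fun_upd_apply intro!: arg_cong[where f = \<mu>] eq)
qed

lemma is_pos_foldr_replace:
  assumes "\<forall>s\<in>set xs. q \<parallel> s"
  shows "is_pos (foldr (\<lambda>s t. replace t s (f s)) xs T) q = is_pos T q"
    and "is_pos T q \<Longrightarrow> subt (foldr (\<lambda>s t. replace t s (f s)) xs T) q = subt T q"
  using assms by (induction xs) (auto simp: parallel_replace)

text \<open>The outermost replacement is turned into a prescription first, and the remaining ones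
  are handled by induction with the enlarged \<open>g\<close>; parallel positions never disturb each
  other.\<close>

lemma tree_eval_foldr_replace:
  assumes "distinct xs" "\<forall>s\<in>set xs. is_pos T s" "pairwise parallel (set xs)"
    "\<forall>q\<in>dom g. \<forall>s\<in>set xs. q \<parallel> s"
  shows "tree_eval \<mu> g (foldr (\<lambda>s t. replace t s (f s)) xs T)
       = tree_eval \<mu> (\<lambda>q. if q \<in> set xs then Some (tree_value \<mu> (f q)) else g q) T"
  using assms
proof (induction xs arbitrary: g)
  case Nil
  then show ?case by simp
next
  case (Cons s xs)
  let ?R = "foldr (\<lambda>s t. replace t s (f s)) xs T"
  have par: "\<forall>s'\<in>set xs. s \<parallel> s'" using Cons.prems(1,3) by (auto simp: pairwise_insert)
  have "is_pos ?R s" using is_pos_foldr_replace(1)[OF par] Cons.prems(2) by simp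
  then have "tree_eval \<mu> g (replace ?R s (f s)) = tree_eval \<mu> (g(s \<mapsto> tree_value \<mu> (f s))) ?R"
    using Cons.prems(4) by (intro tree_eval_replace) auto
  also have "\<dots> = tree_eval \<mu> (\<lambda>q. if q \<in> set xs then Some (tree_value \<mu> (f q))
      else (g(s \<mapsto> tree_value \<mu> (f s))) q) T"
    using Cons.prems par by (intro Cons.IH) (auto simp: pairwise_insert split: if_splits)
  also have "(\<lambda>q. if q \<in> set xs then Some (tree_value \<mu> (f q)) else (g(s \<mapsto> tree_value \<mu> (f s))) q)
      = (\<lambda>q. if q \<in> set (s # xs) then Some (tree_value \<mu> (f q)) else g q)"
    using Cons.prems(1) by auto
  finally show ?case by simp
qed

text \<open>With \<open>Node\<close> as operation, evaluation builds trees, so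
  \<open>tree_eval Node g\<close> is simultaneous substitution; the substituted trees can be read
  off again, which later decides when two rearrangements coincide.\<close>

lemma subt_tree_eval_Node:
  assumes "is_pos t s" "g s = Some u" "\<forall>q\<in>dom g. q \<noteq> s \<longrightarrow> q \<parallel> s"
  shows "subt (tree_eval Node g t) s = u"
  using assms
proof (induction s arbitrary: t g)
  case Nil
  then show ?case by (simp add: tree_eval_Some)
next
  case (Cons i s)
  obtain ts where t: "t = Node ts" by (cases t)
  have g: "g [] = None" using Cons.prems(3) by (auto simp: dom_def)
  have "subt (tree_eval Node (\<lambda>q. g (i # q)) (ts ! i)) s = u"
    using Cons.prems by (intro Cons.IH) (auto simp: t dom_def Cons_parallel_Cons)
  then show ?case using Cons.prems(1) by (simp add: t tree_eval_None[where g = g, OF g])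
qed

lemma tree_value_Node_id: "tree_value Node t = t"
proof (induction t)
  case (Node ts)
  then show ?case by (simp add: tree_value_Node map_idI)
qed

section \<open>Catalan trees\<close>

fun num_internal :: "ptree \<Rightarrow> nat" where
  "num_internal (Node ts) = (if ts = [] then 0 else Suc (sum_list (map num_internal ts)))"

lemma vertices_Node: "vertices (Node ts) = insert [] (\<Union>i<length ts. (#) i ` vertices (ts ! i))"
proof -
  have "q \<in> vertices (Node ts) \<longleftrightarrow> q \<in> insert [] (\<Union>i<length ts. (#) i ` vertices (ts ! i))" for q
    by (cases q) (auto simp: vertices_def)
  then show ?thesis by blast
qed

lemma finite_vertices: "finite (vertices t)"
  by (induction t) (auto simp: vertices_Node)

lemma is_catalan_Node:
  "is_catalan d (Node ts) \<longleftrightarrow> (length ts = 0 \<or> length ts = d) \<and> (\<forall>t\<in>set ts. is_catalan d t)"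
  by (auto simp: is_catalan_def vertices_Node all_set_conv_all_nth)

lemma card_internal_vertices: "card (internal_vertices t) = num_internal t"
proof (induction t)
  case (Node ts)
  have eq: "internal_vertices (Node ts)
      = (if ts = [] then {} else insert [] (\<Union>i<length ts. (#) i ` internal_vertices (ts ! i)))"
    by (auto simp: internal_vertices_def vertices_Node)
  have fin: "finite (internal_vertices t)" for t
    by (simp add: internal_vertices_def finite_vertices)
  show ?case
  proof (cases "ts = []")
    case True
    then show ?thesis using eq by simp
  next
    case False
    have "card (\<Union>i<length ts. (#) i ` internal_vertices (ts ! i))
        = (\<Sum>i<length ts. card ((#) i ` internal_vertices (ts ! i)))"
      by (rule card_UN_disjoint) (auto simp: fin)
    also have "\<dots> = (\<Sum>i<length ts. num_internal (ts ! i))"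
      using Node by (intro sum.cong refl) (simp add: card_image)
    also have "\<dots> = sum_list (map num_internal ts)"
      by (simp add: sum_list_sum_nth atLeast0LessThan)
    finally have "card (\<Union>i<length ts. (#) i ` internal_vertices (ts ! i)) = sum_list (map num_internal ts)" .
    moreover have "[] \<notin> (\<Union>i<length ts. (#) i ` internal_vertices (ts ! i))" by auto
    ultimately show ?thesis unfolding eq using False by (simp add: card_insert_disjoint fin)
  qed
qed

lemma catalan_trees_alt: "catalan_trees d k = {t. is_catalan d t \<and> num_internal t = k}"
  by (simp add: catalan_trees_def card_internal_vertices)

lemma num_internal_replace:
  "is_pos t s \<Longrightarrow> num_internal (replace t s u) + num_internal (subt t s) = num_internal t + num_internal u"
proof (induction s arbitrary: t)
  case Nil
  then show ?case by simp
next
  case (Cons i s)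
  obtain ts where t: "t = Node ts" by (cases t)
  have i: "i < length ts" and IH: "num_internal (replace (ts ! i) s u) + num_internal (subt (ts ! i) s)
      = num_internal (ts ! i) + num_internal u"
    using Cons by (auto simp: t)
  have "sum_list (map num_internal (ts[i := r])) + num_internal (ts ! i)
      = sum_list (map num_internal ts) + num_internal r" for r
    using i by (simp add: map_update sum_list_update) (metis add.commute le_add_diff_inverse2
        elem_le_sum_list length_map nth_map trans_le_add1)
  from this[of "replace (ts ! i) s u"] show ?case using i IH by (auto simp: t)
qed

lemma is_catalan_replace:
  "is_catalan d t \<Longrightarrow> is_catalan d u \<Longrightarrow> is_pos t s \<Longrightarrow> is_catalan d (replace t s u)"
proof (induction s arbitrary: t)
  case Nil
  then show ?case by simp
next
  case (Cons i s)
  then show ?case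
    by (cases t) (auto simp: is_catalan_Node dest!: set_update_subset_insert[THEN subsetD])
qed

lemma is_catalan_subt: "is_catalan d t \<Longrightarrow> is_pos t s \<Longrightarrow> is_catalan d (subt t s)"
proof (induction s arbitrary: t)
  case (Cons i s)
  then show ?case by (cases t) (auto simp: is_catalan_Node)
qed simp

text \<open>When the \<open>f s\<close> are the old subtrees in another order, the two sums agree
  and the number of internal vertices is preserved. The removed subtrees stand on the left to avoid
  subtraction of naturals.\<close>

lemma foldr_replace_catalan:
  assumes "distinct xs" "\<forall>s\<in>set xs. is_pos T s" "pairwise parallel (set xs)"
    "is_catalan d T" "\<forall>s\<in>set xs. is_catalan d (f s)"
  shows "is_catalan d (foldr (\<lambda>s t. replace t s (f s)) xs T)"
    and "num_internal (foldr (\<lambda>s t. replace t s (f s)) xs T) + (\<Sum>s\<in>set xs. num_internal (subt T s))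
         = num_internal T + (\<Sum>s\<in>set xs. num_internal (f s))"
  using assms
proof (induction xs)
  case Nil
  { case 1 then show ?case by simp next case 2 then show ?case by simp }
next
  case (Cons s xs)
  let ?R = "foldr (\<lambda>s t. replace t s (f s)) xs T"
  have pos: "is_pos ?R s" "subt ?R s = subt T s"
    if "pairwise parallel (set (s # xs))" "distinct (s # xs)" "is_pos T s"
    using is_pos_foldr_replace[where xs = xs and q = s and f = f and T = T] that by (auto simp: pairwise_insert)
  { case 1
    then show ?case using Cons.IH(1) pos by (simp add: is_catalan_replace pairwise_insert)
  next
    case 2
    then have "num_internal ?R + (\<Sum>s\<in>set xs. num_internal (subt T s))
         = num_internal T + (\<Sum>s\<in>set xs. num_internal (f s))"
      using Cons.IH(2) by (simp add: pairwise_insert)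
    moreover have "num_internal (replace ?R s (f s)) + num_internal (subt T s)
        = num_internal ?R + num_internal (f s)"
      using num_internal_replace[of ?R s] pos 2 by simp
    ultimately show ?case using 2 by simp
  }
qed

section \<open>Shuffle classes\<close>

lemma sibling_positions_Nil [simp]: "sibling_positions d p [] = {}"
  by (auto simp: sibling_positions_def)

text \<open>The definition counts levels from the end of the position, whereas inductions on trees
  start at the root. The edge from the root to child \<open>i\<close> is among the last
  \<open>p\<close> edges of the path exactly when \<open>length v < p\<close>.\<close>

lemma sibling_positions_Cons:
  "sibling_positions d p (i # v)
     = (if length v < p then (\<lambda>c. [c]) ` ({..<d} - {i}) else {}) \<union> (#) i ` sibling_positions d p v"
    (is "?l = ?r")
proof -
  have "q \<in> ?l \<longleftrightarrow> q \<in> ?r" for q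
  proof
    assume "q \<in> ?l"
    then obtain j c where jc: "q = take j (i # v) @ [c]" "Suc (length v) - p \<le> j" "j < Suc (length v)"
      "c < d" "c \<noteq> (i # v) ! j" by (auto simp: sibling_positions_def)
    show "q \<in> ?r"
    proof (cases j)
      case 0
      then show ?thesis using jc by auto
    next
      case (Suc j')
      then have "take j' v @ [c] \<in> sibling_positions d p v"
        unfolding sibling_positions_def using jc by (intro CollectI exI[of _ j'] exI[of _ c]) auto
      then show ?thesis using jc Suc by auto
    qed
  next
    assume "q \<in> ?r"
    then consider c where "q = [c]" "length v < p" "c < d" "c \<noteq> i"
      | j c where "q = i # take j v @ [c]" "length v - p \<le> j" "j < length v" "c < d" "c \<noteq> v ! j"
      by (auto simp: sibling_positions_def split: if_splits)
    then show "q \<in> ?l"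
    proof cases
      case (1 c)
      then show ?thesis unfolding sibling_positions_def
        by (intro CollectI exI[of _ 0] exI[of _ c]) auto
    next
      case (2 j c)
      then show ?thesis unfolding sibling_positions_def
        by (intro CollectI exI[of _ "Suc j"] exI[of _ c]) auto
    qed
  qed
  then show ?thesis by blast
qed

lemma Nil_notin_sibling_positions: "[] \<notin> sibling_positions d p v"
  by (auto simp: sibling_positions_def)

lemma finite_sibling_positions: "finite (sibling_positions d p v)"
  by (induction v) (auto simp: sibling_positions_Cons)

text \<open>Every sibling branches off the path by one step: two of them leave it at different
  vertices or through different children, so none lies below another.\<close>

lemma pairwise_parallel_sibling_positions: "pairwise parallel (sibling_positions d p v)"
  proof (induction v)
  case (Cons i v)
  let ?X = "(\<lambda>c. [c]) ` ({..<d} - {i}) \<union> (#) i ` sibling_positions d p v"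
  have "s \<parallel> s'" if s: "s \<in> ?X" "s' \<in> ?X" "s \<noteq> s'" for s s'
  proof -
    obtain a q where q: "s = a # q" "(q = [] \<and> a \<noteq> i) \<or> (a = i \<and> q \<in> sibling_positions d p v)"
      using s(1) by auto
    obtain b q' where q': "s' = b # q'" "(q' = [] \<and> b \<noteq> i) \<or> (b = i \<and> q' \<in> sibling_positions d p v)"
      using s(2) by auto
    show ?thesis
    proof (cases "a = b")
      case True
      then have "q \<noteq> q'" using s(3) q(1) q'(1) by simp
      then have "q \<parallel> q'" using True q(2) q'(2) pairwiseD[OF Cons.IH, of q q'] by auto
      then show ?thesis by (simp add: q(1) q'(1) Cons_parallel_Cons)
    next
      case False
      then show ?thesis by (simp add: q(1) q'(1) Cons_parallel_Cons)
    qed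
  qed
  then have "pairwise parallel ?X" by (rule pairwiseI)
  then show ?case unfolding sibling_positions_Cons by (rule pairwise_subset) auto
qed simp

lemma is_pos_sibling_positions:
  "is_catalan d T \<Longrightarrow> is_pos T v \<Longrightarrow> s \<in> sibling_positions d p v \<Longrightarrow> is_pos T s"
proof (induction v arbitrary: T s)
  case Nil
  then show ?case by simp
next
  case (Cons i v)
  obtain ts where T: "T = Node ts" by (cases T)
  have i: "i < length ts" "length ts = d" "is_catalan d (ts ! i)" "is_pos (ts ! i) v"
    using Cons.prems(1,2) by (auto simp: T is_catalan_Node)
  from Cons.prems(3) consider c where "s = [c]" "c < d" | q where "s = i # q" "q \<in> sibling_positions d p v"
    unfolding sibling_positions_Cons by (auto split: if_splits)
  then show ?case
  proof cases
    case 1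
    then show ?thesis using i by (simp add: T)
  next
    case 2
    then show ?thesis using i Cons.IH[OF i(3,4)] by (simp add: T)
  qed
qed

abbreviation substitute :: "nat list set \<Rightarrow> (nat list \<Rightarrow> 'v) \<Rightarrow> nat list \<Rightarrow> 'v option" where
  "substitute S z \<equiv> \<lambda>q. if q \<in> S then Some (z q) else None"

text \<open>The right-hand side does not mention \<open>xs\<close>, so the order of the replacements
  is immaterial. With \<open>Node\<close> for \<open>\<mu>\<close> it describes the rearranged tree
  itself.\<close>

lemma tree_value_rearrange:
  assumes "is_catalan d T" "is_pos T v" "distinct xs" "set xs = sibling_positions d p v"
  shows "tree_value \<mu> (rearrange T xs \<sigma>)
       = tree_eval \<mu> (substitute (sibling_positions d p v) (\<lambda>q. tree_value \<mu> (subt T (\<sigma> q)))) T"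
  using tree_eval_foldr_replace[OF assms(3), of T "\<lambda>_. None" \<mu> "\<lambda>s. subt T (\<sigma> s)"]
    is_pos_sibling_positions[OF assms(1,2)] pairwise_parallel_sibling_positions[of d p v]
  by (simp add: rearrange_def assms(4))

lemma shuffle_class_eq_image:
  assumes "is_catalan d T" "is_pos T v"
  shows "shuffle_class d T p v
       = (\<lambda>\<sigma>. tree_eval Node (substitute (sibling_positions d p v) (\<lambda>q. subt T (\<sigma> q))) T)
           ` {\<sigma>. \<sigma> permutes sibling_positions d p v}"
proof -
  let ?r = "\<lambda>\<sigma>. tree_eval Node (substitute (sibling_positions d p v) (\<lambda>q. subt T (\<sigma> q))) T"
  have eq: "rearrange T xs \<sigma> = ?r \<sigma>"
    if "distinct xs" "set xs = sibling_positions d p v" for xs \<sigma>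
    using tree_value_rearrange[OF assms that, of Node \<sigma>] unfolding tree_value_Node_id .
  obtain xs where xs: "distinct xs" "set xs = sibling_positions d p v"
    using finite_distinct_list[OF finite_sibling_positions] by metis
  show ?thesis
  proof (intro subset_antisym subsetI)
    fix T' assume "T' \<in> shuffle_class d T p v"
    then obtain xs \<sigma> where "distinct xs" "set xs = sibling_positions d p v"
      "\<sigma> permutes sibling_positions d p v" "T' = rearrange T xs \<sigma>"
      unfolding shuffle_class_def by blast
    then show "T' \<in> ?r ` {\<sigma>. \<sigma> permutes sibling_positions d p v}" using eq by blast
  next
    fix T' assume "T' \<in> ?r ` {\<sigma>. \<sigma> permutes sibling_positions d p v}"
    then obtain \<sigma> where "\<sigma> permutes sibling_positions d p v" "T' = ?r \<sigma>" by blast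
    then show "T' \<in> shuffle_class d T p v"
      unfolding shuffle_class_def eq[OF xs, symmetric] using xs by blast
  qed
qed

lemma shuffle_class_subset:
  assumes "T \<in> catalan_trees d k" "is_pos T v"
  shows "shuffle_class d T p v \<subseteq> catalan_trees d k"
proof
  fix T' assume "T' \<in> shuffle_class d T p v"
  then obtain xs \<sigma> where xs: "distinct xs" "set xs = sibling_positions d p v"
    and \<sigma>: "\<sigma> permutes sibling_positions d p v" and T': "T' = rearrange T xs \<sigma>"
    by (auto simp: shuffle_class_def)
  have T: "is_catalan d T" "num_internal T = k" using assms by (auto simp: catalan_trees_alt)
  have pos: "\<forall>s\<in>set xs. is_pos T s" using is_pos_sibling_positions[OF T(1) assms(2)] xs by blast
  have pos': "\<forall>s\<in>set xs. is_pos T (\<sigma> s)" using pos permutes_in_image[OF \<sigma>] xs by auto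
  have cat: "\<forall>s\<in>set xs. is_catalan d (subt T (\<sigma> s))" using is_catalan_subt[OF T(1)] pos' by blast
  have par: "pairwise parallel (set xs)" using pairwise_parallel_sibling_positions xs by metis
  have "(\<Sum>s\<in>set xs. num_internal (subt T (\<sigma> s))) = (\<Sum>s\<in>set xs. num_internal (subt T s))"
    using sum.permute[OF \<sigma>, of "\<lambda>s. num_internal (subt T s)"] xs by (simp add: o_def)
  then show "T' \<in> catalan_trees d k"
    using foldr_replace_catalan[OF xs(1) pos par T(1) cat] T(2)
    by (simp add: catalan_trees_alt T' rearrange_def)
qed

text \<open>Polarisation yields a sum over permutations, while a shuffle class counts each tree
  once. Two permutations give the same tree iff they place equal subtrees everywhere, so all fibres
  are cosets of the stabiliser of the labelling of \<open>S\<close> by subtrees; \<open>c\<close> is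
  its order.\<close>

lemma sum_permutations_shuffle_class:
  fixes \<psi> :: "ptree \<Rightarrow> complex" and p :: nat
  assumes "is_catalan d T" "is_pos T v"
  defines "S \<equiv> sibling_positions d p v"
  shows "\<exists>c. c \<noteq> 0 \<and> (\<Sum>\<sigma> | \<sigma> permutes S. \<psi> (tree_eval Node (substitute S (\<lambda>q. subt T (\<sigma> q))) T))
            = c * (\<Sum>T'\<in>shuffle_class d T p v. \<psi> T')"
proof -
  let ?r = "\<lambda>\<sigma>. tree_eval Node (substitute S (\<lambda>q. subt T (\<sigma> q))) T"
  let ?stab = "{\<rho>. \<rho> permutes S \<and> (\<forall>s\<in>S. subt T (\<rho> s) = subt T s)}"
  have fin: "finite {\<sigma>. \<sigma> permutes S}"
    using finite_permutations finite_sibling_positions S_def by metis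
  have r_eq: "?r \<sigma> = ?r \<sigma>' \<longleftrightarrow> (\<forall>s\<in>S. subt T (\<sigma> s) = subt T (\<sigma>' s))" for \<sigma> \<sigma>'
  proof
    have sub: "subt (?r \<sigma>) s = subt T (\<sigma> s)" if "s \<in> S" for s \<sigma>
    proof (rule subt_tree_eval_Node)
      show "is_pos T s" using is_pos_sibling_positions[OF assms(1,2)] that S_def by blast
      show "substitute S (\<lambda>q. subt T (\<sigma> q)) s = Some (subt T (\<sigma> s))" using that by simp
      have "q \<parallel> s" if "q \<in> S" "q \<noteq> s" for q
        using that \<open>s \<in> S\<close> pairwise_parallel_sibling_positions[of d p v] by (simp add: S_def pairwise_def)
      then show "\<forall>q\<in>dom (substitute S (\<lambda>q. subt T (\<sigma> q))). q \<noteq> s \<longrightarrow> q \<parallel> s"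
        by (auto simp: dom_def split: if_splits)
    qed
    assume r: "?r \<sigma> = ?r \<sigma>'"
    show "\<forall>s\<in>S. subt T (\<sigma> s) = subt T (\<sigma>' s)"
    proof
      fix s assume "s \<in> S"
      show "subt T (\<sigma> s) = subt T (\<sigma>' s)"
        using sub[OF \<open>s \<in> S\<close>, of \<sigma>] sub[OF \<open>s \<in> S\<close>, of \<sigma>'] unfolding r by (rule trans[OF sym])
    qed
  next
    assume "\<forall>s\<in>S. subt T (\<sigma> s) = subt T (\<sigma>' s)"
    then have "substitute S (\<lambda>q. subt T (\<sigma> q)) = substitute S (\<lambda>q. subt T (\<sigma>' q))" by auto
    then show "?r \<sigma> = ?r \<sigma>'" by (rule arg_cong[where f = "\<lambda>g. tree_eval Node g T"])
  qed
  \<comment> \<open>Composition with \<open>\<sigma>0\<close> on the right carries the stabiliser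
    onto the fibre through \<open>\<sigma>0\<close>.\<close>
  have fibre: "card {\<sigma>. \<sigma> permutes S \<and> ?r \<sigma> = ?r \<sigma>0} = card ?stab" if \<sigma>0: "\<sigma>0 permutes S" for \<sigma>0
  proof (rule sym, rule bij_betw_same_card[of "\<lambda>\<rho>. \<rho> \<circ> \<sigma>0"],
      rule bij_betw_byWitness[where f' = "\<lambda>\<sigma>. \<sigma> \<circ> inv \<sigma>0"])
    have inv: "inv \<sigma>0 permutes S" using \<sigma>0 by (rule permutes_inv)
    have c: "\<sigma>0 (inv \<sigma>0 s) = s" "inv \<sigma>0 (\<sigma>0 s) = s" for s
      using permutes_inverses[OF \<sigma>0] by blast+
    have S: "\<sigma>0 s \<in> S" "inv \<sigma>0 s \<in> S" if "s \<in> S" for s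
      using permutes_in_image[OF \<sigma>0] permutes_in_image[OF inv] that by blast+
    show "\<forall>\<rho>\<in>?stab. (\<rho> \<circ> \<sigma>0) \<circ> inv \<sigma>0 = \<rho>" by (simp add: fun_eq_iff c)
    show "\<forall>\<sigma>\<in>{\<sigma>. \<sigma> permutes S \<and> ?r \<sigma> = ?r \<sigma>0}. (\<sigma> \<circ> inv \<sigma>0) \<circ> \<sigma>0 = \<sigma>"
      by (simp add: fun_eq_iff c)
    show "(\<lambda>\<rho>. \<rho> \<circ> \<sigma>0) ` ?stab \<subseteq> {\<sigma>. \<sigma> permutes S \<and> ?r \<sigma> = ?r \<sigma>0}"
      unfolding r_eq using permutes_compose[OF \<sigma>0] S by auto
    show "(\<lambda>\<sigma>. \<sigma> \<circ> inv \<sigma>0) ` {\<sigma>. \<sigma> permutes S \<and> ?r \<sigma> = ?r \<sigma>0} \<subseteq> ?stab"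
      unfolding r_eq using permutes_compose[OF inv] S c by auto
  qed
  have "(\<Sum>\<sigma> | \<sigma> permutes S. \<psi> (?r \<sigma>))
      = (\<Sum>T'\<in>?r ` {\<sigma>. \<sigma> permutes S}. \<Sum>\<sigma>\<in>{\<sigma> \<in> {\<sigma>. \<sigma> permutes S}. ?r \<sigma> = T'}. \<psi> (?r \<sigma>))"
    by (rule sum.image_gen[OF fin])
  also have "\<dots> = (\<Sum>T'\<in>?r ` {\<sigma>. \<sigma> permutes S}. of_nat (card ?stab) * \<psi> T')"
  proof (rule sum.cong[OF refl])
    fix T' assume "T' \<in> ?r ` {\<sigma>. \<sigma> permutes S}"
    then obtain \<sigma>0 where \<sigma>0: "\<sigma>0 permutes S" and T': "T' = ?r \<sigma>0" by auto
    have "(\<Sum>\<sigma>\<in>{\<sigma> \<in> {\<sigma>. \<sigma> permutes S}. ?r \<sigma> = T'}. \<psi> (?r \<sigma>))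
        = (\<Sum>\<sigma>\<in>{\<sigma>. \<sigma> permutes S \<and> ?r \<sigma> = ?r \<sigma>0}. \<psi> T')"
      by (rule sum.cong) (auto simp: T')
    then show "(\<Sum>\<sigma>\<in>{\<sigma> \<in> {\<sigma>. \<sigma> permutes S}. ?r \<sigma> = T'}. \<psi> (?r \<sigma>)) = of_nat (card ?stab) * \<psi> T'"
      by (simp add: fibre[OF \<sigma>0])
  qed
  also have "\<dots> = of_nat (card ?stab) * (\<Sum>T'\<in>shuffle_class d T p v. \<psi> T')"
    unfolding shuffle_class_eq_image[OF assms(1,2)] S_def by (simp add: sum_distrib_left)
  finally have eq: "(\<Sum>\<sigma> | \<sigma> permutes S. \<psi> (?r \<sigma>))
      = of_nat (card ?stab) * (\<Sum>T'\<in>shuffle_class d T p v. \<psi> T')" .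
  have "id \<in> ?stab" by (simp add: permutes_id)
  moreover have "finite ?stab" using fin by (rule rev_finite_subset) auto
  ultimately have "card ?stab \<noteq> 0" unfolding card_eq_0_iff by blast
  then show ?thesis using eq by (intro exI[of _ "of_nat (card ?stab)"]) simp
qed

section \<open>Lists of trees\<close>

lemma in_listset_iff: "xs \<in> listset Bs \<longleftrightarrow> list_all2 (\<in>) xs Bs"
  by (induction Bs arbitrary: xs) (auto simp: set_Cons_def list_all2_Cons2)

lemma listset_Cons_eq_image: "listset (B # Bs) = (\<lambda>(x, xs). x # xs) ` (B \<times> listset Bs)"
  by (auto simp: set_Cons_def)

lemma finite_listset: "\<forall>B\<in>set Bs. finite B \<Longrightarrow> finite (listset Bs)"
  by (induction Bs) (auto simp: listset_Cons_eq_image simp del: listset.simps(2))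

lemma finite_compositions: "finite {ks :: nat list. length ks = d \<and> sum_list ks = k}"
  by (rule finite_subset[OF _ finite_lists_length_eq[of "{..k}" d]]) (auto dest: member_le_sum_list)

lemma catalan_trees_0: "catalan_trees d 0 = {Node []}"
proof -
  have "t \<in> catalan_trees d 0 \<longleftrightarrow> t = Node []" for t
    by (cases t) (auto simp: catalan_trees_alt is_catalan_Node)
  then show ?thesis by blast
qed

lemma in_listset_catalan_trees:
  "ts \<in> listset (map (catalan_trees d) ks) \<longleftrightarrow> (\<forall>t\<in>set ts. is_catalan d t) \<and> map num_internal ts = ks"
  unfolding in_listset_iff
  by (induction ts arbitrary: ks) (auto simp: list_all2_Cons1 list_all2_map2 catalan_trees_alt)

text \<open>A tree with internal root is the list of its \<open>d\<close> subtrees, here sorted by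
  the vector \<open>ks\<close> of their sizes. \<open>0 < d\<close> keeps an internal root apart
  from a leaf.\<close>

lemma catalan_trees_Suc:
  assumes "0 < d"
  shows "catalan_trees d (Suc k)
       = Node ` (\<Union>ks\<in>{ks. length ks = d \<and> sum_list ks = k}. listset (map (catalan_trees d) ks))"
    (is "?l = ?r")
proof -
  have "t \<in> ?l \<longleftrightarrow> t \<in> ?r" for t
  proof (cases t)
    case (Node ts)
    then show ?thesis using assms
      by (auto simp: catalan_trees_alt is_catalan_Node in_listset_catalan_trees image_iff split: if_splits)
  qed
  then show ?thesis by blast
qed

lemma finite_catalan_trees:
  assumes "0 < d"
  shows "finite (catalan_trees d k)"
proof (induction k rule: less_induct)
  case (less k)
  show ?case
  proof (cases k)
    case 0
    then show ?thesis by (simp add: catalan_trees_0)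
  next
    case (Suc k')
    have "finite (listset (map (catalan_trees d) ks))" if "sum_list ks = k'" for ks
      using that less Suc by (intro finite_listset) (auto dest: member_le_sum_list simp: less_Suc_eq_le)
    then show ?thesis unfolding Suc catalan_trees_Suc[OF assms]
      by (intro finite_imageI finite_UN_I finite_compositions) auto
  qed
qed

section \<open>Symmetric multilinear algebras\<close>

text \<open>\<open>\<mu>\<close> plays two roles, since \<open>tree_eval\<close> applies it to the
  list of children: on lists of length \<open>d\<close> it is the symmetric operation, on
  \<open>[]\<close> it is the value of a leaf, left unconstrained by the axioms.\<close>

locale symmetric_algebra =
  fixes d :: nat and \<mu> :: "'v::ab_group_add list \<Rightarrow> 'v"
  assumes d_pos: "0 < d"
    and additive: "length xs = d \<Longrightarrow> j < d \<Longrightarrow> \<mu> (xs[j := a + b]) = \<mu> (xs[j := a]) + \<mu> (xs[j := b])"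
    and symmetric: "length xs = d \<Longrightarrow> mset xs = mset ys \<Longrightarrow> \<mu> xs = \<mu> ys"
begin

text \<open>If \<open>\<mu>\<close> is the symmetric form with diagonal K, this is JK(x) h /
  d.\<close>

definition mult_op :: "'v \<Rightarrow> 'v \<Rightarrow> 'v" where
  "mult_op x h = \<mu> (h # replicate (d - 1) x)"

lemma mu_zero: "length xs = d \<Longrightarrow> j < d \<Longrightarrow> \<mu> (xs[j := 0]) = 0"
  using additive[of xs j 0 0] by simp

lemma mu_zero_in_set: "length xs = d \<Longrightarrow> 0 \<in> set xs \<Longrightarrow> \<mu> xs = 0"
  by (metis in_set_conv_nth list_update_id mu_zero)

lemma mu_sum:
  assumes "length xs = d" "j < d" "finite B"
  shows "\<mu> (xs[j := \<Sum>a\<in>B. w a]) = (\<Sum>a\<in>B. \<mu> (xs[j := w a]))"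
  using assms(3) by (induction B rule: finite_induct) (simp_all add: assms mu_zero additive)

lemma mu_replicate_update:
  assumes "i < d"
  shows "\<mu> ((replicate d x)[i := h]) = mult_op x h"
  unfolding mult_op_def
proof (rule symmetric)
  show "mset ((replicate d x)[i := h]) = mset (h # replicate (d - 1) x)"
    using assms mset_update[of i "replicate d x" h] by (cases d) (simp_all del: replicate_Suc nth_Cons')
qed simp

text \<open>Full distributivity, one slot at a time; \<open>pre\<close> holds the slots already
  expanded.\<close>

lemma mu_listset:
  assumes "length pre + length Bs = d" "\<forall>B\<in>set Bs. finite B"
  shows "\<mu> (pre @ map (\<lambda>B. \<Sum>a\<in>B. w a) Bs) = (\<Sum>as\<in>listset Bs. \<mu> (pre @ map w as))"
  using assms
proof (induction Bs arbitrary: pre)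
  case Nil
  then show ?case by simp
next
  case (Cons B Bs)
  let ?f = "\<lambda>B. \<Sum>a\<in>B. w a"
  have upd: "(pre @ 0 # xs)[length pre := a] = pre @ a # xs" for a xs by simp
  have "\<mu> (pre @ map ?f (B # Bs)) = \<mu> ((pre @ 0 # map ?f Bs)[length pre := ?f B])"
    by simp
  also have "\<dots> = (\<Sum>a\<in>B. \<mu> ((pre @ 0 # map ?f Bs)[length pre := w a]))"
    using Cons.prems by (intro mu_sum) auto
  also have "\<dots> = (\<Sum>a\<in>B. \<mu> ((pre @ [w a]) @ map ?f Bs))" by simp
  also have "\<dots> = (\<Sum>a\<in>B. \<Sum>as\<in>listset Bs. \<mu> ((pre @ [w a]) @ map w as))"
    using Cons.prems by (intro sum.cong refl Cons.IH) auto
  also have "\<dots> = (\<Sum>as\<in>listset (B # Bs). \<mu> (pre @ map w as))"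
    unfolding listset_Cons_eq_image sum.cartesian_product
    by (subst sum.reindex) (auto simp: inj_on_def case_prod_unfold)
  finally show ?case .
qed

text \<open>The substituted value enters through a single branch: at every vertex above
  \<open>s\<close> only one argument of \<open>\<mu>\<close> depends on it, so additivity climbs
  from \<open>s\<close> to the root.\<close>

lemma tree_eval_additive:
  assumes "is_catalan d T" "is_pos T s" "\<forall>q\<in>dom g. q \<noteq> s \<longrightarrow> q \<parallel> s"
  shows "tree_eval \<mu> (g(s \<mapsto> a + b)) T = tree_eval \<mu> (g(s \<mapsto> a)) T + tree_eval \<mu> (g(s \<mapsto> b)) T"
  using assms
proof (induction s arbitrary: T g)
  case Nil
  then show ?case by (simp add: tree_eval_Some)
next
  case (Cons i s)
  obtain ts where T: "T = Node ts" by (cases T)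
  have g: "g [] = None" using Cons.prems(3) by (auto simp: dom_def)
  have i: "i < length ts" "is_pos (ts ! i) s" "is_catalan d (ts ! i)" "length ts = d"
    using Cons.prems by (auto simp: T is_catalan_Node)
  let ?base = "map (\<lambda>j. tree_eval \<mu> (\<lambda>q. g (j # q)) (ts ! j)) [0..<d]"
  have upd: "tree_eval \<mu> (g(i # s \<mapsto> c)) T = \<mu> (?base[i := tree_eval \<mu> ((\<lambda>q. g (i # q))(s \<mapsto> c)) (ts ! i)])" for c
  proof -
    have "(g(i # s \<mapsto> c)) [] = None" using g by simp
    note eq = tree_eval_None[where g = "g(i # s \<mapsto> c)", OF this, of \<mu> ts]
    have 1: "(\<lambda>q. (g(i # s \<mapsto> c)) (i # q)) = (\<lambda>q. g (i # q))(s \<mapsto> c)" by auto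
    have 2: "(\<lambda>q. (g(i # s \<mapsto> c)) (j # q)) = (\<lambda>q. g (j # q))" if "j \<noteq> i" for j using that by auto
    show ?thesis unfolding T eq i(4)
    proof (intro arg_cong[where f = \<mu>] nth_equalityI)
      fix j assume "j < length (map (\<lambda>j. tree_eval \<mu> (\<lambda>q. (g(i # s \<mapsto> c)) (j # q)) (ts ! j)) [0..<d])"
      then show "map (\<lambda>j. tree_eval \<mu> (\<lambda>q. (g(i # s \<mapsto> c)) (j # q)) (ts ! j)) [0..<d] ! j
          = ?base[i := tree_eval \<mu> ((\<lambda>q. g (i # q))(s \<mapsto> c)) (ts ! i)] ! j"
        by (cases "j = i") (simp_all add: 1 2 del: fun_upd_apply)
    qed simp
  qed
  have "tree_eval \<mu> ((\<lambda>q. g (i # q))(s \<mapsto> a + b)) (ts ! i)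
      = tree_eval \<mu> ((\<lambda>q. g (i # q))(s \<mapsto> a)) (ts ! i) + tree_eval \<mu> ((\<lambda>q. g (i # q))(s \<mapsto> b)) (ts ! i)"
    using Cons.prems(3) i by (intro Cons.IH) (auto simp: dom_def Cons_parallel_Cons)
  then show ?case unfolding upd using additive[of ?base i] i by simp
qed

text \<open>Every vertex on the path sees \<open>d - 1\<close> copies of \<open>x\<close> and the
  value of the next path vertex. Symmetry of \<open>\<mu>\<close> makes the index of that child
  irrelevant, so each edge contributes one factor \<open>mult_op x\<close>.
  \<open>length v \<le> p\<close> ensures that siblings are replaced all the way up to the
  root.\<close>

lemma tree_eval_path:
  assumes "is_catalan d T" "is_pos T v" "length v \<le> p"
  shows "tree_eval \<mu> (substitute (sibling_positions d p v) (\<lambda>_. x)) T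
       = (mult_op x ^^ length v) (tree_value \<mu> (subt T v))"
  using assms
proof (induction v arbitrary: T)
  case Nil
  then show ?case by simp
next
  case (Cons i v)
  obtain ts where T: "T = Node ts" by (cases T)
  have i: "i < d" "is_pos (ts ! i) v" "is_catalan d (ts ! i)" "length ts = d"
    using Cons.prems by (auto simp: T is_catalan_Node)
  let ?g = "substitute (sibling_positions d p (i # v)) (\<lambda>_. x)"
  let ?h = "(mult_op x ^^ length v) (tree_value \<mu> (subt (ts ! i) v))"
  have mem: "(j # q \<in> sibling_positions d p (i # v)) = (if j = i then q \<in> sibling_positions d p v else q = [] \<and> j < d)" for j q
    using Cons.prems(3) by (auto simp: sibling_positions_Cons Nil_notin_sibling_positions)
  have "?g [] = None" by (simp add: Nil_notin_sibling_positions)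
  then have "tree_eval \<mu> ?g T = \<mu> (map (\<lambda>j. tree_eval \<mu> (\<lambda>q. ?g (j # q)) (ts ! j)) [0..<d])"
    unfolding T using tree_eval_None[of ?g \<mu> ts] i(4) by simp
  also have "map (\<lambda>j. tree_eval \<mu> (\<lambda>q. ?g (j # q)) (ts ! j)) [0..<d] = (replicate d x)[i := ?h]"
  proof (rule nth_equalityI)
    fix j assume "j < length (map (\<lambda>j. tree_eval \<mu> (\<lambda>q. ?g (j # q)) (ts ! j)) [0..<d])"
    then have j: "j < d" by simp
    show "map (\<lambda>j. tree_eval \<mu> (\<lambda>q. ?g (j # q)) (ts ! j)) [0..<d] ! j = (replicate d x)[i := ?h] ! j"
    proof (cases "j = i")
      case True
      then show ?thesis using Cons.IH[OF i(3,2)] Cons.prems(3) j by (simp add: mem)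
    next
      case False
      have "tree_eval \<mu> (\<lambda>q. ?g (j # q)) (ts ! j) = x"
        using False j by (intro tree_eval_Some) (simp add: mem)
      then show ?thesis using False j by simp
    qed
  qed simp
  finally show ?case using mu_replicate_update[OF i(1)] by (simp add: T)
qed

text \<open>The start of the path of length \<open>p\<close> has value \<open>mult_op x ^^ p\<close>
  of something, that is 0, and a zero argument makes every value above it zero.\<close>

lemma tree_eval_siblings_zero:
  assumes nil: "\<And>x h. (mult_op x ^^ p) h = 0"
  assumes "is_catalan d T" "is_pos T v" "p \<le> length v"
  shows "tree_eval \<mu> (substitute (sibling_positions d p v) (\<lambda>_. x)) T = 0"
  using assms(2-)
proof (induction v arbitrary: T)
  case Nil
  then show ?case using tree_eval_path[of T "[]" p] nil by simp
next
  case (Cons i v)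
  show ?case
  \<comment> \<open>This is the case where the path of length \<open>p\<close> starts at the root;
    otherwise all siblings concerned lie below child \<open>i\<close>.\<close>
  proof (cases "p = Suc (length v)")
    case True
    then show ?thesis using tree_eval_path[OF Cons.prems(1,2), of p x] nil by simp
  next
    case False
    then have p: "p \<le> length v" using Cons.prems by simp
    obtain ts where T: "T = Node ts" by (cases T)
    have i: "i < d" "is_pos (ts ! i) v" "is_catalan d (ts ! i)" "length ts = d"
      using Cons.prems by (auto simp: T is_catalan_Node)
    let ?g = "substitute (sibling_positions d p (i # v)) (\<lambda>_. x)"
    let ?l = "map (\<lambda>j. tree_eval \<mu> (\<lambda>q. ?g (j # q)) (ts ! j)) [0..<d]"
    have "?g [] = None" by (simp add: Nil_notin_sibling_positions)
    then have "tree_eval \<mu> ?g T = \<mu> ?l"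
      unfolding T using tree_eval_None[of ?g \<mu> ts] i(4) by simp
    moreover have "(i # q \<in> sibling_positions d p (i # v)) = (q \<in> sibling_positions d p v)" for q
      using p by (auto simp: sibling_positions_Cons)
    then have "?l ! i = 0" using Cons.IH[OF i(3,2) p] i(1) by simp
    then have "0 \<in> set ?l" using nth_mem[of i ?l] i(1) by simp
    ultimately show ?thesis using mu_zero_in_set[of ?l] by simp
  qed
qed

text \<open>Substituting arbitrary values at the siblings gives a form that is additive in each
  slot; its diagonal vanishes by nilpotence. Polarisation at the values of the subtrees of
  \<open>T\<close> itself then gives the sum over all rearrangements. The functional \<phi> makes
  the form complex-valued; later it is a coordinate.\<close>

lemma sum_shuffle_class_zero:
  fixes \<phi> :: "'v \<Rightarrow> complex"
  assumes \<phi>: "\<And>a b. \<phi> (a + b) = \<phi> a + \<phi> b"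
    and nil: "\<And>x h. (mult_op x ^^ p) h = 0"
    and T: "is_catalan d T" "is_pos T v" "p \<le> length v"
  shows "(\<Sum>T'\<in>shuffle_class d T p v. \<phi> (tree_value \<mu> T')) = 0"
proof -
  define S where "S = sibling_positions d p v"
  define Q where "Q z = \<phi> (tree_eval \<mu> (substitute S z) T)" for z
  have \<phi>0: "\<phi> 0 = 0" using \<phi>[of 0 0] by simp
  have "Q (z(s := a + b)) = Q (z(s := a)) + Q (z(s := b))" if s: "s \<in> S" for z s a b
  proof -
    have upd: "substitute S (z(s := c)) = (substitute S z)(s \<mapsto> c)" for c using s by auto
    have "tree_eval \<mu> ((substitute S z)(s \<mapsto> a + b)) T
        = tree_eval \<mu> ((substitute S z)(s \<mapsto> a)) T + tree_eval \<mu> ((substitute S z)(s \<mapsto> b)) T"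
      using s is_pos_sibling_positions[OF T(1,2)] pairwise_parallel_sibling_positions[of d p v]
      by (intro tree_eval_additive T) (auto simp: S_def pairwise_def dom_def split: if_splits)
    then show ?thesis unfolding Q_def upd by (simp add: \<phi> del: fun_upd_apply)
  qed
  then have Q: "multi_additive S Q" unfolding multi_additive_def by blast
  have Q_cong: "Q (\<lambda>k. if k \<in> S then z k else z' k) = Q z" for z z'
    unfolding Q_def by (intro arg_cong[where f = \<phi>] arg_cong[where f = "\<lambda>g. tree_eval \<mu> g T"]) auto
  have "Q (\<lambda>k. if k \<in> S then x else 0) = 0" for x
    using Q_cong[of "\<lambda>_. x" "\<lambda>_. 0"] tree_eval_siblings_zero[OF nil T, of x] \<phi>0
    unfolding Q_def S_def by simp
  then have "0 = (\<Sum>\<sigma> | \<sigma> permutes S. Q (\<lambda>k. if k \<in> S then tree_value \<mu> (subt T (\<sigma> k)) else 0))"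
    using polarisation[OF Q, of "\<lambda>_. 0" "\<lambda>q. tree_value \<mu> (subt T q)"] finite_sibling_positions S_def by simp
  also have "\<dots> = (\<Sum>\<sigma> | \<sigma> permutes S. \<phi> (tree_value \<mu> (tree_eval Node (substitute S (\<lambda>q. subt T (\<sigma> q))) T)))"
  proof (rule sum.cong[OF refl])
    fix \<sigma>
    obtain xs where xs: "distinct xs" "set xs = sibling_positions d p v"
      using finite_distinct_list[OF finite_sibling_positions] by metis
    have "rearrange T xs \<sigma> = tree_eval Node (substitute S (\<lambda>q. subt T (\<sigma> q))) T"
      using tree_value_rearrange[OF T(1,2) xs, of Node \<sigma>] unfolding tree_value_Node_id S_def .
    then show "Q (\<lambda>k. if k \<in> S then tree_value \<mu> (subt T (\<sigma> k)) else 0)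
        = \<phi> (tree_value \<mu> (tree_eval Node (substitute S (\<lambda>q. subt T (\<sigma> q))) T))"
      using tree_value_rearrange[OF T(1,2) xs, of \<mu> \<sigma>] unfolding Q_cong by (simp add: Q_def S_def)
  qed
  finally show ?thesis
    using sum_permutations_shuffle_class[OF T(1,2), of "\<lambda>t. \<phi> (tree_value \<mu> t)" p] unfolding S_def
    by auto
qed

text \<open>Stationarity allows each tree to be weighted by its column sum, which is 1. Exchanging
  the sums splits the total by \<open>T\<close> and \<open>v\<close> into multiples of sums over
  single shuffle classes, all of them zero.\<close>

lemma sum_catalan_trees_zero:
  fixes \<phi> :: "'v \<Rightarrow> complex"
  assumes \<phi>: "\<And>a b. \<phi> (a + b) = \<phi> a + \<phi> b"
    and nil: "\<And>x h. (mult_op x ^^ p) h = 0"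
    and P: "is_shuffle_family d p k P" "uniform_stationary d p k P"
  shows "(\<Sum>T\<in>catalan_trees d k. \<phi> (tree_value \<mu> T)) = 0"
proof -
  let ?C = "catalan_trees d k" and ?e = "\<lambda>T. \<phi> (tree_value \<mu> T)"
  have fin: "finite ?C" by (rule finite_catalan_trees[OF d_pos])
  \<comment> \<open>Uniform stationarity, with the common factor cancelled, says that the transition
    matrix has column sums 1.\<close>
  have stat: "(\<Sum>T\<in>?C. shuffle_trans d p P T T') = 1" if "T' \<in> ?C" for T'
  proof -
    have "real (card ?C) \<noteq> 0" using that fin by auto
    moreover have "(1 / real (card ?C)) * (\<Sum>T\<in>?C. shuffle_trans d p P T T') = 1 / real (card ?C)"
      using P(2) that by (simp add: uniform_stationary_def sum_distrib_left)
    ultimately show ?thesis by simp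
  qed
  have zero: "(\<Sum>T'\<in>?C. of_real (shuffle_trans d p P T T') * ?e T') = 0" if T: "T \<in> ?C" for T
  proof -
    let ?Sh = "\<lambda>v. shuffle_class d T p v"
    have "(\<Sum>T'\<in>?C. of_real (P T v * (if T' \<in> ?Sh v then 1 / real (card (?Sh v)) else 0)) * ?e T') = 0"
      if v: "v \<in> vertices T" for v
    proof (cases "p \<le> length v")
      case True
      have pos: "is_pos T v" using v by (simp add: vertices_def)
      have "(\<Sum>T'\<in>?C. of_real (P T v * (if T' \<in> ?Sh v then 1 / real (card (?Sh v)) else 0)) * ?e T')
          = (\<Sum>T'\<in>?C. if T' \<in> ?Sh v then of_real (P T v / real (card (?Sh v))) * ?e T' else 0)"
        by (intro sum.cong refl) simp
      also have "\<dots> = (\<Sum>T'\<in>?C \<inter> ?Sh v. of_real (P T v / real (card (?Sh v))) * ?e T')"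
        by (rule sum.inter_restrict[OF fin, symmetric])
      also have "?C \<inter> ?Sh v = ?Sh v" using shuffle_class_subset[OF T pos] by blast
      also have "(\<Sum>T'\<in>?Sh v. of_real (P T v / real (card (?Sh v))) * ?e T') = 0"
        using sum_shuffle_class_zero[OF \<phi> nil _ pos True] T
        unfolding sum_distrib_left[symmetric] by (simp add: catalan_trees_alt)
      finally show ?thesis .
    next
      case False
      then have "P T v = 0" using P(1) T v unfolding is_shuffle_family_def by force
      then show ?thesis by simp
    qed
    then have "(\<Sum>v\<in>vertices T. \<Sum>T'\<in>?C. of_real (P T v * (if T' \<in> ?Sh v then 1 / real (card (?Sh v)) else 0)) * ?e T') = 0"
      by simp
    then show ?thesis
      unfolding shuffle_trans_def of_real_sum sum_distrib_right by (subst sum.swap)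
  qed
  have "(\<Sum>T'\<in>?C. ?e T') = (\<Sum>T'\<in>?C. of_real (\<Sum>T\<in>?C. shuffle_trans d p P T T') * ?e T')"
    by (intro sum.cong refl) (simp add: stat del: of_real_sum)
  also have "\<dots> = (\<Sum>T\<in>?C. \<Sum>T'\<in>?C. of_real (shuffle_trans d p P T T') * ?e T')"
    unfolding of_real_sum sum_distrib_right by (rule sum.swap)
  also have "\<dots> = 0" using zero by simp
  finally show ?thesis .
qed

section \<open>Tree sums as the graded pieces of the inverse\<close>

definition tree_sum :: "nat \<Rightarrow> 'v" where
  "tree_sum k = (\<Sum>T\<in>catalan_trees d k. tree_value \<mu> T)"

lemma tree_sum_0: "tree_sum 0 = \<mu> []"
  by (simp add: tree_sum_def catalan_trees_0 tree_value_Node)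

text \<open>The size-graded form of the equation G = \<open>\<mu> []\<close> + \<mu>(G, ..., G): the
  root is removed and the \<open>d\<close> subtrees are summed independently.\<close>

lemma tree_sum_Suc: "tree_sum (Suc k) = (\<Sum>ks | length ks = d \<and> sum_list ks = k. \<mu> (map tree_sum ks))"
proof -
  let ?K = "{ks. length ks = d \<and> sum_list ks = k}"
  let ?L = "\<lambda>ks. listset (map (catalan_trees d) ks)"
  have fin: "\<forall>B\<in>set (map (catalan_trees d) ks). finite B" for ks
    using finite_catalan_trees[OF d_pos] by auto
  have "tree_sum (Suc k) = (\<Sum>ts\<in>(\<Union>ks\<in>?K. ?L ks). tree_value \<mu> (Node ts))"
    unfolding tree_sum_def catalan_trees_Suc[OF d_pos]
    by (subst sum.reindex) (simp_all add: inj_on_def)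
  also have "\<dots> = (\<Sum>ks\<in>?K. \<Sum>ts\<in>?L ks. \<mu> (map (tree_value \<mu>) ts))"
    unfolding tree_value_Node
  proof (rule sum.UNION_disjoint[OF finite_compositions])
    show "\<forall>ks\<in>?K. finite (?L ks)" using finite_listset[OF fin] by blast
    show "\<forall>ks\<in>?K. \<forall>ks'\<in>?K. ks \<noteq> ks' \<longrightarrow> ?L ks \<inter> ?L ks' = {}"
      by (auto simp: in_listset_catalan_trees)
  qed
  also have "\<dots> = (\<Sum>ks\<in>?K. \<mu> (map tree_sum ks))"
  proof (intro sum.cong refl)
    fix ks assume "ks \<in> ?K"
    then show "(\<Sum>ts\<in>?L ks. \<mu> (map (tree_value \<mu>) ts)) = \<mu> (map tree_sum ks)"
      using mu_listset[of "[]" "map (catalan_trees d) ks" "tree_value \<mu>", OF _ fin]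
      by (simp add: o_def tree_sum_def[abs_def])
  qed
  finally show ?thesis .
qed

text \<open>Expanding the operation at \<open>G\<close> gives all size vectors with entries below
  \<open>K\<close>. Vectors with a larger entry contribute 0, so grouping by total size yields
  complete tree sums.\<close>

lemma tree_sum_fixed_point:
  assumes K: "\<And>k. K \<le> k \<Longrightarrow> tree_sum k = 0"
  defines "G \<equiv> \<Sum>k<K. tree_sum k"
  shows "G = \<mu> [] + \<mu> (replicate d G)"
proof -
  let ?L = "{ks. length ks = d \<and> set ks \<subseteq> {..<K}}"
  have listset: "listset (replicate n {..<K}) = {ks. length ks = n \<and> set ks \<subseteq> {..<K}}" for n
    unfolding in_listset_iff[abs_def] set_eq_iff
    by (auto simp: in_listset_iff list_all2_conv_all_nth set_conv_nth)
  have finL: "finite ?L" using finite_lists_length_eq[of "{..<K}" d] by (simp add: conj_commute)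
  have "\<mu> (replicate d G) = (\<Sum>ks\<in>?L. \<mu> (map tree_sum ks))"
    using mu_listset[of "[]" "replicate d {..<K}" tree_sum] by (simp add: G_def listset)
  \<comment> \<open>Totals are at most \<open>d * K\<close>; the extra \<open>K\<close> makes the
    final range visibly contain all \<open>k < K\<close>.\<close>
  also have "\<dots> = (\<Sum>k\<in>{..d * K + K}. \<Sum>ks\<in>{ks \<in> ?L. sum_list ks = k}. \<mu> (map tree_sum ks))"
  proof (rule sum.group[symmetric, OF finL])
    show "sum_list ` ?L \<subseteq> {..d * K + K}"
    proof
      fix s assume "s \<in> sum_list ` ?L"
      then obtain ks where ks: "s = sum_list ks" "length ks = d" "set ks \<subseteq> {..<K}" by auto
      have "sum_list ks \<le> length ks * K"
        using sum_list_mono[of ks "\<lambda>k. k" "\<lambda>_. K"] ks(3) by (force simp: sum_list_triv)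
      then show "s \<in> {..d * K + K}" using ks by simp
    qed
  qed simp
  also have "\<dots> = (\<Sum>k\<in>{..d * K + K}. tree_sum (Suc k))"
  proof (intro sum.cong refl)
    fix k
    show "(\<Sum>ks\<in>{ks \<in> ?L. sum_list ks = k}. \<mu> (map tree_sum ks)) = tree_sum (Suc k)"
      unfolding tree_sum_Suc
    proof (rule sum.mono_neutral_left[OF finite_compositions])
      show "\<forall>ks\<in>{ks. length ks = d \<and> sum_list ks = k} - {ks \<in> ?L. sum_list ks = k}. \<mu> (map tree_sum ks) = 0"
      proof
        fix ks assume "ks \<in> {ks. length ks = d \<and> sum_list ks = k} - {ks \<in> ?L. sum_list ks = k}"
        then obtain k' where "length ks = d" "k' \<in> set ks" "K \<le> k'" by force
        then show "\<mu> (map tree_sum ks) = 0"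
          using K[of k'] by (intro mu_zero_in_set) (auto simp: image_iff intro!: bexI[of _ k'])
      qed
    qed auto
  qed
  also have "\<mu> [] + \<dots> = (\<Sum>k\<le>Suc (d * K + K). tree_sum k)"
    by (simp add: sum.atMost_Suc_shift tree_sum_0 del: sum.atMost_Suc)
  also have "\<dots> = G"
    unfolding G_def by (rule sum.mono_neutral_right) (auto simp: K)
  finally show ?thesis by simp
qed

end

section \<open>Polynomial functions of countably many variables\<close>

text \<open>No number of variables is fixed, so variables can be added without changing types, and
  closure under composition is a plain induction.\<close>

inductive poly_expr :: "((nat \<Rightarrow> complex) \<Rightarrow> complex) \<Rightarrow> bool" where
  const: "poly_expr (\<lambda>_. c)"
| var: "poly_expr (\<lambda>x. x i)"
| add: "poly_expr f \<Longrightarrow> poly_expr g \<Longrightarrow> poly_expr (\<lambda>x. f x + g x)"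
| mult: "poly_expr f \<Longrightarrow> poly_expr g \<Longrightarrow> poly_expr (\<lambda>x. f x * g x)"

lemma poly_expr_if: "poly_expr f \<Longrightarrow> poly_expr g \<Longrightarrow> poly_expr (\<lambda>x. if b then f x else g x)"
  by (cases b) simp_all

lemma poly_expr_sum: "(\<And>a. a \<in> A \<Longrightarrow> poly_expr (f a)) \<Longrightarrow> poly_expr (\<lambda>x. \<Sum>a\<in>A. f a x)"
  by (induction A rule: infinite_finite_induct) (auto intro: poly_expr.intros)

lemma poly_expr_prod: "(\<And>a. a \<in> A \<Longrightarrow> poly_expr (f a)) \<Longrightarrow> poly_expr (\<lambda>x. \<Prod>a\<in>A. f a x)"
  by (induction A rule: infinite_finite_induct) (auto intro: poly_expr.intros)

lemma poly_expr_sum_list: "(\<And>a. a \<in> set as \<Longrightarrow> poly_expr (f a)) \<Longrightarrow> poly_expr (\<lambda>x. \<Sum>a\<leftarrow>as. f a x)"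
  by (induction as) (auto intro: poly_expr.intros)

lemma poly_expr_compose:
  "poly_expr f \<Longrightarrow> (\<And>i. poly_expr (\<lambda>x. g x i)) \<Longrightarrow> poly_expr (\<lambda>x. f (g x))"
  by (induction rule: poly_expr.induct) (auto intro: poly_expr.intros)

text \<open>Serves to restrict polynomial maps to lines through 0, where the identity theorem for
  one-variable polynomials applies.\<close>

lemma poly_expr_univariate:
  assumes "poly_expr f" and "\<And>i. \<exists>q :: complex poly. \<forall>s. \<gamma> s i = poly q s"
  shows "\<exists>q :: complex poly. \<forall>s. f (\<gamma> s) = poly q s"
  using assms(1)
proof (induction rule: poly_expr.induct)
  case (const c)
  show ?case by (rule exI[of _ "[:c:]"]) simp
next
  case (var i)
  show ?case by (rule assms(2))
next
  case (add f g)
  then obtain q q' where "\<forall>s. f (\<gamma> s) = poly q s" "\<forall>s. g (\<gamma> s) = poly q' s" by blast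
  then show ?case by (intro exI[of _ "q + q'"]) simp
next
  case (mult f g)
  then obtain q q' where "\<forall>s. f (\<gamma> s) = poly q s" "\<forall>s. g (\<gamma> s) = poly q' s" by blast
  then show ?case by (intro exI[of _ "q * q'"]) simp
qed

section \<open>Polynomial maps given by lists of monomials\<close>

text \<open>A monomial is a word of variables with repetitions: degree is length, the product rule
  is a list recursion, and polarisation permutes letters.\<close>

type_synonym monomial_term = "complex \<times> nat list \<times> nat"

definition mon :: "(nat \<Rightarrow> complex) \<Rightarrow> nat list \<Rightarrow> complex" where
  "mon x vs = prod_list (map x vs)"

fun dmon :: "(nat \<Rightarrow> complex) \<Rightarrow> (nat \<Rightarrow> complex) \<Rightarrow> nat list \<Rightarrow> complex" where
  "dmon x h [] = 0"
| "dmon x h (v # vs) = h v * mon x vs + x v * dmon x h vs"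

text \<open>A term \<open>(c, vs, k)\<close> stands for \<open>c\<close> times the product of the variables listed in \<open>vs\<close>, placed
  in the \<open>k\<close>-th component; \<open>dpert L x h\<close> is the derivative of \<open>pert L\<close> at \<open>x\<close> in the direction \<open>h\<close>.\<close>
definition pert :: "monomial_term list \<Rightarrow> (nat \<Rightarrow> complex) \<Rightarrow> nat \<Rightarrow> complex" where
  "pert L x i = (\<Sum>(c, vs, k)\<leftarrow>L. if k = i then c * mon x vs else 0)"

definition dpert :: "monomial_term list \<Rightarrow> (nat \<Rightarrow> complex) \<Rightarrow> (nat \<Rightarrow> complex) \<Rightarrow> nat \<Rightarrow> complex" where
  "dpert L x h i = (\<Sum>(c, vs, k)\<leftarrow>L. if k = i then c * dmon x h vs else 0)"

definition pert_map :: "monomial_term list \<Rightarrow> (nat \<Rightarrow> complex) \<Rightarrow> nat \<Rightarrow> complex" where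
  "pert_map L x i = x i + pert L x i"

text \<open>Bounds inputs and outputs alike, so that \<open>pert_map L\<close> is the identity in
  all coordinates from \<open>N\<close> on.\<close>

definition vars_below :: "nat \<Rightarrow> monomial_term list \<Rightarrow> bool" where
  "vars_below N L \<longleftrightarrow> (\<forall>(c, vs, k)\<in>set L. k < N \<and> set vs \<subseteq> {..<N})"

definition degrees_in :: "nat set \<Rightarrow> monomial_term list \<Rightarrow> bool" where
  "degrees_in D L \<longleftrightarrow> (\<forall>(c, vs, k)\<in>set L. length vs \<in> D)"

text \<open>Stands in for a nowhere vanishing Jacobian determinant, in a form independent of the
  dimension.\<close>

definition nonsingular :: "monomial_term list \<Rightarrow> bool" where
  "nonsingular L \<longleftrightarrow> (\<forall>x h. (\<forall>i. h i + dpert L x h i = 0) \<longrightarrow> (\<forall>i. h i = 0))"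

definition poly_invertible :: "monomial_term list \<Rightarrow> bool" where
  "poly_invertible L \<longleftrightarrow> (\<exists>G. (\<forall>i. poly_expr (\<lambda>x. G x i)) \<and>
     (\<forall>x. G (pert_map L x) = x) \<and> (\<forall>x. pert_map L (G x) = x))"

lemma mon_simps [simp]:
  "mon x [] = 1" "mon x (v # vs) = x v * mon x vs" "mon x (us @ vs) = mon x us * mon x vs"
  "mon x (replicate m v) = x v ^ m"
  by (simp_all add: mon_def)

lemma dmon_append [simp]: "dmon x h (us @ vs) = dmon x h us * mon x vs + mon x us * dmon x h vs"
  by (induction us) (simp_all add: algebra_simps)

lemma dmon_replicate_zero [simp]: "h v = 0 \<Longrightarrow> dmon x h (replicate m v) = 0"
  by (induction m) simp_all

lemma mon_cong: "(\<And>v. v \<in> set vs \<Longrightarrow> x v = y v) \<Longrightarrow> mon x vs = mon y vs"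
  by (induction vs) simp_all

lemma dmon_cong:
  "(\<And>v. v \<in> set vs \<Longrightarrow> x v = y v) \<Longrightarrow> (\<And>v. v \<in> set vs \<Longrightarrow> h v = h' v) \<Longrightarrow> dmon x h vs = dmon y h' vs"
proof (induction vs)
  case (Cons v vs)
  then show ?case using mon_cong[of vs x y] by simp
qed simp

lemma dmon_zero_direction: "(\<And>v. v \<in> set vs \<Longrightarrow> h v = 0) \<Longrightarrow> dmon x h vs = 0"
  by (induction vs) simp_all

lemma mon_scale: "mon (\<lambda>i. r * x i) vs = r ^ length vs * mon x vs"
  by (induction vs) simp_all

lemma dmon_scale: "dmon (\<lambda>i. r * x i) h vs = r ^ (length vs - 1) * dmon x h vs"
proof (induction vs)
  case (Cons v vs)
  have "r * (r ^ (length vs - 1) * dmon x h vs) = r ^ length vs * dmon x h vs"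
    by (cases vs) simp_all
  then show ?case by (simp add: Cons mon_scale algebra_simps)
qed simp

lemma pert_simps [simp]:
  "pert [] x i = 0" "pert ((c, vs, k) # L) x i = (if k = i then c * mon x vs else 0) + pert L x i"
  "pert (L @ L') x i = pert L x i + pert L' x i"
  by (simp_all add: pert_def)

lemma dpert_simps [simp]:
  "dpert [] x h i = 0"
  "dpert ((c, vs, k) # L) x h i = (if k = i then c * dmon x h vs else 0) + dpert L x h i"
  "dpert (L @ L') x h i = dpert L x h i + dpert L' x h i"
  by (simp_all add: dpert_def)

lemma vars_below_simps [simp]:
  "vars_below N []"
  "vars_below N ((c, vs, k) # L) \<longleftrightarrow> k < N \<and> set vs \<subseteq> {..<N} \<and> vars_below N L"
  "vars_below N (L @ L') \<longleftrightarrow> vars_below N L \<and> vars_below N L'"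
  by (simp_all add: vars_below_def ball_Un)

lemma degrees_in_simps [simp]:
  "degrees_in D []" "degrees_in D ((c, vs, k) # L) \<longleftrightarrow> length vs \<in> D \<and> degrees_in D L"
  "degrees_in D (L @ L') \<longleftrightarrow> degrees_in D L \<and> degrees_in D L'"
  by (simp_all add: degrees_in_def ball_Un)

lemma vars_below_mono: "vars_below N L \<Longrightarrow> N \<le> N' \<Longrightarrow> vars_below N' L"
  by (force simp: vars_below_def)

lemma pert_outside: "vars_below N L \<Longrightarrow> N \<le> i \<Longrightarrow> pert L x i = 0"
  by (induction L) auto

lemma dpert_outside: "vars_below N L \<Longrightarrow> N \<le> i \<Longrightarrow> dpert L x h i = 0"
  by (induction L) auto

lemma dpert_no_output: "\<forall>(c, vs, k)\<in>set L. k \<noteq> i \<Longrightarrow> dpert L x h i = 0"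
  by (induction L) auto

lemma pert_cong:
  assumes "vars_below N L" "\<And>j. j < N \<Longrightarrow> x j = y j"
  shows "pert L x i = pert L y i"
  using assms(1)
proof (induction L)
  case (Cons t L)
  obtain c vs k where t: "t = (c, vs, k)" by (cases t)
  have "mon x vs = mon y vs" using Cons.prems assms(2) by (intro mon_cong) (auto simp: t)
  then show ?case using Cons by (simp add: t)
qed simp

lemma dpert_cong:
  assumes "vars_below N L" "\<And>j. j < N \<Longrightarrow> x j = y j" "\<And>j. j < N \<Longrightarrow> h j = h' j"
  shows "dpert L x h i = dpert L y h' i"
  using assms(1)
proof (induction L)
  case (Cons t L)
  obtain c vs k where t: "t = (c, vs, k)" by (cases t)
  have "dmon x h vs = dmon y h' vs" using Cons.prems assms(2,3) by (intro dmon_cong) (auto simp: t)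
  then show ?case using Cons by (simp add: t)
qed simp

lemma dpert_scale: "degrees_in {m} L \<Longrightarrow> dpert L (\<lambda>i. r * x i) h i = r ^ (m - 1) * dpert L x h i"
  by (induction L) (auto simp: dmon_scale algebra_simps)

lemma nonsingularD:
  assumes "nonsingular L" "vars_below N L" "\<And>i. i < N \<Longrightarrow> h i + dpert L x h i = 0" "i < N"
  shows "h i = 0"
proof -
  let ?h = "\<lambda>i. if i < N then h i else 0"
  have "?h i + dpert L x ?h i = 0" for i
    using assms(3)[of i] dpert_cong[OF assms(2), of x x ?h h i] dpert_outside[OF assms(2), of i x ?h]
    by (cases "i < N") auto
  then have "\<forall>i. ?h i = 0" using assms(1)[unfolded nonsingular_def, rule_format, of ?h x] by blast
  then show ?thesis using assms(4) by (metis (full_types))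
qed

lemma poly_expr_mon: "poly_expr (\<lambda>x. mon x vs)"
  by (induction vs) (auto intro: poly_expr.intros)

text \<open>\<open>\<theta>\<close> embeds the graph of \<open>pert_map L\<close> into that of a map in more variables, compatibly with
  the embedding \<open>\<iota>\<close> of the target.\<close>
lemma poly_invertible_stabilise:
  assumes inv: "poly_invertible L'" and L: "vars_below N L"
    and \<iota>: "\<And>i. poly_expr (\<lambda>u. \<iota> u i)"
    and \<theta>: "\<And>x i. i < N \<Longrightarrow> \<theta> x i = x i"
    and graph: "\<And>x. pert_map L' (\<theta> x) = \<iota> (pert_map L x)"
    and recover: "\<And>w u i. pert_map L' w = \<iota> u \<Longrightarrow> i < N \<Longrightarrow> pert_map L w i = u i"
  shows "poly_invertible L"
proof -
  obtain G' where G': "\<And>i. poly_expr (\<lambda>x. G' x i)" "\<And>x. G' (pert_map L' x) = x" "\<And>x. pert_map L' (G' x) = x"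
    using inv unfolding poly_invertible_def by blast
  define G where "G u i = (if i < N then G' (\<iota> u) i else u i)" for u i
  have "poly_expr (\<lambda>u. G u i)" for i
    using poly_expr_compose[OF G'(1)[of i], of \<iota>] \<iota> by (cases "i < N") (auto simp: G_def intro: poly_expr.intros)
  moreover have "G (pert_map L x) = x" for x
  proof
    fix i
    show "G (pert_map L x) i = x i"
      using \<theta>[of i x] pert_outside[OF L, of i x] by (simp add: G_def graph[symmetric] G'(2)) (simp add: pert_map_def)
  qed
  moreover have "pert_map L (G u) = u" for u
  proof
    fix i
    show "pert_map L (G u) i = u i"
    proof (cases "i < N")
      case True
      have "pert L (G u) i = pert L (G' (\<iota> u)) i" by (rule pert_cong[OF L]) (simp add: G_def)
      then have "pert_map L (G u) i = pert_map L (G' (\<iota> u)) i" using True by (simp add: pert_map_def G_def)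
      then show ?thesis using recover[OF G'(3) True] by simp
    next
      case False
      then show ?thesis using pert_outside[OF L, of i "G u"] by (simp add: pert_map_def G_def)
    qed
  qed
  ultimately show ?thesis unfolding poly_invertible_def by blast
qed

section \<open>Reduction of the degree\<close>

text \<open>Termination measure of the degree reduction. Splitting two variables off a monomial of
  degree n creates terms of degrees n - 1 and n - 2, besides terms of degree at most 3, and 3^(n-1)
  + 3^(n-2) < 3^n.\<close>

definition excess :: "monomial_term list \<Rightarrow> nat" where
  "excess L = (\<Sum>(c, vs, k)\<leftarrow>L. if length vs \<le> 3 then 0 else 3 ^ length vs)"

lemma excess_simps [simp]:
  "excess [] = 0"
  "excess ((c, vs, k) # L) = (if length vs \<le> 3 then 0 else 3 ^ length vs) + excess L"
  "excess (L @ L') = excess L + excess L'"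
  by (simp_all add: excess_def)

text \<open>With two new variables \<open>y\<close>, \<open>z\<close>, the monomial \<open>c a b\<close> in component \<open>k\<close> is traded for
  monomials of lower degree by adding \<open>c a\<close> to \<open>y\<close> and \<open>b\<close> to \<open>z\<close> and then subtracting \<open>y z\<close> from
  component \<open>k\<close>.\<close>
definition split_terms :: "nat \<Rightarrow> complex \<Rightarrow> nat list \<Rightarrow> nat list \<Rightarrow> nat \<Rightarrow> monomial_term list" where
  "split_terms N c as bs k = [(c, as, N), (1, bs, Suc N), (-1, [N, Suc N], k), (-1, N # bs, k), (- c, Suc N # as, k)]"

context
  fixes N :: nat and c :: complex and as bs :: "nat list" and k :: nat and L1 L2 L L' :: "monomial_term list"
  defines "L \<equiv> L1 @ (c, as @ bs, k) # L2"
  defines "L' \<equiv> L1 @ L2 @ split_terms N c as bs k"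
  assumes below: "vars_below N L"
begin

private lemma below_parts: "k < N" "set as \<subseteq> {..<N}" "set bs \<subseteq> {..<N}" "vars_below N L1" "vars_below N L2"
  using below by (auto simp: L_def)

text \<open>Multiplying out the product gives four terms: c a b cancels the traded monomial of
  \<open>L\<close>, and the other three are the terms of \<open>split_terms\<close> in component
  \<open>k\<close>.\<close>

private lemma pert_map_split:
  "pert_map L' x i = (if i = N then x N + c * mon x as else if i = Suc N then x (Suc N) + mon x bs
     else if i = k then pert_map L x k - (x N + c * mon x as) * (x (Suc N) + mon x bs) else pert_map L x i)"
  using below_parts pert_outside[OF below_parts(4)] pert_outside[OF below_parts(5)]
  by (auto simp: pert_map_def L'_def L_def split_terms_def algebra_simps)

private lemma dpert_split:
  "h i + dpert L' x h i = (if i = N then h N + c * dmon x h as else if i = Suc N then h (Suc N) + dmon x h bs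
     else if i = k then h k + dpert L x h k - (h N + c * dmon x h as) * (x (Suc N) + mon x bs)
       - (x N + c * mon x as) * (h (Suc N) + dmon x h bs)
     else h i + dpert L x h i)"
  using below_parts dpert_outside[OF below_parts(4)] dpert_outside[OF below_parts(5)]
  by (auto simp: L'_def L_def split_terms_def algebra_simps)

lemma vars_below_split: "vars_below (Suc (Suc N)) L'"
  using below_parts vars_below_mono[OF below_parts(4), of "Suc (Suc N)"]
    vars_below_mono[OF below_parts(5), of "Suc (Suc N)"]
  by (auto simp: L'_def split_terms_def)

lemma nonsingular_split:
  assumes "nonsingular L"
  shows "nonsingular L'"
  unfolding nonsingular_def
proof (intro allI impI)
  fix x h i
  assume "\<forall>i. h i + dpert L' x h i = 0"
  then have zero: "h i + dpert L' x h i = 0" for i by blast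
  have hN: "h N + c * dmon x h as = 0" using zero[of N] by (simp add: dpert_split)
  have hN': "h (Suc N) + dmon x h bs = 0" using zero[of "Suc N"] by (simp add: dpert_split)
  \<comment> \<open>Row \<open>k\<close> differs from that of \<open>L\<close> by products with the
    two expressions just shown to be zero.\<close>
  have eq: "h i + dpert L x h i = 0" if "i < N" for i
    using zero[of i] that hN hN' by (cases "i = k") (simp_all add: dpert_split)
  have low: "h i = 0" if "i < N" for i using nonsingularD[OF assms below eq that] .
  have "dmon x h as = 0" "dmon x h bs = 0" using low below_parts by (auto intro!: dmon_zero_direction)
  then have "h N = 0" "h (Suc N) = 0" using hN hN' by auto
  moreover have "h i = 0" if "Suc N < i"
    using zero[of i] that dpert_outside[OF vars_below_split, of i x h] by simp
  ultimately show "h i = 0" using low by (cases "i < N"; cases "i = N"; cases "i = Suc N") auto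
qed

lemma poly_invertible_split:
  assumes "poly_invertible L'"
  shows "poly_invertible L"
proof (rule poly_invertible_stabilise[OF assms below])
  \<comment> \<open>The new coordinates are chosen to make both factors y + c a and z + b zero, so
    the image lies in the slice y = z = 0 and component \<open>k\<close> keeps its old
    value.\<close>
  let ?\<theta> = "\<lambda>x. x(N := - c * mon x as, Suc N := - mon x bs)"
  let ?\<iota> = "\<lambda>u. u(N := 0, Suc N := 0)"
  show "poly_expr (\<lambda>u. ?\<iota> u i)" for i
    by (cases "i = N"; cases "i = Suc N") (simp_all add: poly_expr.intros)
  show "?\<theta> x i = x i" if "i < N" for x i using that by simp
  show "pert_map L' (?\<theta> x) = ?\<iota> (pert_map L x)" for x
  proof
    fix i
    have 1: "mon (?\<theta> x) as = mon x as" "mon (?\<theta> x) bs = mon x bs"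
      using below_parts by (auto intro!: mon_cong)
    have "pert L (?\<theta> x) i = pert L x i" for i by (rule pert_cong[OF below]) simp
    then have 2: "pert_map L (?\<theta> x) i = pert_map L x i" if "i \<noteq> N" "i \<noteq> Suc N" for i
      using that by (simp add: pert_map_def)
    show "pert_map L' (?\<theta> x) i = ?\<iota> (pert_map L x) i"
      unfolding pert_map_split 1 using 2[of i] 2[of k] below_parts(1) by auto
  qed
  fix w u i assume w: "pert_map L' w = ?\<iota> u" and i: "i < N"
  have "w N + c * mon w as = 0" using fun_cong[OF w, of N] by (simp add: pert_map_split)
  then show "pert_map L w i = u i" using fun_cong[OF w, of i] i by (auto simp: pert_map_split split: if_splits)
qed

lemma excess_split:
  assumes "length as = 2" "2 \<le> length bs"
  shows "excess L' < excess L"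
proof -
  obtain m where m: "length bs = Suc (Suc m)" using assms(2) by (metis add_2_eq_Suc le_Suc_ex)
  show ?thesis using assms by (simp add: L'_def L_def split_terms_def m)
qed

lemma degrees_in_split:
  assumes "degrees_in {2..} L" "length as = 2" "2 \<le> length bs"
  shows "degrees_in {2..} L'"
  using assms by (simp add: L_def L'_def split_terms_def)

end

text \<open>Any monomial of degree at least 4 is split into two variables and the rest, until
  \<open>excess\<close> can decrease no further.\<close>

lemma reduce_to_cubic:
  assumes base: "\<And>N L. vars_below N L \<Longrightarrow> degrees_in {2, 3} L \<Longrightarrow> nonsingular L \<Longrightarrow> poly_invertible L"
    and "vars_below N L" "degrees_in {2..} L" "nonsingular L"
  shows "poly_invertible L"
  using assms(2-)
proof (induction "excess L" arbitrary: N L rule: less_induct)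
  case less
  show ?case
  proof (cases "degrees_in {2, 3} L")
    case True
    then show ?thesis using base less.prems by blast
  next
    case False
    then obtain c vs k where t: "(c, vs, k) \<in> set L" "length vs \<notin> {2, 3}" by (auto simp: degrees_in_def)
    then have len: "4 \<le> length vs" using less.prems(2) by (force simp: degrees_in_def)
    obtain L1 L2 where L: "L = L1 @ (c, vs, k) # L2" using t(1) by (meson split_list)
    define as bs where "as = take 2 vs" and "bs = drop 2 vs"
    have L: "L = L1 @ (c, as @ bs, k) # L2" by (simp add: L as_def bs_def)
    have ab: "length as = 2" "2 \<le> length bs" using len by (auto simp: as_def bs_def)
    let ?L' = "L1 @ L2 @ split_terms N c as bs k"
    note prems = less.prems[unfolded L]
    have "poly_invertible ?L'"
      using less.hyps[of ?L' "Suc (Suc N)"] excess_split[OF prems(1) ab] vars_below_split[OF prems(1)]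
        degrees_in_split[OF prems(1,2) ab] nonsingular_split[OF prems(1,3)]
      by (simp add: L)
    then show ?thesis unfolding L by (rule poly_invertible_split[OF prems(1)])
  qed
qed

section \<open>Homogenisation\<close>

lemma pert_map_vars:
  "pert (map (\<lambda>(c, vs, k). (c, us @ vs, f k)) L) x i
     = mon x us * (\<Sum>(c, vs, k)\<leftarrow>L. if f k = i then c * mon x vs else 0)"
  by (induction L) (auto simp: algebra_simps)

lemma dpert_map_vars:
  assumes "dmon x h us = 0"
  shows "dpert (map (\<lambda>(c, vs, k). (c, us @ vs, f k)) L) x h i
     = mon x us * (\<Sum>(c, vs, k)\<leftarrow>L. if f k = i then c * dmon x h vs else 0)"
  using assms by (induction L) (auto simp: algebra_simps)

lemma sum_list_shift:
  fixes N i :: nat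
  shows
  "(\<Sum>(c, vs, k)\<leftarrow>L. if N + k = i then F c vs else 0)
     = (if N \<le> i then \<Sum>(c, vs, k)\<leftarrow>L. if k = i - N then F c vs else 0 else (0::complex))"
  by (induction L) auto

lemma sum_list_indicator: "(\<Sum>k\<leftarrow>[0..<N]. if k = i then F k else 0) = (if i < N then F i else (0::complex))"
  by (induction N) auto

text \<open>For \<open>x + Q(x) + C(x)\<close> with \<open>Q\<close> quadratic and \<open>C\<close> cubic, this is the map
  \<open>(x, y, t) \<mapsto> (x + t^(d-2) Q(x) - t^(d-1) y, y + t^(d-3) C(x), t)\<close>.\<close>
definition homogenise :: "nat \<Rightarrow> nat \<Rightarrow> monomial_term list \<Rightarrow> monomial_term list \<Rightarrow> monomial_term list" where
  "homogenise d N Q C =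
     map (\<lambda>(c, vs, k). (c, replicate (d - 2) (2 * N) @ vs, k)) Q @
     map (\<lambda>(c, vs, k). (c, replicate (d - 3) (2 * N) @ vs, N + k)) C @
     map (\<lambda>k. (-1, replicate (d - 1) (2 * N) @ [N + k], k)) [0..<N]"

lemma pert_homogenise:
  "pert (homogenise d N Q C) x i = x (2 * N) ^ (d - 2) * pert Q x i
     + (if N \<le> i then x (2 * N) ^ (d - 3) * pert C x (i - N) else 0)
     - (if i < N then x (2 * N) ^ (d - 1) * x (N + i) else 0)"
proof -
  have "pert (map (\<lambda>k. (-1, replicate (d - 1) (2 * N) @ [N + k], k)) [0..<N]) x i
      = (\<Sum>k\<leftarrow>[0..<N]. if k = i then - (x (2 * N) ^ (d - 1) * x (N + k)) else 0)"
    unfolding pert_def map_map by (intro arg_cong[where f = sum_list] map_cong refl) simp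
  then show ?thesis
    using pert_map_vars[of "replicate (d - 2) (2 * N)" "\<lambda>k. k" Q x i]
      pert_map_vars[of "replicate (d - 3) (2 * N)" "\<lambda>k. N + k" C x i]
    by (simp add: homogenise_def sum_list_shift[where F = "\<lambda>c vs. c * mon x vs"] sum_list_indicator pert_def[symmetric])
qed

lemma dpert_homogenise:
  assumes "h (2 * N) = 0"
  shows "dpert (homogenise d N Q C) x h i = x (2 * N) ^ (d - 2) * dpert Q x h i
     + (if N \<le> i then x (2 * N) ^ (d - 3) * dpert C x h (i - N) else 0)
     - (if i < N then x (2 * N) ^ (d - 1) * h (N + i) else 0)"
proof -
  have "dpert (map (\<lambda>k. (-1, replicate (d - 1) (2 * N) @ [N + k], k)) [0..<N]) x h i
      = (\<Sum>k\<leftarrow>[0..<N]. if k = i then - (x (2 * N) ^ (d - 1) * h (N + k)) else 0)"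
    unfolding dpert_def map_map using assms by (intro arg_cong[where f = sum_list] map_cong refl) simp
  then show ?thesis
    using dpert_map_vars[of x h "replicate (d - 2) (2 * N)" "\<lambda>k. k" Q i]
      dpert_map_vars[of x h "replicate (d - 3) (2 * N)" "\<lambda>k. N + k" C i] assms
    by (simp add: homogenise_def sum_list_shift[where F = "\<lambda>c vs. c * dmon x h vs"] sum_list_indicator dpert_def[symmetric])
qed

text \<open>On the slice t = 1, y = -C(x) the new map is the old one followed by an embedding. For
  nonsingularity at general t, eliminating the y-direction leaves h + r dQ h + r^2 dC h with r =
  t^(d-2), which is the old derivative at the base point r x because dQ and dC have degrees 1 and 2
  in the base point.\<close>

lemma reduce_to_homogeneous:
  assumes d: "3 \<le> d"
    and base: "\<And>N L. vars_below N L \<Longrightarrow> degrees_in {d} L \<Longrightarrow> nonsingular L \<Longrightarrow> poly_invertible L"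
    and L: "vars_below N L" "degrees_in {2, 3} L" "nonsingular L"
  shows "poly_invertible L"
proof -
  define Q where "Q = filter (\<lambda>(c, vs, k). length vs = 2) L"
  define C where "C = filter (\<lambda>(c, vs, k). length vs = 3) L"
  define L' where "L' = homogenise d N Q C"
  have degs: "degrees_in {2} Q" "degrees_in {3} C" by (auto simp: Q_def C_def degrees_in_def)
  have below: "vars_below N Q" "vars_below N C" using L(1) by (auto simp: Q_def C_def vars_below_def)
  have pert: "pert L x i = pert Q x i + pert C x i" for x i
    using L(2) unfolding Q_def C_def by (induction L) auto
  have dpert: "dpert L x h i = dpert Q x h i + dpert C x h i" for x h i
    using L(2) unfolding Q_def C_def by (induction L) auto
  have L'_below: "vars_below (Suc (2 * N)) L'"
    using below unfolding L'_def homogenise_def vars_below_def by (auto 0 3)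
  have "degrees_in {d} L'"
    using degs d unfolding L'_def homogenise_def degrees_in_def by auto
  moreover have "nonsingular L'"
    unfolding nonsingular_def
  proof (intro allI impI)
    fix x h i
    assume "\<forall>i. h i + dpert L' x h i = 0"
    then have zero: "h i + dpert L' x h i = 0" for i by blast
    \<comment> \<open>The coordinate t is unperturbed, so no kernel vector has a component in that
      direction.\<close>
    have out: "k \<noteq> 2 * N" if "(c, vs, k) \<in> set L'" for c vs k
      using that below unfolding L'_def homogenise_def vars_below_def by auto
    have "dpert L' x h (2 * N) = 0"
      using out by (intro dpert_no_output) auto
    then have ht: "h (2 * N) = 0" using zero[of "2 * N"] by simp
    let ?t = "x (2 * N)"
    let ?r = "?t ^ (d - 2)"
    have y: "h (N + i) = - (?t ^ (d - 3) * dpert C x h i)" if "i < N" for i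
      using zero[of "N + i"] dpert_homogenise[of h N d Q C x "N + i", OF ht] that
        dpert_outside[OF below(1), of "N + i"] unfolding L'_def by (simp add: eq_neg_iff_add_eq_0)
    have pow: "?t ^ (d - 1) * ?t ^ (d - 3) = ?r ^ 2"
    proof -
      have "(d - 1) + (d - 3) = (d - 2) * 2" using d by simp
      then show ?thesis by (simp only: power_add[symmetric] power_mult[symmetric])
    qed
    have low: "h i = 0" if "i < N" for i
    proof (rule nonsingularD[OF L(3,1) _ that])
      fix i assume i: "i < N"
      have "h i + (?r * dpert Q x h i - ?t ^ (d - 1) * h (N + i)) = 0"
        using zero[of i] dpert_homogenise[of h N d Q C x i, OF ht] i unfolding L'_def by simp
      then have "h i + (?r * dpert Q x h i + ?r ^ 2 * dpert C x h i) = 0"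
        unfolding y[OF i] pow[symmetric] by (simp add: algebra_simps)
      then show "h i + dpert L (\<lambda>i. ?r * x i) h i = 0"
        by (simp add: dpert dpert_scale[OF degs(1)] dpert_scale[OF degs(2)])
    qed
    have "dpert C x h j = 0" for j
      using dpert_cong[OF below(2), of x x h "\<lambda>_. 0" j] low
      unfolding dpert_def by (simp add: dmon_zero_direction case_prod_unfold cong: if_cong)
    then have "h (N + i) = 0" if "i < N" for i using y[OF that] by simp
    then have mid: "h i = 0" if "N \<le> i" "i < 2 * N" for i
      using that by (metis add.commute le_add_diff_inverse less_diff_conv2 mult_2)
    have "h i = 0" if "2 * N < i"
      using zero[of i] dpert_outside[OF L'_below, of i x h] that by simp
    then show "h i = 0" using low mid ht by (cases i "2 * N" rule: linorder_cases; cases "i < N") auto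
  qed
  ultimately have inv: "poly_invertible L'" by (intro base[OF L'_below])
  have pm: "pert_map L' w i = w i + pert Q w i - w (N + i)" if "i < N" "w (2 * N) = 1" for w i
    using that by (simp add: pert_map_def L'_def pert_homogenise)
  have pm': "pert_map L' w (N + i) = w (N + i) + pert C w i" if "i < N" "w (2 * N) = 1" for w i
    using that pert_outside[OF below(1), of "N + i"] by (simp add: pert_map_def L'_def pert_homogenise)
  have pm'': "pert_map L' w i = w i" if "2 * N \<le> i" for w i
    using that pert_outside[OF below(1), of i] pert_outside[OF below(2), of "i - N"]
    by (simp add: pert_map_def L'_def pert_homogenise)
  show ?thesis
  proof (rule poly_invertible_stabilise[OF inv L(1)])
    let ?\<theta> = "\<lambda>x i. if i < N then x i else if i < 2 * N then - pert C x (i - N) else if i = 2 * N then 1 else x i"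
    let ?\<iota> = "\<lambda>u i. if i < N then u i else if i < 2 * N then 0 else if i = 2 * N then 1 else u i"
    show "poly_expr (\<lambda>u. ?\<iota> u i)" for i by (intro poly_expr_if poly_expr.intros)
    show "?\<theta> x i = x i" if "i < N" for x i using that by simp
    show "pert_map L' (?\<theta> x) = ?\<iota> (pert_map L x)" for x
    proof
      fix i
      have Q: "pert Q (?\<theta> x) i = pert Q x i" for i by (rule pert_cong[OF below(1)]) simp
      have C: "pert C (?\<theta> x) i = pert C x i" for i by (rule pert_cong[OF below(2)]) simp
      consider "i < N" | "N \<le> i" "i < 2 * N" | "2 * N \<le> i" by linarith
      then show "pert_map L' (?\<theta> x) i = ?\<iota> (pert_map L x) i"
      proof cases
        case 1
        then show ?thesis using pm[OF 1, of "?\<theta> x"] Q by (simp add: pert_map_def pert)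
      next
        case 2
        then obtain j where j: "i = N + j" "j < N" by (metis add_less_cancel_left le_Suc_ex mult_2)
        show ?thesis using pm'[OF j(2), of "?\<theta> x"] C j by simp
      next
        case 3
        then show ?thesis using pm''[OF 3, of "?\<theta> x"] pert_outside[OF L(1), of i] by (simp add: pert_map_def)
      qed
    qed
    fix w u i assume w: "pert_map L' w = ?\<iota> u" and i: "i < N"
    have t: "w (2 * N) = 1" using fun_cong[OF w, of "2 * N"] pm''[of "2 * N" w] by simp
    have "w (N + i) + pert C w i = 0" using fun_cong[OF w, of "N + i"] pm'[of i w, OF i t] i by simp
    moreover have "w i + pert Q w i - w (N + i) = u i" using fun_cong[OF w, of i] pm[of i w, OF i t] i by simp
    ultimately show "pert_map L w i = u i" by (simp add: pert_map_def pert algebra_simps eq_neg_iff_add_eq_0[symmetric])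
  qed
qed

section \<open>Nilpotent operators\<close>

text \<open>N + 1 vectors in dimension N are dependent. Gaussian elimination: a vector with nonzero
  last coordinate is the pivot clearing that coordinate from the others.\<close>

lemma nontrivial_relation:
  fixes a :: "nat \<Rightarrow> nat \<Rightarrow> complex"
  shows "\<exists>c. (\<exists>j\<le>N. c j \<noteq> 0) \<and> (\<forall>i<N. (\<Sum>j\<le>N. c j * a j i) = 0)"
proof (induction N arbitrary: a)
  case 0
  show ?case by (rule exI[of _ "\<lambda>_. 1"]) simp
next
  case (Suc N)
  show ?case
  proof (cases "\<exists>m\<le>Suc N. a m N \<noteq> 0")
    case False
    obtain c where c: "\<exists>j\<le>N. c j \<noteq> 0" "\<forall>i<N. (\<Sum>j\<le>N. c j * a j i) = 0"
      using Suc.IH by blast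
    have "(\<Sum>j\<le>Suc N. (if j \<le> N then c j else 0) * a j i) = 0" if "i < Suc N" for i
    proof (cases "i = N")
      case True
      then show ?thesis using False by (intro sum.neutral) auto
    next
      case ne: False
      then have "(\<Sum>j\<le>N. (if j \<le> N then c j else 0) * a j i) = (\<Sum>j\<le>N. c j * a j i)"
        by (intro sum.cong) auto
      then show ?thesis using c(2) that ne by simp
    qed
    then show ?thesis using c(1) by (intro exI[of _ "\<lambda>j. if j \<le> N then c j else 0"]) auto
  next
    case True
    then obtain m where m: "m \<le> Suc N" "a m N \<noteq> 0" by blast
    \<comment> \<open>Moves the pivot to the last index, so that the others are indexed by
      \<open>{..N}\<close>.\<close>
    define \<tau> where "\<tau> = Transposition.transpose m (Suc N)"
    have \<tau>: "\<tau> permutes {..Suc N}" unfolding \<tau>_def using m(1) by (intro permutes_swap_id) auto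
    define b where "b j = a (\<tau> j)" for j
    let ?\<beta> = "b (Suc N)"
    have \<beta>: "?\<beta> N \<noteq> 0" using m(2) by (simp add: b_def \<tau>_def)
    obtain c where c: "\<exists>j\<le>N. c j \<noteq> 0" "\<forall>i<N. (\<Sum>j\<le>N. c j * (b j i - b j N / ?\<beta> N * ?\<beta> i)) = 0"
      using Suc.IH[of "\<lambda>j i. b j i - b j N / ?\<beta> N * ?\<beta> i"] by blast
    \<comment> \<open>The coefficient of the pivot is the one that cancels coordinate
      \<open>N\<close>.\<close>
    define e where "e j = (if j \<le> N then c j else - (\<Sum>j\<le>N. c j * b j N) / ?\<beta> N)" for j
    have sum_e: "(\<Sum>j\<le>Suc N. e j * b j i) = (\<Sum>j\<le>N. c j * b j i) - (\<Sum>j\<le>N. c j * b j N) / ?\<beta> N * ?\<beta> i" for i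
    proof -
      have "(\<Sum>j\<le>N. e j * b j i) = (\<Sum>j\<le>N. c j * b j i)" by (intro sum.cong) (auto simp: e_def)
      then show ?thesis by (simp add: e_def)
    qed
    have "(\<Sum>j\<le>Suc N. e j * b j i) = 0" if "i < Suc N" for i
    proof (cases "i = N")
      case True
      then show ?thesis unfolding sum_e using \<beta> by simp
    next
      case False
      then have "(\<Sum>j\<le>N. c j * (b j i - b j N / ?\<beta> N * ?\<beta> i)) = 0" using c(2) that by simp
      then show ?thesis unfolding sum_e
        by (simp add: right_diff_distrib sum_subtractf sum_distrib_right sum_divide_distrib mult.assoc)
    qed
    moreover have "(\<Sum>j\<le>Suc N. e j * b j i) = (\<Sum>j\<le>Suc N. e (\<tau> j) * a j i)" for i
      using sum.permute[OF \<tau>, of "\<lambda>j. e (\<tau> j) * a j i"] by (simp add: o_def b_def \<tau>_def)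
    moreover have "\<exists>j\<le>Suc N. e (\<tau> j) \<noteq> 0"
    proof -
      obtain j where j: "j \<le> N" "c j \<noteq> 0" using c(1) by blast
      have "\<tau> (\<tau> j) = j" by (simp add: \<tau>_def)
      moreover have "\<tau> j \<le> Suc N" using permutes_in_image[OF \<tau>, of j] j(1) by simp
      ultimately show ?thesis using j by (intro exI[of _ "\<tau> j"]) (simp add: e_def)
    qed
    ultimately show ?thesis by (intro exI[of _ "\<lambda>j. e (\<tau> j)"]) simp
  qed
qed

text \<open>Injectivity of 1 - s A for every s excludes each nonzero eigenvalue 1/s.\<close>

locale eigenvalue_free =
  fixes A :: "(nat \<Rightarrow> complex) \<Rightarrow> nat \<Rightarrow> complex"
  assumes lin: "A (\<lambda>i. u i + s * v i) = (\<lambda>i. A u i + s * A v i)"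
    and inj: "(\<And>i. h i = s * A h i) \<Longrightarrow> h = (\<lambda>_. 0)"
begin

lemma zero: "A (\<lambda>_. 0) = (\<lambda>_. 0)"
proof -
  have "A (\<lambda>i. 0 + (- 1) * 0) = (\<lambda>i. A (\<lambda>_. 0) i + (- 1) * A (\<lambda>_. 0) i)"
    using lin[of "\<lambda>_. 0" "- 1" "\<lambda>_. 0"] .
  then show ?thesis by simp
qed

lemma funpow_zero: "(A ^^ n) (\<lambda>_. 0) = (\<lambda>_. 0)"
  by (induction n) (simp_all add: zero)

lemma funpow_lin: "(A ^^ n) (\<lambda>i. u i + s * v i) = (\<lambda>i. (A ^^ n) u i + s * (A ^^ n) v i)"
  by (induction n) (simp_all add: lin)

text \<open>If p(A) w = 0 and p = (X - l) q, then q annihilates A w - l w, whose n-th iterate is 0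
  by induction. So the n-th iterate of \<open>w\<close> satisfies the eigenvector equation for l:
  either l = 0 or it vanishes, and one more application of \<open>A\<close> gives 0 in both
  cases.\<close>

lemma funpow_annihilated:
  assumes "p \<noteq> 0" "\<And>i. (\<Sum>j\<le>degree p. coeff p j * (A ^^ j) w i) = 0"
  shows "(A ^^ degree p) w = (\<lambda>_. 0)"
  using assms
proof (induction "degree p" arbitrary: p w)
  case 0
  then have "coeff p 0 \<noteq> 0" by (metis leading_coeff_0_iff)
  then show ?case using 0 by (simp add: fun_eq_iff)
next
  case (Suc n)
  obtain l where "poly p l = 0" using alg_closed_imp_poly_has_root[of p] Suc.hyps(2) by auto
  then obtain q where q: "p = [:- l, 1:] * q" unfolding poly_eq_0_iff_dvd by (elim dvdE)
  have "q \<noteq> 0" using Suc.prems(1) q by auto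
  then have deg: "degree q = n"
    using Suc.hyps(2) degree_mult_eq[of "[:- l, 1:]" q] unfolding q by simp
  let ?w = "\<lambda>i. A w i + (- l) * w i"
  have "(\<Sum>j\<le>degree q. coeff q j * (A ^^ j) ?w i) = 0" for i
  proof -
    have top: "coeff q (Suc n) = 0" using deg by (simp add: coeff_eq_0)
    have "coeff p j = - l * coeff q j + coeff (pCons 0 q) j" for j by (simp add: q)
    then have "0 = (\<Sum>j\<le>Suc n. (- l * coeff q j + coeff (pCons 0 q) j) * (A ^^ j) w i)"
      using Suc.prems(2)[of i] Suc.hyps(2) by simp
    also have "\<dots> = (\<Sum>j\<le>Suc n. - l * coeff q j * (A ^^ j) w i) + (\<Sum>j\<le>Suc n. coeff (pCons 0 q) j * (A ^^ j) w i)"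
      by (simp only: distrib_right sum.distrib)
    also have "(\<Sum>j\<le>Suc n. - l * coeff q j * (A ^^ j) w i) = (\<Sum>j\<le>n. - l * coeff q j * (A ^^ j) w i)"
      by (simp add: top)
    also have "(\<Sum>j\<le>Suc n. coeff (pCons 0 q) j * (A ^^ j) w i) = (\<Sum>j\<le>n. coeff q j * (A ^^ j) (A w) i)"
      by (simp add: sum.atMost_Suc_shift funpow_swap1 del: sum.atMost_Suc)
    also have "(\<Sum>j\<le>n. - l * coeff q j * (A ^^ j) w i) + (\<Sum>j\<le>n. coeff q j * (A ^^ j) (A w) i)
        = (\<Sum>j\<le>n. coeff q j * (A ^^ j) ?w i)"
      unfolding funpow_lin sum.distrib[symmetric] by (intro sum.cong refl) (simp add: algebra_simps)
    finally show ?thesis using deg by simp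
  qed
  then have "(A ^^ n) ?w = (\<lambda>_. 0)" using Suc.hyps(1)[of q ?w] deg \<open>q \<noteq> 0\<close> by simp
  then have eig: "A ((A ^^ n) w) i = l * (A ^^ n) w i" for i
    unfolding funpow_lin by (simp add: fun_eq_iff funpow_swap1)
  have "A ((A ^^ n) w) = (\<lambda>_. 0)"
  proof (cases "l = 0")
    case True
    then show ?thesis using eig by (simp add: fun_eq_iff)
  next
    case False
    then have "(A ^^ n) w i = inverse l * A ((A ^^ n) w) i" for i using eig[of i] by simp
    then have "(A ^^ n) w = (\<lambda>_. 0)" by (rule inj)
    then show ?thesis using zero by simp
  qed
  then show ?case using Suc.hyps(2) by (metis comp_apply funpow.simps(2))
qed

text \<open>\<open>A h\<close> is supported below \<open>N\<close>, though \<open>h\<close> itself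
  may not be. So the N + 1 iterates starting from \<open>A h\<close> are dependent, the annihilating
  polynomial has degree at most \<open>N\<close>, and the first application accounts for
  \<open>Suc N\<close>.\<close>

lemma funpow_eq_zero:
  assumes supp: "\<And>h i. N \<le> i \<Longrightarrow> A h i = 0"
  shows "(A ^^ Suc N) h = (\<lambda>_. 0)"
proof -
  obtain c where c: "\<exists>j\<le>N. c j \<noteq> 0" "\<forall>i<N. (\<Sum>j\<le>N. c j * (A ^^ j) (A h) i) = 0"
    using nontrivial_relation[of N "\<lambda>j. (A ^^ j) (A h)"] by blast
  define p where "p = (\<Sum>j\<le>N. monom (c j) j)"
  have coeff: "coeff p j = (if j \<le> N then c j else 0)" for j
    by (simp add: p_def coeff_sum)
  have "p \<noteq> 0" using c(1) coeff by (metis coeff_0)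
  have deg: "degree p \<le> N" by (rule degree_le) (simp add: coeff)
  have "(\<Sum>j\<le>degree p. coeff p j * (A ^^ j) (A h) i) = 0" for i
  proof (cases "i < N")
    case True
    have "(\<Sum>j\<le>degree p. coeff p j * (A ^^ j) (A h) i) = (\<Sum>j\<le>N. coeff p j * (A ^^ j) (A h) i)"
      using deg by (intro sum.mono_neutral_left) (auto simp: coeff_eq_0)
    also have "\<dots> = (\<Sum>j\<le>N. c j * (A ^^ j) (A h) i)" by (intro sum.cong) (auto simp: coeff)
    finally show ?thesis using c(2) True by simp
  next
    case False
    then show ?thesis by (intro sum.neutral) (simp add: funpow_swap1[symmetric] supp)
  qed
  then have z: "(A ^^ degree p) (A h) = (\<lambda>_. 0)" by (rule funpow_annihilated[OF \<open>p \<noteq> 0\<close>])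
  have "(A ^^ Suc N) h = (A ^^ N) (A h)" by (simp add: funpow_swap1)
  also have "\<dots> = (A ^^ (N - degree p)) ((A ^^ degree p) (A h))"
    using deg by (metis comp_apply funpow_add le_add_diff_inverse2)
  finally show ?thesis unfolding z funpow_zero .
qed

end

section \<open>Polarised monomials\<close>

text \<open>The permanent of the matrix with entries \<open>(xs ! j) (vs ! l)\<close>: the complete
  polarisation of the monomial, without the factor 1 / n!.\<close>

definition polar :: "(nat \<Rightarrow> complex) list \<Rightarrow> nat list \<Rightarrow> complex" where
  "polar xs vs = (\<Sum>\<sigma> | \<sigma> permutes {..<length vs}. \<Prod>j<length vs. (xs ! j) (vs ! \<sigma> j))"

lemma prod_update_split:
  assumes "j < n" "length xs = n"
  shows "(\<Prod>l<n. (xs[j := a] ! l) (f l)) = a (f j) * (\<Prod>l\<in>{..<n} - {j}. (xs ! l) (f l))"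
proof -
  have "(\<Prod>l<n. (xs[j := a] ! l) (f l)) = (xs[j := a] ! j) (f j) * (\<Prod>l\<in>{..<n} - {j}. (xs[j := a] ! l) (f l))"
    using assms by (intro prod.remove) auto
  also have "(\<Prod>l\<in>{..<n} - {j}. (xs[j := a] ! l) (f l)) = (\<Prod>l\<in>{..<n} - {j}. (xs ! l) (f l))"
    by (intro prod.cong) auto
  finally show ?thesis using assms by simp
qed

lemma polar_lin:
  assumes "length xs = length vs" "j < length vs"
  shows "polar (xs[j := (\<lambda>i. a i + s * b i)]) vs = polar (xs[j := a]) vs + s * polar (xs[j := b]) vs"
  unfolding polar_def prod_update_split[OF assms(2,1)] sum_distrib_left sum.distrib[symmetric]
  by (intro sum.cong refl) (simp add: algebra_simps)

lemma polar_permute: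
  assumes "length xs = length vs" "mset xs = mset ys"
  shows "polar xs vs = polar ys vs"
proof -
  let ?n = "length vs"
  obtain \<tau> where \<tau>: "\<tau> permutes {..<?n}" "permute_list \<tau> ys = xs"
    using mset_eq_permutation[OF assms(2)] mset_eq_length[OF assms(2)] assms(1) by metis
  have len: "length ys = ?n" using mset_eq_length[OF assms(2)] assms(1) by simp
  have "polar xs vs = (\<Sum>\<sigma> | \<sigma> permutes {..<?n}. \<Prod>j<?n. (ys ! \<tau> j) (vs ! (\<sigma> \<circ> \<tau>) j))"
    unfolding polar_def sum_permutations_compose_right[OF \<tau>(1), of "\<lambda>\<sigma>. \<Prod>j<?n. (xs ! j) (vs ! \<sigma> j)"]
    using \<tau> len by (intro sum.cong prod.cong refl) (auto simp: permute_list_nth)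
  also have "\<dots> = polar ys vs"
    unfolding polar_def
  proof (rule sum.cong[OF refl])
    fix \<sigma>
    show "(\<Prod>j<?n. (ys ! \<tau> j) (vs ! (\<sigma> \<circ> \<tau>) j)) = (\<Prod>j<?n. (ys ! j) (vs ! \<sigma> j))"
      using prod.permute[OF \<tau>(1), of "\<lambda>j. (ys ! j) (vs ! \<sigma> j)"] by (simp add: o_def)
  qed
  finally show ?thesis .
qed

lemma mon_eq_prod: "mon x vs = (\<Prod>j<length vs. x (vs ! j))"
  by (induction vs) (simp_all add: prod.lessThan_Suc_shift del: prod.lessThan_Suc)

lemma polar_diagonal: "polar (replicate (length vs) x) vs = fact (length vs) * mon x vs"
proof -
  let ?n = "length vs"
  have "(\<Prod>j<?n. (replicate ?n x ! j) (vs ! \<sigma> j)) = mon x vs" if "\<sigma> permutes {..<?n}" for \<sigma>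
    using prod.permute[OF that, of "\<lambda>j. x (vs ! j)"] by (simp add: mon_eq_prod o_def)
  then show ?thesis by (simp add: polar_def card_permutations)
qed

lemma dmon_eq_sum: "dmon x h vs = (\<Sum>i<length vs. h (vs ! i) * (\<Prod>j\<in>{..<length vs} - {i}. x (vs ! j)))"
proof (induction vs)
  case (Cons v vs)
  let ?n = "length vs"
  have 0: "{..<Suc ?n} - {0} = Suc ` {..<?n}" by (auto simp: lessThan_Suc_eq_insert_0)
  have S: "{..<Suc ?n} - {Suc i} = insert 0 (Suc ` ({..<?n} - {i}))" for i
    by (auto simp: lessThan_Suc_eq_insert_0)
  have "(\<Prod>j\<in>{..<Suc ?n} - {0}. x ((v # vs) ! j)) = mon x vs"
    unfolding 0 by (subst prod.reindex) (auto simp: mon_eq_prod)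
  moreover have "(\<Prod>j\<in>{..<Suc ?n} - {Suc i}. x ((v # vs) ! j)) = x v * (\<Prod>j\<in>{..<?n} - {i}. x (vs ! j))" for i
    unfolding S by (subst prod.insert) (auto simp: prod.reindex)
  ultimately show ?case
    by (simp add: Cons sum.lessThan_Suc_shift sum_distrib_left algebra_simps del: sum.lessThan_Suc)
qed simp

text \<open>By symmetry \<open>h\<close> may stand in any of the n slots, so n times the value is
  the sum over all slots; for each permutation that sum is the Leibniz rule.\<close>

lemma polar_derivative:
  assumes "vs \<noteq> []"
  shows "of_nat (length vs) * polar (h # replicate (length vs - 1) x) vs = fact (length vs) * dmon x h vs"
proof -
  let ?n = "length vs"
  have n: "0 < ?n" using assms by simp
  have "polar ((replicate ?n x)[i := h]) vs = polar (h # replicate (?n - 1) x) vs" if "i < ?n" for i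
  proof (rule polar_permute)
    have "mset ((replicate ?n x)[i := h]) = add_mset h (replicate_mset ?n x - {#x#})"
      using that by (simp add: mset_update)
    also have "replicate_mset ?n x = add_mset x (replicate_mset (?n - 1) x)"
      using n by (metis Suc_diff_1 replicate_mset_Suc)
    finally show "mset ((replicate ?n x)[i := h]) = mset (h # replicate (?n - 1) x)" by simp
  qed simp
  then have "of_nat ?n * polar (h # replicate (?n - 1) x) vs = (\<Sum>i<?n. polar ((replicate ?n x)[i := h]) vs)"
    by simp
  also have "\<dots> = (\<Sum>i<?n. \<Sum>\<sigma> | \<sigma> permutes {..<?n}. h (vs ! \<sigma> i) * (\<Prod>j\<in>{..<?n} - {i}. x (vs ! \<sigma> j)))"
    unfolding polar_def
  proof (intro sum.cong refl)
    fix i \<sigma> assume i: "i \<in> {..<?n}"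
    have "(\<Prod>l\<in>{..<?n} - {i}. (replicate ?n x ! l) (vs ! \<sigma> l)) = (\<Prod>j\<in>{..<?n} - {i}. x (vs ! \<sigma> j))"
      by (intro prod.cong) auto
    then show "(\<Prod>j<?n. ((replicate ?n x)[i := h] ! j) (vs ! \<sigma> j))
        = h (vs ! \<sigma> i) * (\<Prod>j\<in>{..<?n} - {i}. x (vs ! \<sigma> j))"
      using prod_update_split[of i ?n "replicate ?n x" h "\<lambda>l. vs ! \<sigma> l"] i by simp
  qed
  also have "\<dots> = (\<Sum>\<sigma> | \<sigma> permutes {..<?n}. \<Sum>i<?n. h (vs ! \<sigma> i) * (\<Prod>j\<in>{..<?n} - {i}. x (vs ! \<sigma> j)))"
    by (rule sum.swap)
  also have "\<dots> = (\<Sum>\<sigma> | \<sigma> permutes {..<?n}. dmon x h vs)"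
  proof (intro sum.cong refl)
    fix \<sigma> assume "\<sigma> \<in> {\<sigma>. \<sigma> permutes {..<?n}}"
    then have \<sigma>: "\<sigma> permutes {..<?n}" by simp
    have img: "\<sigma> ` ({..<?n} - {i}) = {..<?n} - {\<sigma> i}" if "i < ?n" for i
      using image_set_diff[OF permutes_inj[OF \<sigma>], of "{..<?n}" "{i}"] permutes_image[OF \<sigma>] by simp
    have "(\<Prod>j\<in>{..<?n} - {i}. x (vs ! \<sigma> j)) = (\<Prod>j\<in>{..<?n} - {\<sigma> i}. x (vs ! j))" if "i < ?n" for i
      unfolding img[OF that, symmetric]
      by (subst prod.reindex) (auto intro: inj_on_subset[OF permutes_inj[OF \<sigma>]])
    then have "(\<Sum>i<?n. h (vs ! \<sigma> i) * (\<Prod>j\<in>{..<?n} - {i}. x (vs ! \<sigma> j)))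
        = (\<Sum>i<?n. h (vs ! \<sigma> i) * (\<Prod>j\<in>{..<?n} - {\<sigma> i}. x (vs ! j)))"
      by (intro sum.cong refl) simp
    also have "\<dots> = dmon x h vs"
      using sum.permute[OF \<sigma>, of "\<lambda>i. h (vs ! i) * (\<Prod>j\<in>{..<?n} - {i}. x (vs ! j))"]
      by (simp add: dmon_eq_sum o_def)
    finally show "(\<Sum>i<?n. h (vs ! \<sigma> i) * (\<Prod>j\<in>{..<?n} - {i}. x (vs ! \<sigma> j))) = dmon x h vs" .
  qed
  finally show ?thesis by (simp add: card_permutations)
qed

lemma poly_expr_polar:
  assumes "\<And>t v. t \<in> set ts \<Longrightarrow> poly_expr (\<lambda>y. F y t v)" "length ts = length vs"
  shows "poly_expr (\<lambda>y. polar (map (F y) ts) vs)"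
proof -
  have "poly_expr (\<lambda>y. \<Sum>\<sigma> | \<sigma> permutes {..<length vs}. \<Prod>j<length vs. F y (ts ! j) (vs ! \<sigma> j))"
    using assms by (intro poly_expr_sum poly_expr_prod) auto
  moreover have "polar (map (F y) ts) vs
      = (\<Sum>\<sigma> | \<sigma> permutes {..<length vs}. \<Prod>j<length vs. F y (ts ! j) (vs ! \<sigma> j))" for y
    unfolding polar_def using assms(2) by (intro sum.cong prod.cong refl) auto
  ultimately show ?thesis by simp
qed

section \<open>Homogeneous perturbations\<close>

lemma sum_fun_apply: "(\<Sum>a\<in>A. f a) x = (\<Sum>a\<in>A. f a x)"
  by (induction A rule: infinite_finite_induct) simp_all

section \<open>Behaviour near the origin\<close>

lemma poly_eq_zero_near_0:
  fixes p :: "complex poly"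
  assumes "eventually (\<lambda>s. poly p s = 0) (nhds 0)"
  shows "p = 0"
proof (rule ccontr)
  assume "p \<noteq> 0"
  then have fin: "finite {s. poly p s = 0}" by (rule poly_roots_finite)
  obtain e where e: "e > 0" "\<forall>s. dist s 0 < e \<longrightarrow> poly p s = 0"
    using assms unfolding eventually_nhds_metric by blast
  have "ball 0 e \<subseteq> {s. poly p s = 0}" using e(2) by (auto simp: dist_commute)
  then have "finite (ball (0::complex) e)" using fin finite_subset by blast
  then show False using uncountable_ball[OF e(1), of "0::complex"] by (simp add: countable_finite)
qed

lemma norm_mon_le:
  fixes \<epsilon> :: real
  assumes "\<And>v. v \<in> set vs \<Longrightarrow> cmod (x v) \<le> \<epsilon>" "0 \<le> \<epsilon>" "\<epsilon> \<le> 1"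
  shows "cmod (mon x vs) \<le> 1" and "vs \<noteq> [] \<Longrightarrow> cmod (mon x vs) \<le> \<epsilon>"
proof -
  have le1: "cmod (mon x vs) \<le> 1" if "\<And>v. v \<in> set vs \<Longrightarrow> cmod (x v) \<le> \<epsilon>" for vs
    using that
  proof (induction vs)
    case (Cons v vs)
    then have "cmod (x v) * cmod (mon x vs) \<le> 1 * 1"
      using assms(2,3) by (intro mult_mono) (auto intro: order_trans)
    then show ?case by (simp add: norm_mult)
  qed simp
  show "cmod (mon x vs) \<le> 1" using le1 assms(1) .
  assume "vs \<noteq> []"
  then obtain v us where vs: "vs = v # us" by (cases vs) auto
  have "cmod (x v) * cmod (mon x us) \<le> \<epsilon> * 1"
    using assms le1[of us] by (intro mult_mono) (auto simp: vs)
  then show "cmod (mon x vs) \<le> \<epsilon>" by (simp add: vs norm_mult)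
qed

text \<open>Telescoping over the letters replaces one factor by a difference of size
  \<open>\<delta>\<close>; degree at least 2 leaves another factor, of size at most
  \<open>\<epsilon>\<close>.\<close>

lemma norm_mon_diff_le:
  fixes \<epsilon> \<delta> :: real
  assumes "\<And>v. v \<in> set vs \<Longrightarrow> cmod (a v) \<le> \<epsilon>" "\<And>v. v \<in> set vs \<Longrightarrow> cmod (b v) \<le> \<epsilon>"
    "\<And>v. v \<in> set vs \<Longrightarrow> cmod (a v - b v) \<le> \<delta>" "0 \<le> \<epsilon>" "\<epsilon> \<le> 1" "0 \<le> \<delta>" "2 \<le> length vs"
  shows "cmod (mon a vs - mon b vs) \<le> length vs * (\<epsilon> * \<delta>)"
proof -
  have id: "mon a (v # vs) - mon b (v # vs) = (a v - b v) * mon a vs + b v * (mon a vs - mon b vs)" for v vs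
    by (simp add: algebra_simps)
  have weak: "cmod (mon a vs - mon b vs) \<le> length vs * \<delta>"
    if "\<And>v. v \<in> set vs \<Longrightarrow> cmod (a v) \<le> \<epsilon> \<and> cmod (b v) \<le> \<epsilon> \<and> cmod (a v - b v) \<le> \<delta>" for vs
    using that
  proof (induction vs)
    case (Cons v vs)
    have "cmod ((a v - b v) * mon a vs) \<le> \<delta> * 1"
      unfolding norm_mult using Cons.prems norm_mon_le(1)[of vs a \<epsilon>] assms(4-6) by (intro mult_mono) auto
    moreover have "cmod (b v * (mon a vs - mon b vs)) \<le> 1 * (length vs * \<delta>)"
      unfolding norm_mult using Cons assms(4-6) by (intro mult_mono) (auto intro: order_trans)
    ultimately show ?case unfolding id
      by (intro order_trans[OF norm_triangle_ineq]) (simp add: algebra_simps)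
  qed simp
  obtain v us where vs: "vs = v # us" and us: "us \<noteq> []" using assms(7) by (cases vs) force+
  have "cmod ((a v - b v) * mon a us) \<le> \<delta> * \<epsilon>"
    unfolding norm_mult using norm_mon_le(2)[of us a \<epsilon>] us assms by (intro mult_mono) (auto simp: vs)
  moreover have "cmod (b v * (mon a us - mon b us)) \<le> \<epsilon> * (length us * \<delta>)"
    unfolding norm_mult using weak[of us] assms by (intro mult_mono) (auto simp: vs)
  ultimately show ?thesis unfolding vs id
    by (intro order_trans[OF norm_triangle_ineq]) (simp add: algebra_simps)
qed

lemma pert_lipschitz:
  assumes "vars_below N L" "degrees_in {2..} L"
  shows "\<exists>C\<ge>0. \<forall>a b \<epsilon> \<delta> i. 0 \<le> \<epsilon> \<longrightarrow> \<epsilon> \<le> 1 \<longrightarrow> 0 \<le> \<delta> \<longrightarrow>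
     (\<forall>v<N. cmod (a v) \<le> \<epsilon> \<and> cmod (b v) \<le> \<epsilon> \<and> cmod (a v - b v) \<le> \<delta>) \<longrightarrow>
     cmod (pert L a i - pert L b i) \<le> C * (\<epsilon> * \<delta>)"
  using assms
proof (induction L)
  case Nil
  show ?case by (rule exI[of _ 0]) simp
next
  case (Cons t L)
  obtain c vs k where t: "t = (c, vs, k)" by (cases t)
  obtain C where C: "C \<ge> 0" "\<And>a b \<epsilon> \<delta> i. 0 \<le> \<epsilon> \<Longrightarrow> \<epsilon> \<le> 1 \<Longrightarrow> 0 \<le> \<delta> \<Longrightarrow>
     (\<forall>v<N. cmod (a v) \<le> \<epsilon> \<and> cmod (b v) \<le> \<epsilon> \<and> cmod (a v - b v) \<le> \<delta>) \<Longrightarrow>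
     cmod (pert L a i - pert L b i) \<le> C * (\<epsilon> * \<delta>)"
    using Cons t by auto
  have vs: "set vs \<subseteq> {..<N}" "2 \<le> length vs" using Cons.prems t by auto
  show ?case
  proof (intro exI[of _ "cmod c * length vs + C"] conjI allI impI)
    show "0 \<le> cmod c * length vs + C" using C(1) by simp
    fix a b :: "nat \<Rightarrow> complex" and \<epsilon> \<delta> :: real and i
    assume *: "0 \<le> \<epsilon>" "\<epsilon> \<le> 1" "0 \<le> \<delta>" "\<forall>v<N. cmod (a v) \<le> \<epsilon> \<and> cmod (b v) \<le> \<epsilon> \<and> cmod (a v - b v) \<le> \<delta>"
    have "cmod (mon a vs - mon b vs) \<le> length vs * (\<epsilon> * \<delta>)"
      using * vs by (intro norm_mon_diff_le) auto
    then have "cmod (c * (mon a vs - mon b vs)) \<le> cmod c * (length vs * (\<epsilon> * \<delta>))"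
      unfolding norm_mult by (rule mult_left_mono) simp
    moreover have "0 \<le> cmod c * (length vs * (\<epsilon> * \<delta>))" using * by simp
    ultimately have head: "cmod ((if k = i then c * mon a vs else 0) - (if k = i then c * mon b vs else 0))
        \<le> cmod c * (length vs * (\<epsilon> * \<delta>))"
      by (simp add: right_diff_distrib)
    have "cmod (pert (t # L) a i - pert (t # L) b i)
        \<le> cmod ((if k = i then c * mon a vs else 0) - (if k = i then c * mon b vs else 0))
          + cmod (pert L a i - pert L b i)"
      unfolding t pert_simps by (rule norm_diff_triangle_ineq)
    then show "cmod (pert (t # L) a i - pert (t # L) b i) \<le> (cmod c * length vs + C) * (\<epsilon> * \<delta>)"
      using head C(2)[OF *, of i] by (simp add: algebra_simps)
  qed
qed

text \<open>On a small ball the perturbation is a strict contraction for the sum of coordinate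
  distances, so points with equal images have distance 0.\<close>

lemma pert_map_locally_injective:
  assumes "vars_below N L" "degrees_in {2..} L"
  shows "\<exists>\<epsilon>>0. \<forall>a b. pert_map L a = pert_map L b \<longrightarrow>
     (\<forall>v<N. cmod (a v) \<le> \<epsilon> \<and> cmod (b v) \<le> \<epsilon>) \<longrightarrow> (\<forall>v<N. a v = b v)"
proof -
  obtain C where C: "C \<ge> 0" "\<And>a b \<epsilon> \<delta> i. 0 \<le> \<epsilon> \<Longrightarrow> \<epsilon> \<le> 1 \<Longrightarrow> 0 \<le> \<delta> \<Longrightarrow>
     (\<forall>v<N. cmod (a v) \<le> \<epsilon> \<and> cmod (b v) \<le> \<epsilon> \<and> cmod (a v - b v) \<le> \<delta>) \<Longrightarrow>
     cmod (pert L a i - pert L b i) \<le> C * (\<epsilon> * \<delta>)"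
    using pert_lipschitz[OF assms] by blast
  \<comment> \<open>Chosen so that the contraction factor \<open>N * C * \<epsilon>\<close> is below
    1, also when \<open>C\<close> is 0.\<close>
  define \<epsilon> where "\<epsilon> = 1 / (1 + N * C)"
  have \<epsilon>: "0 < \<epsilon>" "\<epsilon> \<le> 1" "N * C * \<epsilon> < 1"
    using C(1) by (auto simp: \<epsilon>_def field_simps add_pos_nonneg)
  show ?thesis
  proof (intro exI[of _ \<epsilon>] conjI allI impI)
    fix a b v assume eq: "pert_map L a = pert_map L b" and small: "\<forall>v<N. cmod (a v) \<le> \<epsilon> \<and> cmod (b v) \<le> \<epsilon>"
      and v: "v < N"
    define \<delta> where "\<delta> = (\<Sum>v<N. cmod (a v - b v))"
    have \<delta>: "0 \<le> \<delta>" by (simp add: \<delta>_def sum_nonneg)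
    have le: "cmod (a v - b v) \<le> \<delta>" if "v < N" for v
      unfolding \<delta>_def using that by (intro member_le_sum) auto
    have "cmod (a v - b v) \<le> C * (\<epsilon> * \<delta>)" for v
    proof -
      have "a v - b v = pert L b v - pert L a v"
        using fun_cong[OF eq, of v] by (simp add: pert_map_def algebra_simps)
      then show ?thesis using C(2)[of \<epsilon> \<delta> a b v] \<epsilon> \<delta> small le by (simp add: norm_minus_commute)
    qed
    then have "\<delta> \<le> (\<Sum>v<N. C * (\<epsilon> * \<delta>))" unfolding \<delta>_def[of] by (intro sum_mono)
    then have "\<delta> \<le> (N * C * \<epsilon>) * \<delta>" by (simp add: algebra_simps)
    then have "\<delta> = 0" using \<epsilon>(3) \<delta> by (metis less_eq_real_def mult_le_cancel_right1 not_le)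
    then show "a v = b v" using le[OF v] by simp
  qed (use \<epsilon> in auto)
qed

text \<open>Along a line \<open>s \<mapsto> s x\<close> both \<open>s x\<close> and \<open>G (F (s x))\<close> are small preimages of the same point
  for small \<open>s\<close>, hence equal, and then equal for all \<open>s\<close> because they are polynomial in \<open>s\<close>.\<close>
lemma right_inverse_imp_left_inverse:
  assumes L: "vars_below N L" "degrees_in {2..} L"
    and G: "\<And>i. poly_expr (\<lambda>y. G y i)" "\<And>y. pert_map L (G y) = y" "G (\<lambda>_. 0) = (\<lambda>_. 0)"
  shows "G (pert_map L x) = x"
proof -
  let ?e = "\<lambda>s. G (pert_map L (\<lambda>i. s * x i))"
  have "\<exists>q. \<forall>s. ?e s i = poly q s" for i
  proof (rule poly_expr_univariate[of "\<lambda>z. G (pert_map L z) i" "\<lambda>s i. s * x i"])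
    have "poly_expr (\<lambda>z. pert_map L z j)" for j
      unfolding pert_map_def pert_def case_prod_unfold
      by (intro poly_expr.add poly_expr.var poly_expr_sum_list poly_expr_if poly_expr.mult poly_expr.const poly_expr_mon)
    then show "poly_expr (\<lambda>z. G (pert_map L z) i)" by (rule poly_expr_compose[OF G(1)])
    show "\<exists>q. \<forall>s. s * x i = poly q s" for i by (rule exI[of _ "[:0, x i:]"]) simp
  qed
  then obtain q where q: "\<And>i s. ?e s i = poly (q i) s" by metis
  obtain \<epsilon> where \<epsilon>: "\<epsilon> > 0" "\<And>a b v. pert_map L a = pert_map L b \<Longrightarrow>
      (\<forall>v<N. cmod (a v) \<le> \<epsilon> \<and> cmod (b v) \<le> \<epsilon>) \<Longrightarrow> v < N \<Longrightarrow> a v = b v"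
    using pert_map_locally_injective[OF L] by blast
  have "pert_map L (\<lambda>i. 0 * x i) = (\<lambda>_. 0)"
  proof
    fix i
    have "pert L (\<lambda>i. 0) i = 0" using L(2)
    proof (induction L)
      case (Cons t L)
      obtain c vs k where t: "t = (c, vs, k)" by (cases t)
      show ?case using Cons by (cases vs) (auto simp: t)
    qed simp
    then show "pert_map L (\<lambda>i. 0 * x i) i = 0" by (simp add: pert_map_def)
  qed
  then have e0: "poly (q i) 0 = 0" for i using q[of 0 i] G(3) by simp
  have ev: "eventually (\<lambda>s. cmod (poly p s) \<le> \<epsilon>) (nhds 0)" if "poly p 0 = 0" for p
  proof -
    have "((\<lambda>s. cmod (poly p s)) \<longlongrightarrow> cmod (poly p 0)) (nhds 0)"
      by (intro tendsto_intros isCont_tendsto_compose[OF poly_isCont] filterlim_ident)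
    then have "eventually (\<lambda>s. cmod (poly p s) < \<epsilon>) (nhds 0)"
      using \<epsilon>(1) that by (intro order_tendstoD) auto
    then show ?thesis by (rule eventually_mono) simp
  qed
  have "eventually (\<lambda>s. \<forall>v<N. cmod (poly (q v) s) \<le> \<epsilon> \<and> cmod (s * x v) \<le> \<epsilon>) (nhds 0)"
  proof -
    have "eventually (\<lambda>s. cmod (poly (q v) s) \<le> \<epsilon> \<and> cmod (s * x v) \<le> \<epsilon>) (nhds 0)" for v
      using eventually_conj[OF ev[OF e0[of v]] ev[of "[:0, x v:]"]] by (simp add: mult.commute)
    then have "eventually (\<lambda>s. \<forall>v\<in>{..<N}. cmod (poly (q v) s) \<le> \<epsilon> \<and> cmod (s * x v) \<le> \<epsilon>) (nhds 0)"
      by (intro eventually_ball_finite) auto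
    then show ?thesis by (rule eventually_mono) auto
  qed
  then have near: "eventually (\<lambda>s. \<forall>v<N. poly (q v) s = s * x v) (nhds 0)"
  proof (rule eventually_mono)
    fix s assume s: "\<forall>v<N. cmod (poly (q v) s) \<le> \<epsilon> \<and> cmod (s * x v) \<le> \<epsilon>"
    show "\<forall>v<N. poly (q v) s = s * x v"
    proof (intro allI impI)
      fix v assume v: "v < N"
      have "?e s v = s * x v"
        using \<epsilon>(2)[of "?e s" "\<lambda>i. s * x i" v] G(2) s v q by simp
      then show "poly (q v) s = s * x v" using q by simp
    qed
  qed
  show ?thesis
  proof
    fix i
    show "G (pert_map L x) i = x i"
    proof (cases "i < N")
      case True
      have "eventually (\<lambda>s. poly (q i - [:0, x i:]) s = 0) (nhds 0)"
        using near by (rule eventually_mono) (use True in simp)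
      then have "q i - [:0, x i:] = 0" by (rule poly_eq_zero_near_0)
      then have "q i = [:0, x i:]" by simp
      then show ?thesis using q[of 1 i] by simp
    next
      case False
      then show ?thesis
        using fun_cong[OF G(2)[of "pert_map L x"], of i] pert_outside[OF L(1), of i] by (simp add: pert_map_def)
    qed
  qed
qed

text \<open>The symmetric multilinear form whose diagonal is \<open>- pert L\<close>.\<close>
definition polar_form :: "nat \<Rightarrow> monomial_term list \<Rightarrow> (nat \<Rightarrow> complex) list \<Rightarrow> nat \<Rightarrow> complex" where
  "polar_form d L xs i = - (\<Sum>(c, vs, k)\<leftarrow>L. if k = i then c * polar xs vs else 0) / fact d"

lemma polar_form_simps:
  "polar_form d [] xs i = 0"
  "polar_form d ((c, vs, k) # L) xs i = (if k = i then - c / fact d * polar xs vs else 0) + polar_form d L xs i"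
  by (simp_all add: polar_form_def add_divide_distrib diff_divide_distrib)

lemma polar_form_lin:
  assumes "degrees_in {d} L" "length xs = d" "j < d"
  shows "polar_form d L (xs[j := (\<lambda>i. a i + s * b i)]) i
       = polar_form d L (xs[j := a]) i + s * polar_form d L (xs[j := b]) i"
  using assms
proof (induction L)
  case (Cons t L)
  obtain c vs k where t: "t = (c, vs, k)" by (cases t)
  show ?case using Cons polar_lin[of xs vs j a s b]
    by (simp add: t polar_form_simps field_simps)
qed (simp add: polar_form_simps)

lemma polar_form_permute:
  assumes "degrees_in {d} L" "length xs = d" "mset xs = mset ys"
  shows "polar_form d L xs i = polar_form d L ys i"
  using assms
proof (induction L)
  case (Cons t L)
  obtain c vs k where t: "t = (c, vs, k)" by (cases t)
  show ?case using Cons polar_permute[of xs vs ys] by (simp add: t polar_form_simps)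
qed (simp add: polar_form_simps)

lemma polar_form_diagonal:
  "degrees_in {d} L \<Longrightarrow> polar_form d L (replicate d x) i = - pert L x i"
proof (induction L)
  case (Cons t L)
  obtain c vs k where t: "t = (c, vs, k)" by (cases t)
  show ?case using Cons polar_diagonal[of vs x] by (simp add: t polar_form_simps)
qed (simp add: polar_form_simps)

lemma polar_form_derivative:
  assumes "degrees_in {d} L" "0 < d"
  shows "of_nat d * polar_form d L (h # replicate (d - 1) x) i = - dpert L x h i"
  using assms(1)
proof (induction L)
  case (Cons t L)
  obtain c vs k where t: "t = (c, vs, k)" by (cases t)
  have len: "length vs = d" using Cons.prems t by simp
  have "of_nat d * polar (h # replicate (d - 1) x) vs = fact d * dmon x h vs"
    using polar_derivative[of vs h x] assms(2) len by auto
  then have "of_nat d * (- c / fact d * polar (h # replicate (d - 1) x) vs) = - c * dmon x h vs"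
    by (simp add: field_simps)
  then show ?case using Cons by (simp add: t polar_form_simps distrib_left)
qed (simp add: polar_form_simps)

lemma polar_form_outside: "vars_below N L \<Longrightarrow> N \<le> i \<Longrightarrow> polar_form d L xs i = 0"
  by (induction L) (auto simp: polar_form_simps)

lemma poly_expr_polar_form:
  assumes "\<And>t v. t \<in> set ts \<Longrightarrow> poly_expr (\<lambda>y. F y t v)" "degrees_in {d} L" "length ts = d"
  shows "poly_expr (\<lambda>y. polar_form d L (map (F y) ts) i)"
  using assms(2)
proof (induction L)
  case (Cons t L)
  obtain c vs k where t: "t = (c, vs, k)" by (cases t)
  have "poly_expr (\<lambda>y. polar (map (F y) ts) vs)"
    using Cons.prems assms(1,3) by (intro poly_expr_polar) (auto simp: t)
  then have "poly_expr (\<lambda>y. (- c / fact d) * polar (map (F y) ts) vs)"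
    by (rule poly_expr.mult[OF poly_expr.const])
  then have "poly_expr (\<lambda>y. if k = i then (- c / fact d) * polar (map (F y) ts) vs else 0)"
    by (rule poly_expr_if) (rule poly_expr.const)
  from poly_expr.add[OF this Cons.IH] Cons.prems show ?case by (simp add: t polar_form_simps)
qed (simp add: polar_form_simps poly_expr.const)

text \<open>The point \<open>y\<close> at the leaves enters as the value on \<open>[]\<close>; for
  \<open>0 < d\<close> this does not collide with the \<open>d\<close>-fold operation.\<close>

definition node_value :: "nat \<Rightarrow> monomial_term list \<Rightarrow> (nat \<Rightarrow> complex) \<Rightarrow> (nat \<Rightarrow> complex) list \<Rightarrow> nat \<Rightarrow> complex" where
  "node_value d L y xs = (if xs = [] then y else polar_form d L xs)"

lemma symmetric_algebra_node_value:
  assumes "degrees_in {d} L" "0 < d"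
  shows "symmetric_algebra d (node_value d L y)"
proof
  show "0 < d" by fact
  fix xs ys :: "(nat \<Rightarrow> complex) list" and j a b
  assume len: "length xs = d"
  show "node_value d L y (xs[j := a + b]) = node_value d L y (xs[j := a]) + node_value d L y (xs[j := b])" if "j < d"
  proof
    fix i
    have "xs \<noteq> []" using len assms(2) by auto
    moreover have "a + b = (\<lambda>i. a i + 1 * b i)" by (simp add: fun_eq_iff)
    ultimately show "node_value d L y (xs[j := a + b]) i = (node_value d L y (xs[j := a]) + node_value d L y (xs[j := b])) i"
      using polar_form_lin[OF assms(1) len that, of a 1 b i] by (simp add: node_value_def)
  qed
  show "node_value d L y xs = node_value d L y ys" if "mset xs = mset ys"
    using polar_form_permute[OF assms(1) len that] that len assms(2) by (auto simp: node_value_def fun_eq_iff)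
qed

lemma poly_expr_tree_value:
  assumes "degrees_in {d} L" "0 < d" "is_catalan d T"
  shows "poly_expr (\<lambda>y. tree_value (node_value d L y) T i)"
  using assms(3)
proof (induction T arbitrary: i)
  case (Node ts)
  show ?case
  proof (cases "ts = []")
    case True
    then show ?thesis by (simp add: tree_value_Node node_value_def poly_expr.var)
  next
    case False
    then have len: "length ts = d" using Node.prems by (simp add: is_catalan_Node)
    have "poly_expr (\<lambda>y. polar_form d L (map (tree_value (node_value d L y)) ts) i)"
      using Node by (intro poly_expr_polar_form[OF _ assms(1) len]) (auto simp: is_catalan_Node)
    then show ?thesis using False unfolding tree_value_Node by (subst node_value_def) simp
  qed
qed

lemma homogeneous_poly_invertible:
  assumes d: "2 \<le> d"
    and chains: "\<And>p. 1 \<le> p \<Longrightarrow> \<exists>k0. \<forall>k\<ge>k0. \<exists>P. is_shuffle_family d p k P \<and> uniform_stationary d p k P"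
    and L: "vars_below N L" "degrees_in {d} L" "nonsingular L"
  shows "poly_invertible L"
proof -
  have d0: "0 < d" using d by simp
  let ?\<mu> = "node_value d L"
  have alg: "symmetric_algebra d (?\<mu> y)" for y by (rule symmetric_algebra_node_value[OF L(2) d0])
  define A where "A x h = polar_form d L (h # replicate (d - 1) x)" for x h
  have A: "symmetric_algebra.mult_op d (?\<mu> y) = A" for y
    by (simp add: fun_eq_iff symmetric_algebra.mult_op_def[OF alg] A_def node_value_def)
  have eig: "eigenvalue_free (A x)" for x
  proof
    show "A x (\<lambda>i. u i + s * v i) = (\<lambda>i. A x u i + s * A x v i)" for u s v
      using polar_form_lin[OF L(2), of "undefined # replicate (d - 1) x" 0 u s v] d0
      by (simp add: A_def fun_eq_iff)
    show "h = (\<lambda>_. 0)" if h: "\<And>i. h i = s * A x h i" for h s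
    proof -
      \<comment> \<open>The derivative is homogeneous of degree d - 1 in the base point and equals
        -d A(x); this r turns h - s A(x) h into h + \<open>dpert L\<close> at r x, applied to
        h.\<close>
      obtain r where r: "r ^ (d - 1) = s / of_nat d"
        using nth_root_exists[of "d - 1" "s / of_nat d"] d by auto
      have "h i + dpert L (\<lambda>i. r * x i) h i = 0" for i
      proof -
        have "dpert L (\<lambda>i. r * x i) h i = r ^ (d - 1) * dpert L x h i" by (rule dpert_scale[OF L(2)])
        also have "\<dots> = - (s * A x h i)"
        proof -
          have "dpert L x h i = - (of_nat d * A x h i)"
            using polar_form_derivative[OF L(2) d0, of h x i] by (simp add: A_def)
          then show ?thesis unfolding r using d0 by simp
        qed
        finally show ?thesis using h[of i] by simp
      qed
      then show ?thesis
        using L(3)[unfolded nonsingular_def, rule_format, of h "\<lambda>i. r * x i"] by (simp add: fun_eq_iff)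
    qed
  qed
  have nil: "(A x ^^ Suc N) h = 0" for x h
    using eigenvalue_free.funpow_eq_zero[OF eig, of N x h] polar_form_outside[OF L(1)]
    by (simp add: A_def[abs_def] zero_fun_def del: funpow.simps)
  obtain K where K: "\<And>k. K \<le> k \<Longrightarrow> \<exists>P. is_shuffle_family d (Suc N) k P \<and> uniform_stationary d (Suc N) k P"
    \<comment> \<open>\<open>Suc N\<close> is the nilpotency exponent common to all
      \<open>A x\<close>.\<close>
    using chains[of "Suc N"] by auto
  have vanish: "symmetric_algebra.tree_sum d (?\<mu> y) k = 0" if k: "K \<le> k" for y k
  proof
    fix i
    obtain P where P: "is_shuffle_family d (Suc N) k P" "uniform_stationary d (Suc N) k P" using K[OF k] by blast
    have "(\<Sum>T\<in>catalan_trees d k. tree_value (?\<mu> y) T i) = 0"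
      by (rule symmetric_algebra.sum_catalan_trees_zero[OF alg, where \<phi> = "\<lambda>v. v i", OF _ _ P])
        (simp_all only: A nil plus_fun_apply)
    then show "symmetric_algebra.tree_sum d (?\<mu> y) k i = 0 i"
      by (simp add: symmetric_algebra.tree_sum_def[OF alg] sum_fun_apply)
  qed
  define G where "G y = (\<Sum>k<K. symmetric_algebra.tree_sum d (?\<mu> y) k)" for y
  have fixed: "G y i = y i + polar_form d L (replicate d (G y)) i" for y i
    using fun_cong[OF symmetric_algebra.tree_sum_fixed_point[OF alg, of K y, OF vanish], of i] d0
    unfolding G_def[symmetric] by (simp add: node_value_def)
  have inv: "pert_map L (G y) = y" for y
  proof
    fix i
    show "pert_map L (G y) i = y i"
      using fixed[of y i] by (simp add: pert_map_def polar_form_diagonal[OF L(2)])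
  qed
  have G0: "G (\<lambda>_. 0) = (\<lambda>_. 0)"
  \<comment> \<open>For y = 0 the equation reads g = \<mu>(g, ..., g) = A(g) g, so g would be an
    eigenvector of A(g) for the eigenvalue 1 unless g = 0.\<close>
  proof (rule eigenvalue_free.inj[OF eig[of "G (\<lambda>_. 0)"], of _ 1])
    have "replicate d (G (\<lambda>_. 0)) = G (\<lambda>_. 0) # replicate (d - 1) (G (\<lambda>_. 0))" using d0 by (cases d) auto
    then show "G (\<lambda>_. 0) i = 1 * A (G (\<lambda>_. 0)) (G (\<lambda>_. 0)) i" for i
      using fixed[of "\<lambda>_. 0" i] by (simp add: A_def)
  qed
  have poly: "poly_expr (\<lambda>y. G y i)" for i
    unfolding G_def sum_fun_apply symmetric_algebra.tree_sum_def[OF alg]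
    by (intro poly_expr_sum poly_expr_tree_value[OF L(2) d0]) (simp add: catalan_trees_alt)
  have "degrees_in {2..} L" using L(2) d by (auto simp: degrees_in_def)
  then have "G (pert_map L x) = x" for x
    by (rule right_inverse_imp_left_inverse[OF L(1) _ poly inv G0])
  then show ?thesis unfolding poly_invertible_def using poly inv by blast
qed

section \<open>Polynomial functions on complex affine space\<close>

lemma poly_fun_const: "poly_fun (\<lambda>_ :: complex ^ 'n. c)"
  unfolding poly_fun_def by (intro exI[of _ "{\<lambda>_. 0}"] exI[of _ "\<lambda>_. c"]) simp

lemma poly_fun_var: "poly_fun (\<lambda>x :: complex ^ 'n. x $ i)"
proof -
  have "(\<Prod>j\<in>UNIV. (x $ j) ^ (if j = i then 1 else 0)) = x $ i" for x :: "complex ^ 'n"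
  proof -
    have "(\<Prod>j\<in>UNIV. (x $ j) ^ (if j = i then 1 else 0)) = (\<Prod>j\<in>UNIV. if j = i then x $ j else 1)"
      by (intro prod.cong) auto
    then show ?thesis by simp
  qed
  then show ?thesis unfolding poly_fun_def
    by (intro exI[of _ "{\<lambda>j. if j = i then 1 else 0}"] exI[of _ "\<lambda>_. 1"]) simp
qed

lemma poly_fun_add:
  fixes f g :: "complex ^ 'n \<Rightarrow> complex"
  assumes "poly_fun f" "poly_fun g"
  shows "poly_fun (\<lambda>x. f x + g x)"
proof -
  obtain S c where f: "finite S" "\<And>x. f x = (\<Sum>m\<in>S. c m * (\<Prod>i\<in>UNIV. (x $ i) ^ m i))"
    using assms(1) unfolding poly_fun_def by blast
  obtain S' c' where g: "finite S'" "\<And>x. g x = (\<Sum>m\<in>S'. c' m * (\<Prod>i\<in>UNIV. (x $ i) ^ m i))"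
    using assms(2) unfolding poly_fun_def by blast
  let ?c = "\<lambda>m. (if m \<in> S then c m else 0) + (if m \<in> S' then c' m else 0)"
  have "f x + g x = (\<Sum>m\<in>S \<union> S'. ?c m * (\<Prod>i\<in>UNIV. (x $ i) ^ m i))" for x
  proof -
    let ?X = "\<lambda>m. \<Prod>i\<in>UNIV. (x $ i) ^ m i"
    have "(\<Sum>m\<in>S. c m * ?X m) = (\<Sum>m\<in>S \<union> S'. (if m \<in> S then c m else 0) * ?X m)"
      using f(1) g(1) by (intro sum.mono_neutral_cong_left) auto
    moreover have "(\<Sum>m\<in>S'. c' m * ?X m) = (\<Sum>m\<in>S \<union> S'. (if m \<in> S' then c' m else 0) * ?X m)"
      using f(1) g(1) by (intro sum.mono_neutral_cong_left) auto
    ultimately show ?thesis by (simp only: f(2) g(2) distrib_right sum.distrib)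
  qed
  then show ?thesis unfolding poly_fun_def using f(1) g(1)
    by (intro exI[of _ "S \<union> S'"] exI[of _ ?c]) blast
qed

lemma poly_fun_mult:
  fixes f g :: "complex ^ 'n \<Rightarrow> complex"
  assumes "poly_fun f" "poly_fun g"
  shows "poly_fun (\<lambda>x. f x * g x)"
proof -
  obtain S c where f: "finite S" "\<And>x. f x = (\<Sum>m\<in>S. c m * (\<Prod>i\<in>UNIV. (x $ i) ^ m i))"
    using assms(1) unfolding poly_fun_def by blast
  obtain S' c' where g: "finite S'" "\<And>x. g x = (\<Sum>m\<in>S'. c' m * (\<Prod>i\<in>UNIV. (x $ i) ^ m i))"
    using assms(2) unfolding poly_fun_def by blast
  define pl :: "('n \<Rightarrow> nat) \<times> ('n \<Rightarrow> nat) \<Rightarrow> 'n \<Rightarrow> nat" where "pl = (\<lambda>(m, m') i. m i + m' i)"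
  let ?c = "\<lambda>q. \<Sum>mm\<in>{mm \<in> S \<times> S'. pl mm = q}. c (fst mm) * c' (snd mm)"
  have "f x * g x = (\<Sum>q\<in>pl ` (S \<times> S'). ?c q * (\<Prod>i\<in>UNIV. (x $ i) ^ q i))" for x
  proof -
    let ?X = "\<lambda>m. \<Prod>i\<in>UNIV. (x $ i) ^ m i"
    have X: "?X (pl mm) = ?X (fst mm) * ?X (snd mm)" for mm
      by (simp add: pl_def case_prod_unfold power_add prod.distrib)
    have "f x * g x = (\<Sum>mm\<in>S \<times> S'. c (fst mm) * c' (snd mm) * ?X (pl mm))"
      unfolding f(2) g(2) sum_product sum.cartesian_product X
      by (intro sum.cong refl) (simp add: case_prod_unfold mult_ac)
    also have "\<dots> = (\<Sum>q\<in>pl ` (S \<times> S'). \<Sum>mm\<in>{mm \<in> S \<times> S'. pl mm = q}. c (fst mm) * c' (snd mm) * ?X (pl mm))"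
      using f(1) g(1) by (intro sum.image_gen) auto
    also have "\<dots> = (\<Sum>q\<in>pl ` (S \<times> S'). ?c q * ?X q)"
      unfolding sum_distrib_right by (intro sum.cong refl) auto
    finally show ?thesis .
  qed
  then show ?thesis unfolding poly_fun_def using f(1) g(1)
    by (intro exI[of _ "pl ` (S \<times> S')"] exI[of _ ?c]) blast
qed

lemma poly_fun_sum: "(\<And>a. a \<in> A \<Longrightarrow> poly_fun (f a)) \<Longrightarrow> poly_fun (\<lambda>x. \<Sum>a\<in>A. f a x)"
  by (induction A rule: infinite_finite_induct) (auto intro: poly_fun_const poly_fun_add)

lemma poly_fun_poly_expr:
  assumes "poly_expr f" "\<And>i. poly_fun (\<lambda>x. g x i)"
  shows "poly_fun (\<lambda>x. f (g x))"
  using assms(1)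
  by (induction rule: poly_expr.induct) (auto intro: poly_fun_const poly_fun_add poly_fun_mult assms(2))

section \<open>Keller maps in coordinates\<close>

lemma has_field_derivative_mon:
  "((\<lambda>t. mon (x(v := t)) vs) has_field_derivative dmon x (\<lambda>l. if l = v then 1 else 0) vs) (at (x v))"
proof (induction vs)
  case (Cons u vs)
  have "((\<lambda>t. (x(v := t)) u) has_field_derivative (if u = v then 1 else 0)) (at (x v))"
    by (cases "u = v") auto
  from DERIV_mult[OF this Cons] show ?case by (simp add: algebra_simps)
qed simp

lemma has_field_derivative_pert:
  "((\<lambda>t. pert L (x(v := t)) i) has_field_derivative dpert L x (\<lambda>l. if l = v then 1 else 0) i) (at (x v))"
proof (induction L)
  case (Cons t L)
  obtain c vs k where t: "t = (c, vs, k)" by (cases t)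
  have "((\<lambda>t. if k = i then c * mon (x(v := t)) vs else 0) has_field_derivative
      (if k = i then c * dmon x (\<lambda>l. if l = v then 1 else 0) vs else 0)) (at (x v))"
    by (cases "k = i") (auto intro: DERIV_cmult has_field_derivative_mon)
  from DERIV_add[OF this Cons] show ?case unfolding t pert_simps dpert_simps .
qed simp

lemma dmon_sum: "dmon x (\<lambda>i. \<Sum>k\<in>K. a k * u k i) vs = (\<Sum>k\<in>K. a k * dmon x (u k) vs)"
  by (induction vs) (simp_all add: sum_distrib_left sum_distrib_right sum.distrib algebra_simps)

lemma dpert_sum: "dpert L x (\<lambda>i. \<Sum>k\<in>K. a k * u k i) i = (\<Sum>k\<in>K. a k * dpert L x (u k) i)"
proof (induction L)
  case (Cons t L)
  then show ?case
    by (cases t) (simp add: dmon_sum sum_distrib_left sum.distrib algebra_simps)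
qed simp

text \<open>The theorem fixes the dimension by a type, the reductions work with sequences; one
  enumeration \<open>e\<close> of the index type links the two.\<close>

locale coordinates =
  fixes e :: "nat \<Rightarrow> 'n::finite" and n :: nat
  assumes bij: "bij_betw e {..<n} UNIV"
begin

definition ix :: "'n \<Rightarrow> nat" where
  "ix = inv_into {..<n} e"

definition emb :: "complex ^ 'n \<Rightarrow> nat \<Rightarrow> complex" where
  "emb x i = (if i < n then x $ e i else 0)"

definition proj :: "(nat \<Rightarrow> complex) \<Rightarrow> complex ^ 'n" where
  "proj w = (\<chi> j. w (ix j))"

lemma ix_less [simp]: "ix j < n" and e_ix [simp]: "e (ix j) = j"
  using bij_betw_inv_into[OF bij] bij_betw_inv_into_right[OF bij, of j]
  by (auto simp: ix_def bij_betw_def)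

lemma ix_e [simp]: "i < n \<Longrightarrow> ix (e i) = i"
  using bij_betw_inv_into_left[OF bij] by (simp add: ix_def)

lemma emb_ix [simp]: "emb x (ix j) = x $ j"
  by (simp add: emb_def)

lemma proj_emb [simp]: "proj (emb x) = x"
  by (simp add: proj_def vec_eq_iff)

lemma emb_proj: "(\<And>i. n \<le> i \<Longrightarrow> w i = 0) \<Longrightarrow> emb (proj w) = w"
  by (auto simp: emb_def proj_def fun_eq_iff)

lemma emb_proj_below: "i < n \<Longrightarrow> emb (proj w) i = w i"
  by (simp add: emb_def proj_def)

lemma emb_eq_sum: "emb h = (\<lambda>i. \<Sum>k\<in>UNIV. h $ k * (if i = ix k then 1 else 0))"
proof
  fix i
  show "emb h i = (\<Sum>k\<in>UNIV. h $ k * (if i = ix k then 1 else 0))"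
  proof (cases "i < n")
    case True
    then have "(\<Sum>k\<in>UNIV. h $ k * (if i = ix k then 1 else 0)) = (\<Sum>k\<in>UNIV. if k = e i then h $ k else 0)"
      by (intro sum.cong) auto
    then show ?thesis using True by (simp add: emb_def)
  next
    case False
    then have "i \<noteq> ix k" for k using ix_less[of k] by auto
    then show ?thesis using False by (simp add: emb_def)
  qed
qed

definition word :: "('n \<Rightarrow> nat) \<Rightarrow> nat list" where
  "word m = concat (map (\<lambda>i. replicate (m (e i)) i) [0..<n])"

lemma mon_emb_word: "mon (emb x) (word m) = (\<Prod>k\<in>UNIV. (x $ k) ^ m k)"
proof -
  have "mon y (concat (map (\<lambda>i. replicate (m (e i)) i) [0..<l])) = (\<Prod>i<l. y i ^ m (e i))" for l and y :: "nat \<Rightarrow> complex"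
    by (induction l) simp_all
  then have "mon (emb x) (word m) = (\<Prod>i<n. (x $ e i) ^ m (e i))"
    unfolding word_def by (simp add: emb_def)
  also have "\<dots> = (\<Prod>k\<in>UNIV. (x $ k) ^ m k)"
    by (rule prod.reindex_bij_betw[OF bij])
  finally show ?thesis .
qed

lemma set_word: "set (word m) \<subseteq> {..<n}"
  by (auto simp: word_def)

lemma poly_map_as_terms:
  fixes F :: "complex ^ 'n \<Rightarrow> complex ^ 'n"
  assumes "poly_map F"
  shows "\<exists>L. vars_below n L \<and> (\<forall>x j. F x $ j = pert L (emb x) (ix j))"
proof -
  have "\<forall>j. \<exists>S c. finite S \<and> (\<forall>x. F x $ j = (\<Sum>m\<in>S. c m * (\<Prod>i\<in>UNIV. (x $ i) ^ m i)))"
    using assms unfolding poly_map_def poly_fun_def by blast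
  then obtain S where "\<forall>j. \<exists>c. finite (S j) \<and> (\<forall>x. F x $ j = (\<Sum>m\<in>S j. c m * (\<Prod>i\<in>UNIV. (x $ i) ^ m i)))"
    by metis
  then obtain c where S: "\<And>j. finite (S j)"
    and F: "\<And>x j. F x $ j = (\<Sum>m\<in>S j. c j m * (\<Prod>i\<in>UNIV. (x $ i) ^ m i))"
    by metis
  have "finite (Sigma UNIV S)" using S by auto
  then obtain T where T: "distinct T" "set T = Sigma UNIV S" using finite_distinct_list by metis
  define L where "L = map (\<lambda>(j, m). (c j m, word m, ix j)) T"
  have ix_eq: "ix j' = ix j \<longleftrightarrow> j' = j" for j j' by (metis e_ix)
  have "pert L (emb x) (ix j) = F x $ j" for x j
  proof -
    have "pert L (emb x) (ix j) = (\<Sum>jm\<leftarrow>T. if fst jm = j then c j (snd jm) * (\<Prod>k\<in>UNIV. (x $ k) ^ snd jm k) else 0)"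
      unfolding pert_def L_def map_map
      by (intro arg_cong[where f = sum_list] map_cong refl) (auto simp: ix_eq mon_emb_word)
    also have "\<dots> = (\<Sum>jm\<in>Sigma UNIV S. if fst jm = j then c j (snd jm) * (\<Prod>k\<in>UNIV. (x $ k) ^ snd jm k) else 0)"
      using T by (simp add: sum_list_distinct_conv_sum_set)
    also have "\<dots> = (\<Sum>j'\<in>UNIV. \<Sum>m\<in>S j'. if j' = j then c j m * (\<Prod>k\<in>UNIV. (x $ k) ^ m k) else 0)"
      using S by (subst sum.Sigma) (auto simp: case_prod_unfold)
    also have "\<dots> = (\<Sum>j'\<in>UNIV. if j' = j then \<Sum>m\<in>S j. c j m * (\<Prod>k\<in>UNIV. (x $ k) ^ m k) else 0)"
      by (intro sum.cong refl) auto
    finally show ?thesis by (simp add: F)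
  qed
  moreover have "vars_below n L" using set_word by (auto simp: vars_below_def L_def)
  ultimately show ?thesis by metis
qed

lemma jacobian_matrix_mult:
  fixes F :: "complex ^ 'n \<Rightarrow> complex ^ 'n"
  assumes F: "\<And>x j. F x $ j = pert L (emb x) (ix j)"
  shows "(jacobian_matrix F x *v h) $ j = dpert L (emb x) (emb h) (ix j)"
proof -
  have upd: "emb (\<chi> l. if l = k then t else x $ l) = (emb x)(ix k := t)" for k t
    by (auto simp: emb_def fun_eq_iff)
  have "jacobian_matrix F x $ j $ k = dpert L (emb x) (\<lambda>l. if l = ix k then 1 else 0) (ix j)" for k
    using DERIV_imp_deriv[OF has_field_derivative_pert[of L "emb x" "ix k" "ix j"]]
    by (simp add: jacobian_matrix_def F upd)
  then have "(jacobian_matrix F x *v h) $ j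
      = (\<Sum>k\<in>UNIV. h $ k * dpert L (emb x) (\<lambda>l. if l = ix k then 1 else 0) (ix j))"
    by (simp add: matrix_vector_mult_def mult.commute)
  also have "\<dots> = dpert L (emb x) (emb h) (ix j)"
    unfolding emb_eq_sum[of h] dpert_sum ..
  finally show ?thesis .
qed

text \<open>Encodes the linear map \<open>B\<close> applied after \<open>pert L\<close>: each term
  is copied into all components, weighted by a column of \<open>B\<close>.\<close>

definition transform_terms :: "complex ^ 'n ^ 'n \<Rightarrow> monomial_term list \<Rightarrow> monomial_term list" where
  "transform_terms B L = concat (map (\<lambda>(c, vs, k). map (\<lambda>i. (B $ e i $ e k * c, vs, i)) [0..<n]) L)"

text \<open>The function \<phi> on words is left general to cover both the values and the
  derivatives.\<close>

lemma transform_terms_sum: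
  assumes "vars_below n L" "i < n"
  shows "(\<Sum>(c, vs, k)\<leftarrow>transform_terms B L. if k = i then c * \<phi> vs else 0)
       = (\<Sum>j\<in>UNIV. B $ e i $ j * (\<Sum>(c, vs, k)\<leftarrow>L. if k = ix j then c * \<phi> vs else 0))"
  using assms(1)
proof (induction L)
  case Nil
  then show ?case by (simp add: transform_terms_def)
next
  case (Cons t L)
  obtain c vs k where t: "t = (c, vs, k)" by (cases t)
  have k: "k < n" using Cons.prems t by simp
  have "(\<Sum>j\<in>UNIV. B $ e i $ j * (if k = ix j then c * \<phi> vs else 0)) = (\<Sum>j\<in>UNIV. if j = e k then B $ e i $ j * (c * \<phi> vs) else 0)"
    using k by (intro sum.cong refl) auto
  then have 1: "(\<Sum>j\<in>UNIV. B $ e i $ j * (if k = ix j then c * \<phi> vs else 0)) = B $ e i $ e k * (c * \<phi> vs)"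
    by simp
  have "(\<Sum>(c, vs, k)\<leftarrow>map (\<lambda>i. (B $ e i $ e k * c, vs, i)) [0..<n]. if k = i then c * \<phi> vs else 0)
      = (\<Sum>l\<leftarrow>[0..<n]. if l = i then B $ e l $ e k * c * \<phi> vs else 0)"
    by (simp add: o_def)
  also have "\<dots> = B $ e i $ e k * c * \<phi> vs" unfolding sum_list_indicator using assms(2) by simp
  finally have 2: "(\<Sum>(c, vs, k)\<leftarrow>map (\<lambda>i. (B $ e i $ e k * c, vs, i)) [0..<n]. if k = i then c * \<phi> vs else 0)
      = B $ e i $ e k * c * \<phi> vs" .
  have "transform_terms B (t # L) = map (\<lambda>i. (B $ e i $ e k * c, vs, i)) [0..<n] @ transform_terms B L"
    by (simp add: transform_terms_def t)
  then show ?case using Cons 1 2 by (simp add: t distrib_left sum.distrib mult.assoc)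
qed

lemma pert_transform_terms:
  "vars_below n L \<Longrightarrow> i < n \<Longrightarrow> pert (transform_terms B L) x i = (B *v (\<chi> j. pert L x (ix j))) $ e i"
  unfolding pert_def by (simp add: transform_terms_sum matrix_vector_mult_def)

lemma dpert_transform_terms:
  "vars_below n L \<Longrightarrow> i < n \<Longrightarrow> dpert (transform_terms B L) x h i = (B *v (\<chi> j. dpert L x h (ix j))) $ e i"
  unfolding dpert_def by (simp add: transform_terms_sum matrix_vector_mult_def)

text \<open>Write F(x) = a + M x + R(x) with R of order at least 2. For B the inverse of M, the map
  B(F - a) = x + B R(x) has the form required by \<open>base\<close>, and its inverse gives that of
  \<open>F\<close> by undoing the affine change.\<close>

lemma keller_reduction:
  fixes F :: "complex ^ 'n \<Rightarrow> complex ^ 'n"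
  assumes base: "\<And>N L. vars_below N L \<Longrightarrow> degrees_in {2..} L \<Longrightarrow> nonsingular L \<Longrightarrow> poly_invertible L"
    and keller: "keller_map F"
  shows "poly_automorphism F"
proof -
  obtain L0 where L0: "vars_below n L0" and F: "\<And>x j. F x $ j = pert L0 (emb x) (ix j)"
    using poly_map_as_terms[of F] keller by (auto simp: keller_map_def)
  define LC where "LC = filter (\<lambda>(c, vs, k). length vs = 0) L0"
  define LL where "LL = filter (\<lambda>(c, vs, k). length vs = 1) L0"
  define LR where "LR = filter (\<lambda>(c, vs, k). 2 \<le> length vs) L0"
  have LR: "vars_below n LR" using L0 by (auto simp: LR_def vars_below_def)
  \<comment> \<open>A linear form is its own derivative, so the linear part is written as
    \<open>dpert LL\<close> at 0, the form in which the Jacobian at 0 produces it.\<close>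
  have split: "pert L0 x i = pert LC (\<lambda>_. 0) i + dpert LL (\<lambda>_. 0) x i + pert LR x i" for x i
    unfolding LC_def LL_def LR_def
  proof (induction L0)
    case (Cons t L)
    obtain c vs k where t: "t = (c, vs, k)" by (cases t)
    consider "vs = []" | v where "vs = [v]" | "2 \<le> length vs"
      by (cases vs rule: list.exhaust; cases "tl vs") auto
    then show ?case using Cons by cases (auto simp: t)
  qed simp
  have dsplit: "dpert L0 x h i = dpert LL (\<lambda>_. 0) h i + dpert LR x h i" for x h i
    unfolding LL_def LR_def
  proof (induction L0)
    case (Cons t L)
    obtain c vs k where t: "t = (c, vs, k)" by (cases t)
    consider "vs = []" | v where "vs = [v]" | "2 \<le> length vs"
      by (cases vs rule: list.exhaust; cases "tl vs") auto
    then show ?case using Cons by cases (auto simp: t)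
  qed simp
  have dLR0: "dpert LR (\<lambda>_. 0) h i = 0" for h i
    unfolding LR_def
  proof (induction L0)
    case (Cons t L)
    obtain c vs k where t: "t = (c, vs, k)" by (cases t)
    show ?case
    proof (cases "2 \<le> length vs")
      case True
      then obtain u v us where "vs = u # v # us" by (cases vs rule: list.exhaust; cases "tl vs") auto
      then show ?thesis using Cons by (simp add: t)
    qed (use Cons in \<open>simp add: t\<close>)
  qed simp
  define M where "M = jacobian_matrix F 0"
  have emb0: "emb 0 = (\<lambda>_. 0)" by (simp add: emb_def fun_eq_iff)
  have M: "(M *v h) $ j = dpert LL (\<lambda>_. 0) (emb h) (ix j)" for h j
    unfolding M_def jacobian_matrix_mult[OF F] emb0 dsplit dLR0 by simp
  have invertible: "invertible (jacobian_matrix F x)" for x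
    using keller unfolding keller_map_def by (metis invertible_det_nz)
  obtain B where B: "M ** B = mat 1" "B ** M = mat 1"
    using invertible[of 0] unfolding invertible_def M_def by blast
  have inj: "jacobian_matrix F x *v h = 0 \<Longrightarrow> h = 0" for x h
    using invertible by (metis inj_matrix_vector_mult injD matrix_vector_mult_0_right)
  have BM: "B *v (M *v h) = h" and MB: "M *v (B *v h) = h" for h
    by (simp_all add: matrix_vector_mul_assoc B)
  define a where "a = (\<chi> j. pert LC (\<lambda>_. 0) (ix j))"
  define R where "R x = (\<chi> j. pert LR (emb x) (ix j))" for x
  have F': "F x = a + M *v x + R x" for x
    by (simp add: vec_eq_iff F split a_def M R_def)
  define L where "L = transform_terms B LR"
  have L: "vars_below n L" "degrees_in {2..} L"
    using LR unfolding L_def transform_terms_def LR_def vars_below_def degrees_in_def by auto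
  have pm: "pert_map L (emb x) = emb (B *v (F x - a))" for x
  proof
    fix i
    have "B *v (F x - a) = x + B *v R x"
      by (simp add: F' matrix_vector_right_distrib BM)
    then show "pert_map L (emb x) i = emb (B *v (F x - a)) i"
      using pert_transform_terms[OF LR, of i B "emb x"] pert_outside[OF L(1), of i "emb x"]
      by (cases "i < n") (simp_all add: pert_map_def L_def R_def emb_def)
  qed
  have "nonsingular L"
    unfolding nonsingular_def
  proof (intro allI impI)
    fix x h i assume zero: "\<forall>i. h i + dpert L x h i = 0"
    have out: "h i = 0" if "n \<le> i" for i
      using zero[rule_format, of i] dpert_outside[OF L(1) that] by simp
    define h' x' where "h' = proj h" and "x' = proj x"
    have h: "h = emb h'" unfolding h'_def using emb_proj[of h] out by simp
    define D where "D = (\<chi> j. dpert LR (emb x') (emb h') (ix j))"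
    have "h' + B *v D = 0"
    proof (rule vec_eq_iff[THEN iffD2], rule allI)
      fix j
      have "dpert L x h (ix j) = dpert L (emb x') (emb h') (ix j)"
        unfolding h x'_def by (rule dpert_cong[OF L(1)]) (simp_all add: emb_proj_below)
      then have "dpert L x h (ix j) = (B *v D) $ j"
        using dpert_transform_terms[OF LR, of "ix j" B "emb x'" "emb h'"] by (simp add: L_def D_def)
      then show "(h' + B *v D) $ j = 0 $ j" using zero[rule_format, of "ix j"] by (simp add: h)
    qed
    \<comment> \<open>Multiplying by M undoes B, and the equation becomes that of a kernel vector of
      the Jacobian of \<open>F\<close> at \<open>x'\<close>.\<close>
    then have "M *v (h' + B *v D) = 0" by simp
    then have "M *v h' + D = 0" by (simp add: matrix_vector_right_distrib MB)
    moreover have "jacobian_matrix F x' *v h' = M *v h' + D"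
      by (simp add: vec_eq_iff jacobian_matrix_mult[OF F] dsplit M D_def)
    ultimately have "h' = 0" using inj by simp
    then show "h i = 0" by (simp add: h emb_def)
  qed
  then obtain G where G: "\<And>i. poly_expr (\<lambda>x. G x i)" "\<And>x. G (pert_map L x) = x" "\<And>x. pert_map L (G x) = x"
    using base[OF L] unfolding poly_invertible_def by blast
  define Fi where "Fi w = proj (G (emb (B *v (w - a))))" for w
  have "poly_map Fi"
    unfolding poly_map_def
  proof
    fix j
    have "poly_fun (\<lambda>w. emb (B *v (w - a)) i)" for i
    proof (cases "i < n")
      case True
      have "poly_fun (\<lambda>w. \<Sum>l\<in>UNIV. B $ e i $ l * (w $ l + (- a $ l)))"
        by (intro poly_fun_sum poly_fun_mult poly_fun_add poly_fun_const poly_fun_var)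
      then show ?thesis using True by (simp add: emb_def matrix_vector_mult_def)
    next
      case False
      then show ?thesis by (simp add: emb_def poly_fun_const)
    qed
    then have "poly_fun (\<lambda>w. G (emb (B *v (w - a))) (ix j))" by (rule poly_fun_poly_expr[OF G(1)])
    then show "poly_fun (\<lambda>w. Fi w $ j)" by (simp add: Fi_def proj_def)
  qed
  moreover have "Fi (F x) = x" for x
    by (simp add: Fi_def pm[symmetric] G(2))
  moreover have "F (Fi w) = w" for w
  proof -
    let ?u = "B *v (w - a)" and ?z = "G (emb (B *v (w - a)))"
    \<comment> \<open>Beyond \<open>n\<close> the map is the identity and the target is 0, so
      passing through \<open>proj\<close> loses nothing.\<close>
    have "?z i = 0" if "n \<le> i" for i
      using fun_cong[OF G(3)[of "emb ?u"], of i] pert_outside[OF L(1) that, of ?z] that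
      by (simp add: pert_map_def emb_def)
    then have "emb (Fi w) = ?z" unfolding Fi_def by (rule emb_proj)
    then have "emb (B *v (F (Fi w) - a)) = emb ?u" using pm[of "Fi w"] G(3) by simp
    then have "B *v (F (Fi w) - a) = ?u" by (metis proj_emb)
    then have "F (Fi w) - a = w - a" by (metis MB)
    then show ?thesis by simp
  qed
  ultimately show ?thesis
    using keller unfolding poly_automorphism_def keller_map_def
    by (intro conjI exI[of _ Fi]) (auto simp: fun_eq_iff)
qed

end

theorem theorem1p6:
  assumes "\<exists>d::nat. 3 \<le> d \<and>
             (\<forall>p::nat. 1 \<le> p \<longrightarrow>
                (\<exists>k0. \<forall>k \<ge> k0. \<exists>P. is_shuffle_family d p k P \<and> uniform_stationary d p k P))"
  shows "\<forall>F :: complex ^ 'n \<Rightarrow> complex ^ 'n. keller_map F \<longrightarrow> poly_automorphism F"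
proof (intro allI impI)
  fix F :: "complex ^ 'n \<Rightarrow> complex ^ 'n"
  assume keller: "keller_map F"
  obtain d :: nat where d: "3 \<le> d"
    and chains: "\<And>p. 1 \<le> p \<Longrightarrow> \<exists>k0. \<forall>k\<ge>k0. \<exists>P. is_shuffle_family d p k P \<and> uniform_stationary d p k P"
    using assms by blast
  obtain e :: "nat \<Rightarrow> 'n" where "bij_betw e {0..<CARD('n)} UNIV"
    using ex_bij_betw_nat_finite[of "UNIV :: 'n set"] by auto
  then interpret coordinates e "CARD('n)"
    by unfold_locales (simp add: atLeast0LessThan)
  \<comment> \<open>The reduction ends in degree exactly \<open>d\<close>, the one arity for which
    chains are given, with \<open>N\<close> arbitrary.\<close>
  have homogeneous: "poly_invertible L" if "vars_below N L" "degrees_in {d} L" "nonsingular L" for N L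
    using homogeneous_poly_invertible[OF _ chains that] d by simp
  have cubic: "poly_invertible L" if "vars_below N L" "degrees_in {2, 3} L" "nonsingular L" for N L
    using reduce_to_homogeneous[OF d homogeneous that] .
  have "poly_invertible L" if "vars_below N L" "degrees_in {2..} L" "nonsingular L" for N L
    using reduce_to_cubic[OF cubic that] .
  then show "poly_automorphism F" by (rule keller_reduction[OF _ keller])
qed

end
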